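(* Let $M$ be a complex surface with canonical line bundle $K=\Lambda^2T^*$, and let $V$ be a rank $2$ holomorphic vector bundle on $M$ with a fixed isomorphism $\Lambda^2V\cong K^*=\Lambda^2T$. Let $s_1,s_2$ be two holomorphic sections of $V$ which are generically linearly independent. Let $\sigma=s_1\wedge s_2$, regarded as a holomorphic section of $\Lambda^2V\cong K^*=\Lambda^2T$, i.e. as a holomorphic Poisson structure on $M$, and let $C$ be its zero set. On $M\setminus C$ the sections $s_1,s_2$ trivialize $V$; let $\nabla$ be the flat holomorphic connection on $V|_{M\setminus C}$ with $\nabla s_1=\nabla s_2=0$. Then $\nabla$ extends to a Poisson module structure on $V$ over $M$; that is, there is a Poisson module structure $(f,s)\mapsto\{f,s\}$ on $\mathcal{O}(V)$ over the holomorphic Poisson manifold $(M,\sigma)$ whose restriction to $M\setminus C$ is $\{f,s\}=\nabla_{\sigma(df)}s$.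
   Context: $T$ is the holomorphic tangent bundle of $M$. For a holomorphic section $\sigma$ of $\Lambda^2T$ that is Poisson (automatic on a complex surface), the Poisson bracket of local holomorphic functions is $\{f,g\}=\sigma(df,dg)$, and $\sigma(df)$ denotes the Hamiltonian vector field, $\sigma(df)(g)=\{f,g\}$. A Poisson module structure on a holomorphic vector bundle $V$ over a holomorphic Poisson manifold $(M,\sigma)$ is an action $s\mapsto\{f,s\}$ of the structure sheaf $\mathcal{O}$ on the locally free sheaf $\mathcal{O}(V)$ such that for local holomorphic functions $f,g$ and local holomorphic sections $s$: (i) $\{f,gs\}=\{f,g\}s+g\{f,s\}$; (ii) $\{\{f,g\},s\}=\{f,\{g,s\}\}-\{g,\{f,s\}\}$. The action is given by a first order holomorphic linear differential operator $D:\mathcal{O}(V)\to\mathcal{O}(V\otimes T)$ through $\{f,s\}=\langle Ds,df\rangle$. Where $\sigma$ is nondegenerate, it identifies $T^*$ with $T$, and a Poisson module structure is then the same as a flat holomorphic connection $\nabla$, via $\{f,s\}=\nabla_{\sigma(df)}s$. *)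

theory Defs
  imports "HOL-Analysis.Analysis" "HOL-Library.Function_Algebras"
begin

text \<open>A chart is a pair of its domain and its coordinate map; the values of the coordinate map
  off the domain are irrelevant. The manifold is the whole type \<open>'m\<close>, its complex
  dimension is the cardinality of \<open>'n\<close>.\<close>

type_synonym ('m, 'n) chart = "'m set \<times> ('m \<Rightarrow> complex^'n)"

abbreviation cdom :: "('m, 'n::finite) chart \<Rightarrow> 'm set" where "cdom c \<equiv> fst c"

abbreviation coord :: "('m, 'n::finite) chart \<Rightarrow> 'm \<Rightarrow> complex^'n" where "coord c \<equiv> snd c"

definition param :: "('m, 'n::finite) chart \<Rightarrow> complex^'n \<Rightarrow> 'm" where
  "param c = inv_into (cdom c) (coord c)"

text \<open>To be used on open sets only: the derivative is taken in a full neighbourhood.\<close>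

definition holo_on :: "(complex^'n::finite) set \<Rightarrow> (complex^'n \<Rightarrow> complex) \<Rightarrow> bool" where
  "holo_on S f \<longleftrightarrow>
     (\<forall>z\<in>S. \<exists>f'. (f has_derivative f') (at z) \<and> (\<forall>c v. f' (c *s v) = c * f' v))"

definition complex_manifold ::
  "('m::{t2_space,second_countable_topology}, 'n::finite) chart set \<Rightarrow> bool" where
  "complex_manifold A \<longleftrightarrow>
     (\<Union>c\<in>A. cdom c) = UNIV \<and>
     (\<forall>c\<in>A. open (cdom c) \<and> open (coord c ` cdom c) \<and>
        homeomorphism (cdom c) (coord c ` cdom c) (coord c) (param c)) \<and>
     (\<forall>c\<in>A. \<forall>d\<in>A. \<forall>i. holo_on (coord c ` (cdom c \<inter> cdom d)) (\<lambda>z. coord d (param c z) $ i))"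

text \<open>\<open>\<O>(U)\<close> for open \<open>U\<close>; values off \<open>U\<close> are irrelevant.\<close>

definition holo :: "('m, 'n::finite) chart set \<Rightarrow> 'm set \<Rightarrow> ('m \<Rightarrow> complex) set" where
  "holo A U = {f. \<forall>c\<in>A. holo_on (coord c ` (U \<inter> cdom c)) (\<lambda>z. f (param c z))}"

text \<open>The fibres are linear subspaces of one ambient complex vector space \<open>'v\<close> with scalar
  multiplication \<open>Scl\<close>. The ambient space carries no topology and may be the direct sum of
  all the fibres, so this loses no generality. A local trivialization is an open set \<open>U\<close>
  together with linear isomorphisms from the fibres over \<open>U\<close> to \<open>complex^'r\<close>; the rank is
  the cardinality of \<open>'r\<close>.\<close>

record ('m, 'v, 'r) hbundle =
  Fib :: "'m \<Rightarrow> 'v set"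
  Scl :: "complex \<Rightarrow> 'v \<Rightarrow> 'v"
  Triv :: "('m set \<times> ('m \<Rightarrow> 'v \<Rightarrow> complex^'r)) set"

definition holo_bundle ::
  "('m::topological_space, 'n::finite) chart set \<Rightarrow> ('m, 'v::ab_group_add, 'r::finite) hbundle \<Rightarrow> bool"
where
  "holo_bundle A E \<longleftrightarrow>
     vector_space (Scl E) \<and>
     (\<forall>p. module.subspace (Scl E) (Fib E p)) \<and>
     (\<Union>(U, \<Phi>)\<in>Triv E. U) = UNIV \<and>
     (\<forall>(U, \<Phi>)\<in>Triv E. open U \<and>
        (\<forall>p\<in>U. bij_betw (\<Phi> p) (Fib E p) UNIV \<and>
           (\<forall>x\<in>Fib E p. \<forall>y\<in>Fib E p. \<Phi> p (x + y) = \<Phi> p x + \<Phi> p y) \<and>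
           (\<forall>a. \<forall>x\<in>Fib E p. \<Phi> p (Scl E a x) = a *s \<Phi> p x))) \<and>
     (\<forall>(U, \<Phi>)\<in>Triv E. \<forall>(W, \<Psi>)\<in>Triv E. \<forall>x i.
        (\<lambda>p. \<Psi> p (inv_into (Fib E p) (\<Phi> p) x) $ i) \<in> holo A (U \<inter> W))"

text \<open>Holomorphic sections over an open set \<open>U\<close>; values off \<open>U\<close> are irrelevant.\<close>

definition sections ::
  "('m, 'n::finite) chart set \<Rightarrow> ('m, 'v, 'r::finite) hbundle \<Rightarrow> 'm set \<Rightarrow> ('m \<Rightarrow> 'v) set" where
  "sections A E U =
     {s. (\<forall>p\<in>U. s p \<in> Fib E p) \<and>
         (\<forall>(W, \<Phi>)\<in>Triv E. \<forall>i. (\<lambda>p. \<Phi> p (s p) $ i) \<in> holo A (U \<inter> W))}"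

definition trivial_line :: "('m, complex, 1) hbundle" where
  "trivial_line = \<lparr>Fib = (\<lambda>p. UNIV), Scl = (*), Triv = {(UNIV, \<lambda>p z. \<chi> i. z)}\<rparr>"

text \<open>\<open>Hom(E, F) = E\<^sup>* \<otimes> F\<close>. A linear map between fibres is extended by zero to the ambient
  space, so that it is determined by its restriction to the fibre. The trivialization takes
  matrix entries.\<close>

definition hom_bundle ::
  "('m, 'v::ab_group_add, 'r::finite) hbundle \<Rightarrow> ('m, 'w::ab_group_add, 'q::finite) hbundle
    \<Rightarrow> ('m, 'v \<Rightarrow> 'w, 'q \<times> 'r) hbundle" where
  "hom_bundle E F =
     \<lparr>Fib = (\<lambda>p. {L. (\<forall>x\<in>Fib E p. L x \<in> Fib F p) \<and>
                    (\<forall>x\<in>Fib E p. \<forall>y\<in>Fib E p. L (x + y) = L x + L y) \<and>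
                    (\<forall>a. \<forall>x\<in>Fib E p. L (Scl E a x) = Scl F a (L x)) \<and>
                    (\<forall>x. x \<notin> Fib E p \<longrightarrow> L x = 0)}),
      Scl = (\<lambda>a L x. Scl F a (L x)),
      Triv = {(U \<inter> W, \<lambda>p L. \<chi> k.
                 \<Psi> p (L (inv_into (Fib E p) (\<Phi> p) (axis (snd k) 1))) $ fst k) | U \<Phi> W \<Psi>.
               (U, \<Phi>) \<in> Triv E \<and> (W, \<Psi>) \<in> Triv F}\<rparr>"

abbreviation dual_bundle ::
  "('m, 'v::ab_group_add, 'r::finite) hbundle \<Rightarrow> ('m, 'v \<Rightarrow> complex, 1 \<times> 'r) hbundle" where
  "dual_bundle E \<equiv> hom_bundle E trivial_line"

text \<open>The exterior square of a bundle of rank 2. Its fibre consists of the alternating bilinear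
  forms on the dual fibre (extended by zero), and
  \<open>(x \<and> y)(\<alpha>, \<beta>) = \<alpha>(x) \<beta>(y) - \<alpha>(y) \<beta>(x)\<close>. A local frame \<open>e\<^sub>1, e\<^sub>2\<close> of \<open>E\<close> gives the frame
  \<open>e\<^sub>1 \<and> e\<^sub>2\<close>, with respect to which \<open>B\<close> has the coordinate \<open>B(e\<^sup>1, e\<^sup>2)\<close>.\<close>

definition ext2 ::
  "('m, 'v::ab_group_add, 2) hbundle \<Rightarrow> ('m, ('v \<Rightarrow> complex) \<Rightarrow> ('v \<Rightarrow> complex) \<Rightarrow> complex, 1) hbundle"
where
  "ext2 E =
     \<lparr>Fib = (\<lambda>p. let E' = Fib (dual_bundle E) p in
         {B. (\<forall>\<alpha>\<in>E'. \<forall>\<beta>\<in>E'. \<forall>\<gamma>\<in>E'.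
                B (\<alpha> + \<beta>) \<gamma> = B \<alpha> \<gamma> + B \<beta> \<gamma> \<and> B \<gamma> (\<alpha> + \<beta>) = B \<gamma> \<alpha> + B \<gamma> \<beta>) \<and>
             (\<forall>a. \<forall>\<alpha>\<in>E'. \<forall>\<beta>\<in>E'.
                B (\<lambda>x. a * \<alpha> x) \<beta> = a * B \<alpha> \<beta> \<and> B \<alpha> (\<lambda>x. a * \<beta> x) = a * B \<alpha> \<beta>) \<and>
             (\<forall>\<alpha>\<in>E'. B \<alpha> \<alpha> = 0) \<and>
             (\<forall>\<alpha> \<beta>. \<alpha> \<notin> E' \<or> \<beta> \<notin> E' \<longrightarrow> B \<alpha> \<beta> = 0)}),
      Scl = (\<lambda>a B \<alpha> \<beta>. a * B \<alpha> \<beta>),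
      Triv = {(U, \<lambda>p B. \<chi> i.
                 B (\<lambda>x. if x \<in> Fib E p then \<Phi> p x $ 1 else 0)
                   (\<lambda>x. if x \<in> Fib E p then \<Phi> p x $ 2 else 0)) | U \<Phi>. (U, \<Phi>) \<in> Triv E}\<rparr>"

definition wedge ::
  "('m, 'v::ab_group_add, 2) hbundle \<Rightarrow> 'm \<Rightarrow> 'v \<Rightarrow> 'v \<Rightarrow> ('v \<Rightarrow> complex) \<Rightarrow> ('v \<Rightarrow> complex) \<Rightarrow> complex"
where
  "wedge E p x y = (\<lambda>\<alpha> \<beta>.
     if \<alpha> \<in> Fib (dual_bundle E) p \<and> \<beta> \<in> Fib (dual_bundle E) p
     then \<alpha> x * \<beta> y - \<alpha> y * \<beta> x else 0)"

definition bundle_iso ::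
  "('m, 'n::finite) chart set \<Rightarrow> ('m, 'v::ab_group_add, 'r::finite) hbundle
    \<Rightarrow> ('m, 'w::ab_group_add, 'q::finite) hbundle \<Rightarrow> ('m \<Rightarrow> 'v \<Rightarrow> 'w) \<Rightarrow> bool" where
  "bundle_iso A E F \<theta> \<longleftrightarrow>
     \<theta> \<in> sections A (hom_bundle E F) UNIV \<and> (\<forall>p. bij_betw (\<theta> p) (Fib E p) (Fib F p))"

definition lin_indep2 :: "('m, 'v::ab_group_add, 'r::finite) hbundle \<Rightarrow> 'v \<Rightarrow> 'v \<Rightarrow> bool" where
  "lin_indep2 E x y \<longleftrightarrow> (\<forall>a b. Scl E a x + Scl E b y = 0 \<longrightarrow> a = 0 \<and> b = 0)"

text \<open>A holomorphic tangent vector at \<open>p\<close> is the family of its coordinate vectors in the charts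
  around \<open>p\<close>, related by the derivatives of the coordinate changes.\<close>

type_synonym ('m, 'n) tangent = "('m, 'n) chart \<Rightarrow> complex^'n"

definition tangent_bundle ::
  "('m, 'n::finite) chart set \<Rightarrow> ('m, ('m, 'n) tangent, 'n) hbundle" where
  "tangent_bundle A =
     \<lparr>Fib = (\<lambda>p. {v. (\<forall>c. c \<notin> A \<or> p \<notin> cdom c \<longrightarrow> v c = 0) \<and>
                    (\<forall>c\<in>A. \<forall>d\<in>A. p \<in> cdom c \<inter> cdom d \<longrightarrow>
                       v d = frechet_derivative (\<lambda>z. coord d (param c z)) (at (coord c p)) (v c))}),
      Scl = (\<lambda>a v c. a *s v c),
      Triv = {(cdom c, \<lambda>p v. v c) | c. c \<in> A}\<rparr>"

text \<open>The differential of \<open>f\<close> at \<open>p\<close>, as an element of the cotangent space. It does not depend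
  on the chart chosen.\<close>

definition dif ::
  "('m, 'n::finite) chart set \<Rightarrow> ('m \<Rightarrow> complex) \<Rightarrow> 'm \<Rightarrow> ('m, 'n) tangent \<Rightarrow> complex" where
  "dif A f p = (\<lambda>v.
     if v \<in> Fib (tangent_bundle A) p
     then let c = (SOME c. c \<in> A \<and> p \<in> cdom c)
          in frechet_derivative (\<lambda>z. f (param c z)) (at (coord c p)) (v c)
     else 0)"

definition lie_bracket ::
  "('m::topological_space, 'n::finite) chart set \<Rightarrow> ('m \<Rightarrow> ('m, 'n) tangent)
    \<Rightarrow> ('m \<Rightarrow> ('m, 'n) tangent) \<Rightarrow> 'm \<Rightarrow> ('m, 'n) tangent" where
  "lie_bracket A X Y p =
     (THE Z. Z \<in> Fib (tangent_bundle A) p \<and>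
        (\<forall>W g. open W \<and> p \<in> W \<and> g \<in> holo A W \<longrightarrow>
           dif A g p Z = dif A (\<lambda>q. dif A g q (Y q)) p (X p)
                       - dif A (\<lambda>q. dif A g q (X q)) p (Y p)))"

text \<open>\<open>\<complex>\<close>-linear morphisms of sheaves from \<open>\<O>(E)\<close> to \<open>\<O>(F)\<close> over the open set \<open>W\<close>: for each
  open subset of \<open>W\<close> an operator on sections, compatible with restriction.\<close>

definition sheaf_map ::
  "('m::topological_space, 'n::finite) chart set \<Rightarrow> 'm set
    \<Rightarrow> ('m, 'v::ab_group_add, 'r::finite) hbundle \<Rightarrow> ('m, 'w::ab_group_add, 'q::finite) hbundle
    \<Rightarrow> ('m set \<Rightarrow> ('m \<Rightarrow> 'v) \<Rightarrow> 'm \<Rightarrow> 'w) \<Rightarrow> bool" where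
  "sheaf_map A W E F P \<longleftrightarrow>
     (\<forall>U s. open U \<and> U \<subseteq> W \<and> s \<in> sections A E U \<longrightarrow> P U s \<in> sections A F U) \<and>
     (\<forall>U U' s s'. open U \<and> U \<subseteq> W \<and> open U' \<and> U' \<subseteq> U \<and>
        s \<in> sections A E U \<and> s' \<in> sections A E U' \<and> (\<forall>p\<in>U'. s' p = s p) \<longrightarrow>
        (\<forall>p\<in>U'. P U' s' p = P U s p)) \<and>
     (\<forall>U s t. open U \<and> U \<subseteq> W \<and> s \<in> sections A E U \<and> t \<in> sections A E U \<longrightarrow>
        (\<forall>p\<in>U. P U (\<lambda>q. s q + t q) p = P U s p + P U t p)) \<and>
     (\<forall>U s a. open U \<and> U \<subseteq> W \<and> s \<in> sections A E U \<longrightarrow>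
        (\<forall>p\<in>U. P U (\<lambda>q. Scl E a (s q)) p = Scl F a (P U s p)))"

text \<open>Here \<open>nab U s p\<close> is the linear map \<open>X \<mapsto> (\<nabla>\<^sub>X s)(p)\<close> on the tangent space at \<open>p\<close>.
  The clauses after the first are the Leibniz rule and the vanishing of the curvature.\<close>

definition flat_connection ::
  "('m::topological_space, 'n::finite) chart set \<Rightarrow> 'm set \<Rightarrow> ('m, 'v::ab_group_add, 'r::finite) hbundle
    \<Rightarrow> ('m set \<Rightarrow> ('m \<Rightarrow> 'v) \<Rightarrow> 'm \<Rightarrow> ('m, 'n) tangent \<Rightarrow> 'v) \<Rightarrow> bool" where
  "flat_connection A W V nab \<longleftrightarrow>
     sheaf_map A W V (hom_bundle (tangent_bundle A) V) nab \<and>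
     (\<forall>U f s. open U \<and> U \<subseteq> W \<and> f \<in> holo A U \<and> s \<in> sections A V U \<longrightarrow>
        (\<forall>p\<in>U. \<forall>X\<in>Fib (tangent_bundle A) p.
           nab U (\<lambda>q. Scl V (f q) (s q)) p X
             = Scl V (dif A f p X) (s p) + Scl V (f p) (nab U s p X))) \<and>
     (\<forall>U s X Y. open U \<and> U \<subseteq> W \<and> s \<in> sections A V U \<and>
        X \<in> sections A (tangent_bundle A) U \<and> Y \<in> sections A (tangent_bundle A) U \<longrightarrow>
        (\<forall>p\<in>U. nab U (\<lambda>q. nab U s q (Y q)) p (X p) - nab U (\<lambda>q. nab U s q (X q)) p (Y p)
               = nab U s p (lie_bracket A X Y p)))"

type_synonym 'm bivector =
  "(('m, 2) tangent \<Rightarrow> complex) \<Rightarrow> (('m, 2) tangent \<Rightarrow> complex) \<Rightarrow> complex"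

definition poisson_bracket ::
  "('m, 2) chart set \<Rightarrow> ('m \<Rightarrow> 'm bivector) \<Rightarrow> ('m \<Rightarrow> complex) \<Rightarrow> ('m \<Rightarrow> complex) \<Rightarrow> 'm \<Rightarrow> complex"
where
  "poisson_bracket A \<sigma> f g p = \<sigma> p (dif A f p) (dif A g p)"

definition poisson_structure ::
  "('m::topological_space, 2) chart set \<Rightarrow> ('m \<Rightarrow> 'm bivector) \<Rightarrow> bool" where
  "poisson_structure A \<sigma> \<longleftrightarrow>
     \<sigma> \<in> sections A (ext2 (tangent_bundle A)) UNIV \<and>
     (\<forall>U f g h. open U \<and> f \<in> holo A U \<and> g \<in> holo A U \<and> h \<in> holo A U \<longrightarrow>
        (\<forall>p\<in>U. poisson_bracket A \<sigma> f (poisson_bracket A \<sigma> g h) p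
             + poisson_bracket A \<sigma> g (poisson_bracket A \<sigma> h f) p
             + poisson_bracket A \<sigma> h (poisson_bracket A \<sigma> f g) p = 0))"

definition hamiltonian ::
  "('m::topological_space, 2) chart set \<Rightarrow> ('m \<Rightarrow> 'm bivector) \<Rightarrow> ('m \<Rightarrow> complex)
    \<Rightarrow> 'm \<Rightarrow> ('m, 2) tangent" where
  "hamiltonian A \<sigma> f p =
     (THE X. X \<in> Fib (tangent_bundle A) p \<and>
        (\<forall>W g. open W \<and> p \<in> W \<and> g \<in> holo A W \<longrightarrow> dif A g p X = poisson_bracket A \<sigma> f g p))"

text \<open>Linear differential operators of order at most one: the commutators with two functions
  \<open>g\<close> and \<open>h\<close> vanish.\<close>

definition first_order_op ::
  "('m::topological_space, 'n::finite) chart set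
    \<Rightarrow> ('m, 'v::ab_group_add, 'r::finite) hbundle \<Rightarrow> ('m, 'w::ab_group_add, 'q::finite) hbundle
    \<Rightarrow> ('m set \<Rightarrow> ('m \<Rightarrow> 'v) \<Rightarrow> 'm \<Rightarrow> 'w) \<Rightarrow> bool" where
  "first_order_op A E F P \<longleftrightarrow>
     sheaf_map A UNIV E F P \<and>
     (\<forall>U g h s. open U \<and> g \<in> holo A U \<and> h \<in> holo A U \<and> s \<in> sections A E U \<longrightarrow>
        (\<forall>p\<in>U. P U (\<lambda>q. Scl E (g q * h q) (s q)) p
               - Scl F (g p) (P U (\<lambda>q. Scl E (h q) (s q)) p)
               - Scl F (h p) (P U (\<lambda>q. Scl E (g q) (s q)) p)
               + Scl F (g p * h p) (P U s p) = 0))"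

text \<open>A Poisson module structure: \<open>br U f s\<close> is \<open>{f, s}\<close> for \<open>f\<close> and \<open>s\<close> over the open set \<open>U\<close>.
  The bundle \<open>V \<otimes> T\<close> is taken as \<open>Hom(T\<^sup>*, V)\<close>, so \<open>\<langle>Ds, df\<rangle>\<close> is evaluation. The last clause
  contains the linearity and locality of the action in \<open>f\<close>.\<close>

definition poisson_module ::
  "('m::topological_space, 2) chart set \<Rightarrow> ('m \<Rightarrow> 'm bivector)
    \<Rightarrow> ('m, 'v::ab_group_add, 'r::finite) hbundle
    \<Rightarrow> ('m set \<Rightarrow> ('m \<Rightarrow> complex) \<Rightarrow> ('m \<Rightarrow> 'v) \<Rightarrow> 'm \<Rightarrow> 'v) \<Rightarrow> bool" where
  "poisson_module A \<sigma> V br \<longleftrightarrow>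
     poisson_structure A \<sigma> \<and>
     holo_bundle A V \<and>
     (\<forall>U f. open U \<and> f \<in> holo A U \<longrightarrow> sheaf_map A U V V (\<lambda>U'. br U' f)) \<and>
     (\<forall>U f g s. open U \<and> f \<in> holo A U \<and> g \<in> holo A U \<and> s \<in> sections A V U \<longrightarrow>
        (\<forall>p\<in>U. br U f (\<lambda>q. Scl V (g q) (s q)) p
               = Scl V (poisson_bracket A \<sigma> f g p) (s p) + Scl V (g p) (br U f s p))) \<and>
     (\<forall>U f g s. open U \<and> f \<in> holo A U \<and> g \<in> holo A U \<and> s \<in> sections A V U \<longrightarrow>
        (\<forall>p\<in>U. br U (poisson_bracket A \<sigma> f g) s p
               = br U f (br U g s) p - br U g (br U f s) p)) \<and>
     (\<exists>D. first_order_op A V (hom_bundle (dual_bundle (tangent_bundle A)) V) D \<and>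
        (\<forall>U f s. open U \<and> f \<in> holo A U \<and> s \<in> sections A V U \<longrightarrow>
           (\<forall>p\<in>U. br U f s p = D U s p (dif A f p))))"

end

theory Submission
  imports Defs "HOL-Complex_Analysis.Cauchy_Integral_Formula"
begin

text \<open>Off \<open>C\<close> the connection is determined by the Leibniz rule: if \<open>s = f\<^sub>1 s\<^sub>1 + f\<^sub>2 s\<^sub>2\<close>, then
  \<open>\<nabla>s = df\<^sub>1 s\<^sub>1 + df\<^sub>2 s\<^sub>2\<close> (\<open>flat_connection_unique\<close>), so the module structure must be given there by
  \<open>{f, s} = {f, f\<^sub>1} s\<^sub>1 + {f, f\<^sub>2} s\<^sub>2\<close>. The coefficients \<open>f\<^sub>i\<close> have poles along \<open>C\<close>, and the point of the
  theorem is that \<open>\<sigma>\<close> vanishes there to exactly the order that cancels them. In a trivialization of \<open>V\<close>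
  let \<open>a\<close> be the matrix with columns \<open>s\<^sub>1, s\<^sub>2\<close>, let \<open>\<Delta> = det a\<close>, and let \<open>N\<close> be the coordinate vector of \<open>s\<close>,
  so that the coefficient vector is \<open>a\<^sup>-\<^sup>1 N\<close>. The isomorphism \<open>\<Lambda>\<^sup>2V \<cong> \<Lambda>\<^sup>2T\<close> gives
  \<open>\<sigma> = \<Delta> \<omega>\<close> with \<open>\<omega>\<close> nowhere zero, and for a covector \<open>\<alpha>\<close>
  \<open>a \<sigma>(\<alpha>, d(a\<^sup>-\<^sup>1 N)) = \<Delta> \<omega>(\<alpha>, dN) - \<omega>(\<alpha>, da) \<Delta> a\<^sup>-\<^sup>1 N\<close>.
  Since \<open>\<Delta> a\<^sup>-\<^sup>1\<close> is the adjugate of \<open>a\<close>, the right-hand side is holomorphic across \<open>C\<close>; it is the definition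
  of the extended operator (\<open>ext_coef\<close>), and \<open>ext_op_off_C\<close> is the computation above.

  Everything else follows by density: the complement of \<open>C\<close> is dense, so two holomorphic sections
  that agree off \<open>C\<close> agree (\<open>eq_if_eq_off_C\<close>). This shows that the extension does not depend on the
  trivialization (\<open>ext_op_unique\<close>), and it reduces the axioms of a Poisson module to identities off
  \<open>C\<close>, where they are the Leibniz rule of the bracket (\<open>poisson_op_leibniz\<close>) and its Jacobi identity
  (\<open>poisson_op_bracket\<close>) applied to the coefficients. The Jacobi identity itself holds for every
  bivector field in dimension two by a computation in a chart (\<open>poisson_jacobi\<close>).

  The computations use that partial derivatives of holomorphic functions are holomorphic and commute.
  As holomorphy is defined by complex differentiability alone, this is first derived from the Cauchy
  estimates in one variable.\<close>

section \<open>Derivatives of holomorphic functions of several variables\<close>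

lemma holo_onD:
  assumes "holo_on S f" "z \<in> S"
  shows "(f has_derivative frechet_derivative f (at z)) (at z)"
    and "frechet_derivative f (at z) (c *s v) = c * frechet_derivative f (at z) v"
proof -
  obtain D where D: "(f has_derivative D) (at z)" "\<And>c v. D (c *s v) = c * D v"
    using assms unfolding holo_on_def by blast
  then have "D = frechet_derivative f (at z)" by (intro frechet_derivative_at)
  with D show "(f has_derivative frechet_derivative f (at z)) (at z)"
    "frechet_derivative f (at z) (c *s v) = c * frechet_derivative f (at z) v" by auto
qed

lemma holo_on_subset: "holo_on S f \<Longrightarrow> T \<subseteq> S \<Longrightarrow> holo_on T f"
  unfolding holo_on_def by blast

lemma norm_vector_scalar_mult: "norm (c *s v) = cmod c * norm (v :: complex^'n::finite)"
  by (simp add: norm_vec_def norm_mult L2_set_right_distrib)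

lemma bounded_linear_smult_left: "bounded_linear (\<lambda>h. h *s (u :: complex^'n::finite))"
  by (rule bounded_linear_intro[where K = "norm u"])
     (simp_all add: vec_eq_iff distrib_right norm_vector_scalar_mult)

lemma holo_on_line:
  assumes "holo_on S f" "z + \<zeta> *s u \<in> S"
  shows "((\<lambda>\<zeta>. f (z + \<zeta> *s u)) has_field_derivative frechet_derivative f (at (z + \<zeta> *s u)) u) (at \<zeta>)"
proof -
  have 1: "((\<lambda>\<zeta>. z + \<zeta> *s u) has_derivative (\<lambda>h. h *s u)) (at \<zeta>)"
    by (rule derivative_eq_intros has_derivative_bounded_linear | simp)+
       (auto intro!: bounded_linear_imp_has_derivative bounded_linear_smult_left)
  have "((\<lambda>\<zeta>. f (z + \<zeta> *s u)) has_derivative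
      (\<lambda>h. frechet_derivative f (at (z + \<zeta> *s u)) (h *s u))) (at \<zeta>)"
    using has_derivative_compose[OF 1 holo_onD(1)[OF assms]] .
  moreover have "(\<lambda>h. frechet_derivative f (at (z + \<zeta> *s u)) (h *s u))
      = (*) (frechet_derivative f (at (z + \<zeta> *s u)) u)"
    by (intro ext) (simp only: holo_onD(2)[OF assms] mult.commute)
  ultimately show ?thesis by (simp only: has_field_derivative_def)
qed

lemma holo_on_line_holomorphic:
  assumes "holo_on (ball z r) f" "s * norm u \<le> r"
  shows "(\<lambda>\<zeta>. f (z + \<zeta> *s u)) holomorphic_on ball 0 s"
proof (rule holomorphic_onI)
  fix \<zeta> :: complex assume \<zeta>: "\<zeta> \<in> ball 0 s"
  have "z + \<zeta> *s u \<in> ball z r" if "u \<noteq> 0"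
  proof -
    have "norm (\<zeta> *s u) < s * norm u" using \<zeta> that by (simp add: norm_vector_scalar_mult)
    then show ?thesis using assms(2) by (simp add: dist_norm)
  qed
  then have "(\<lambda>\<zeta>. f (z + \<zeta> *s u)) field_differentiable at \<zeta>"
    using holo_on_line[OF assms(1), of z \<zeta> u]
    by (cases "u = 0") (auto simp del: mem_ball simp: field_differentiable_def)
  then show "(\<lambda>\<zeta>. f (z + \<zeta> *s u)) field_differentiable at \<zeta> within ball 0 s"
    by (rule field_differentiable_at_within)
qed

text \<open>Restricting to a complex line through \<open>z\<close> reduces this to the one-variable Cauchy inequality.\<close>

lemma holo_on_Cauchy_estimate:
  assumes f: "holo_on (ball z r) f" and "0 < r" and M: "\<And>w. w \<in> ball z r \<Longrightarrow> cmod (f w) \<le> M"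
  shows "cmod (frechet_derivative f (at z) u) \<le> 2 * M * norm u / r"
proof (cases "u = 0")
  case True
  have "linear (frechet_derivative f (at z))"
    using holo_onD(1)[OF f, of z] \<open>0 < r\<close> by (auto intro: has_derivative_linear)
  then show ?thesis using True by (simp add: linear_0)
next
  case False
  define s where "s = r / norm u"
  have s: "s > 0" "s * norm u = r" using False \<open>0 < r\<close> by (auto simp: s_def)
  let ?g = "\<lambda>\<zeta>. f (z + \<zeta> *s u)"
  have hol: "?g holomorphic_on ball 0 s"
    by (rule holo_on_line_holomorphic[OF f]) (simp add: s)
  have "cmod ((deriv ^^ 1) ?g 0) \<le> fact 1 * M / (s/2)^1"
  proof (rule Cauchy_inequality)
    show "?g holomorphic_on ball 0 (s/2)" by (rule holomorphic_on_subset[OF hol]) (use s in auto)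
    show "continuous_on (cball 0 (s/2)) ?g"
      by (rule holomorphic_on_imp_continuous_on, rule holomorphic_on_subset[OF hol]) (use s in auto)
    show "cmod (?g x) \<le> M" if "cmod (0 - x) = s/2" for x
    proof (rule M)
      have "norm (x *s u) = s/2 * norm u" using that by (simp add: norm_vector_scalar_mult)
      also have "\<dots> < r" using s \<open>0 < r\<close> by (simp)
      finally show "z + x *s u \<in> ball z r" by (simp add: dist_norm)
    qed
  qed (use s in auto)
  moreover have "deriv ?g 0 = frechet_derivative f (at z) u"
    using holo_on_line[OF f, of z 0 u] \<open>0 < r\<close> by (intro DERIV_imp_deriv) simp
  ultimately show ?thesis by (simp add: s_def field_simps)
qed

lemma holomorphic_Taylor1:
  assumes g: "g holomorphic_on ball 0 s" and "0 < s"
    and M: "\<And>w. w \<in> ball 0 s \<Longrightarrow> cmod (g w) \<le> M" and t: "cmod t \<le> s / 4"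
  shows "cmod (g t - g 0 - deriv g 0 * t) \<le> 8 * M / s^2 * (cmod t)^2"
proof -
  have hol: "(deriv ^^ i) g holomorphic_on ball 0 s" for i
    by (rule holomorphic_higher_deriv[OF g]) auto
  have "cmod ((deriv ^^ 0) g t - (\<Sum>i\<le>1. (deriv ^^ i) g 0 * (t - 0)^i / fact i))
      \<le> 8 * M / s^2 * cmod (t - 0) ^ Suc 1 / fact 1"
  proof (rule complex_Taylor[where f = "\<lambda>i. (deriv ^^ i) g" and S = "cball 0 (s/4)"])
    fix i and x :: complex assume x: "x \<in> cball 0 (s/4)"
    then have xs: "x \<in> ball 0 s" using \<open>0 < s\<close> by auto
    show "((deriv ^^ i) g has_field_derivative (deriv ^^ Suc i) g x) (at x within cball 0 (s/4))"
      using holomorphic_derivI[OF hol[of i] open_ball xs]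
      by (simp add: has_field_derivative_at_within)
  next
    fix x :: complex assume x: "x \<in> cball 0 (s/4)"
    have sub: "cball x (s/2) \<subseteq> ball 0 s"
      using x \<open>0 < s\<close> by (auto simp: dist_norm) (smt (verit) norm_triangle_sub norm_minus_commute field_sum_of_halves)
    have "cmod ((deriv ^^ 2) g x) \<le> fact 2 * M / (s/2)^2"
    proof (rule Cauchy_inequality)
      show "g holomorphic_on ball x (s/2)" by (rule holomorphic_on_subset[OF g]) (use sub in auto)
      show "continuous_on (cball x (s/2)) g"
        by (rule holomorphic_on_imp_continuous_on, rule holomorphic_on_subset[OF g sub])
      show "cmod (g y) \<le> M" if "cmod (x - y) = s/2" for y
        by (rule M, rule subsetD[OF sub]) (use that in \<open>auto simp: dist_norm\<close>)
    qed (use \<open>0 < s\<close> in auto)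
    also have "\<dots> = 8 * M / s^2" by (simp add: power2_eq_square)
    finally show "cmod ((deriv ^^ Suc 1) g x) \<le> 8 * M / s^2" by (simp add: numeral_2_eq_2)
  qed (use t \<open>0 < s\<close> in auto)
  then show ?thesis by (simp add: power2_eq_square diff_diff_eq)
qed

text \<open>The difference quotients of \<open>f\<close> in the direction \<open>v\<close> converge uniformly near a point by the
  one-variable Taylor estimate, hence so do their derivatives by the Cauchy estimate, and the limit of
  the quotients is differentiable. The last conclusion identifies its derivative as a limit, which
  gives both complex linearity and the symmetry of second derivatives.\<close>

lemma directional_derivative_has_derivative:
  assumes "open S" and f: "holo_on S f" and "z0 \<in> S"
  obtains r G t where "r > 0" "ball z0 r \<subseteq> S"
    "\<And>n. t n > (0::real)" "t \<longlonglongrightarrow> 0"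
    "\<And>z. z \<in> ball z0 r \<Longrightarrow> ((\<lambda>z. frechet_derivative f (at z) v) has_derivative G z) (at z)"
    "\<And>z u. z \<in> ball z0 r \<Longrightarrow> (\<lambda>n. (frechet_derivative f (at (z + of_real (t n) *s v)) u
        - frechet_derivative f (at z) u) / of_real (t n)) \<longlonglongrightarrow> G z u"
proof -
  obtain R where R: "R > 0" "cball z0 R \<subseteq> S"
    using \<open>open S\<close> \<open>z0 \<in> S\<close> open_contains_cball by blast
  have "continuous_on (cball z0 R) f"
    using R by (intro continuous_at_imp_continuous_on ballI has_derivative_continuous[OF holo_onD(1)[OF f]]) auto
  then have "bounded (f ` cball z0 R)"
    by (intro compact_imp_bounded compact_continuous_image) auto
  then obtain M where M: "M > 0" "\<And>z. z \<in> cball z0 R \<Longrightarrow> cmod (f z) \<le> M"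
    unfolding bounded_pos by blast
  have fR: "holo_on (ball z0 R) f" using R by (intro holo_on_subset[OF f]) auto
  \<comment> \<open>\<open>z + \<zeta> v\<close> stays in the ball of radius \<open>R\<close> when \<open>z\<close> is in the ball of radius \<open>R/2\<close> and \<open>\<bar>\<zeta>\<bar> < s\<close>;
    the steps \<open>t n\<close> are at most \<open>s/4\<close>, as the Taylor estimate requires.\<close>
  define s where "s = R / 2 / (norm v + 1)"
  have "norm v + 1 > 0" by (simp add: add_nonneg_pos)
  then have s: "s > 0" "s * norm v \<le> R / 2"
  proof -
    show s: "s > 0" unfolding s_def using R \<open>norm v + 1 > 0\<close> by (intro divide_pos_pos) auto
    have "s * norm v \<le> s * (norm v + 1)" using s by (intro mult_left_mono) auto
    also have "\<dots> = R / 2" unfolding s_def using \<open>norm v + 1 > 0\<close>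
      by (metis less_irrefl nonzero_eq_divide_eq)
    finally show "s * norm v \<le> R / 2" .
  qed
  define t where "t n = s / 4 * inverse (real (Suc n))" for n
  have t: "t n > 0" "t n \<le> s / 4" "t n * norm v \<le> R / 4" for n
  proof -
    show "t n > 0" unfolding t_def using s by (intro mult_pos_pos) auto
    have "inverse (real (Suc n)) \<le> 1" by (simp add: field_simps)
    then have "s / 4 * inverse (real (Suc n)) \<le> s / 4 * 1" using s by (intro mult_left_mono) auto
    then show "t n \<le> s / 4" by (simp add: t_def)
    then have "t n * norm v \<le> s / 4 * norm v" by (intro mult_right_mono) auto
    also have "\<dots> = (s * norm v) / 4" by simp
    also have "\<dots> \<le> (R / 2) / 4" using s(2) by (intro divide_right_mono) auto
    finally show "t n * norm v \<le> R / 4" using R(1) by simp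
  qed
  have t0: "t \<longlonglongrightarrow> 0"
    unfolding t_def by (rule tendsto_mult_right_zero[OF LIMSEQ_inverse_real_of_nat])
  let ?D = "\<lambda>z u. frechet_derivative f (at z) u"
  define F where "F n z = (f (z + of_real (t n) *s v) - f z) / of_real (t n)" for n z
  define DF where "DF n z u = (?D (z + of_real (t n) *s v) u - ?D z u) / of_real (t n)" for n z u
  have shift: "z + of_real (t n) *s v \<in> ball z0 R" if "z \<in> ball z0 (R/2)" for n z
  proof -
    have "norm (of_real (t n) *s v) \<le> R / 4"
      using t[of n] by (simp add: norm_vector_scalar_mult)
    then have "dist z0 (z + of_real (t n) *s v) < R/2 + R / 4"
      using that dist_triangle[of z0 "z + of_real (t n) *s v" z] by (auto simp: dist_norm)
    then show ?thesis using R by simp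
  qed
  have derF: "(F n has_derivative DF n z) (at z)" if z: "z \<in> ball z0 (R/2)" for n z
  proof -
    have 1: "(f has_derivative ?D (z + of_real (t n) *s v)) (at (z + of_real (t n) *s v))"
      by (rule holo_onD(1)[OF fR shift[OF z]])
    have 2: "(f has_derivative ?D z) (at z)"
      by (rule holo_onD(1)[OF fR]) (use z R in auto)
    have 3: "((\<lambda>z. z + of_real (t n) *s v) has_derivative (\<lambda>h. h)) (at z)"
      using has_derivative_add_const[OF has_derivative_ident] .
    show ?thesis unfolding F_def DF_def
      by (rule bounded_linear.has_derivative[OF bounded_linear_divide
            has_derivative_diff[OF has_derivative_compose[OF 3 1] 2]])
  qed
  have holF: "holo_on (ball z0 (R/2)) (F n)" for n
    unfolding holo_on_def
  proof (intro ballI exI conjI allI)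
    fix z assume z: "z \<in> ball z0 (R/2)"
    show "(F n has_derivative DF n z) (at z)" by (rule derF[OF z])
    fix c u show "DF n z (c *s u) = c * DF n z u"
      using holo_onD(2)[OF fR, of z c u] holo_onD(2)[OF fR shift[OF z], of n c u] z R
      by (simp add: DF_def right_diff_distrib)
  qed
  define K where "K = 8 * M / s^2"
  have K: "K \<ge> 0" using M by (simp add: K_def)
  have Fv: "cmod (F n z - ?D z v) \<le> K * t n" if z: "z \<in> ball z0 (R/2)" for n z
  proof -
    let ?g = "\<lambda>\<zeta>. f (z + \<zeta> *s v)"
    have sub: "ball z (R/2) \<subseteq> ball z0 R"
      using z by (simp add: ball_subset_ball_iff dist_commute)
    have dg: "deriv ?g 0 = ?D z v"
      using holo_on_line[OF fR, of z 0 v] z R by (intro DERIV_imp_deriv) auto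
    have "cmod (?g (of_real (t n)) - ?g 0 - deriv ?g 0 * of_real (t n))
        \<le> 8 * M / s^2 * (cmod (of_real (t n)))^2"
    proof (rule holomorphic_Taylor1)
      show "?g holomorphic_on ball 0 s"
        by (rule holo_on_line_holomorphic[OF holo_on_subset[OF fR sub] s(2)])
      fix w :: complex assume w: "w \<in> ball 0 s"
      have "norm (w *s v) < R / 2"
      proof (cases "v = 0")
        case False
        then have "norm (w *s v) < s * norm v" using w by (simp add: norm_vector_scalar_mult)
        then show ?thesis using s by simp
      qed (use R in auto)
      then have "z + w *s v \<in> ball z (R / 2)" by (simp add: dist_norm)
      then have "z + w *s v \<in> ball z0 R" using sub by blast
      then show "cmod (?g w) \<le> M" using M by auto
    qed (use s t(1,2)[of n] in auto)
    then have le: "cmod (f (z + of_real (t n) *s v) - f z - ?D z v * of_real (t n)) \<le> K * t n * t n"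
      using t(1)[of n] by (simp add: dg K_def power2_eq_square)
    have "F n z - ?D z v = (f (z + of_real (t n) *s v) - f z - ?D z v * of_real (t n)) / of_real (t n)"
      using t(1)[of n] by (simp add: F_def divide_simps)
    then have "cmod (F n z - ?D z v) =
        cmod (f (z + of_real (t n) *s v) - f z - ?D z v * of_real (t n)) / t n"
      using t(1)[of n] by (simp add: norm_divide)
    also have "\<dots> \<le> K * t n" using le t(1)[of n] by (simp add: divide_le_eq)
    finally show ?thesis .
  qed
  have DFd: "cmod (DF n z u - DF m z u) \<le> 8 * K * (t n + t m) * norm u / R"
    if z: "z \<in> ball z0 (R/4)" for n m z u
  proof -
    have sub: "ball z (R/4) \<subseteq> ball z0 (R/2)"
      using z by (simp add: ball_subset_ball_iff dist_commute)
    have zz: "z \<in> ball z0 (R/2)" using z R by auto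
    have d: "((\<lambda>z. F n z - F m z) has_derivative (\<lambda>u. DF n z u - DF m z u)) (at z)"
      if "z \<in> ball z0 (R/2)" for z
      by (rule has_derivative_diff[OF derF derF]) (use that in auto)
    have "holo_on (ball z0 (R/2)) (\<lambda>z. F n z - F m z)"
      unfolding holo_on_def
      by (intro ballI exI conjI allI, rule d)
         (auto simp: right_diff_distrib frechet_derivative_at[OF derF] holo_onD(2)[OF holF])
    then have h: "holo_on (ball z (R/4)) (\<lambda>z. F n z - F m z)"
      by (rule holo_on_subset[OF _ sub])
    have "cmod (frechet_derivative (\<lambda>z. F n z - F m z) (at z) u) \<le> 2 * (K * (t n + t m)) * norm u / (R/4)"
    proof (rule holo_on_Cauchy_estimate[OF h])
      fix w assume "w \<in> ball z (R/4)"
      then have w: "w \<in> ball z0 (R/2)" using sub by auto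
      have "cmod (F n w - F m w) \<le> cmod (F n w - ?D w v) + cmod (F m w - ?D w v)"
        using norm_triangle_ineq4[of "F n w - ?D w v" "F m w - ?D w v"] by simp
      also have "\<dots> \<le> K * t n + K * t m" by (intro add_mono Fv w)
      finally show "cmod (F n w - F m w) \<le> K * (t n + t m)" by (simp add: algebra_simps)
    qed (use R in auto)
    then show ?thesis
      by (simp add: frechet_derivative_at[OF d[OF zz], symmetric])
  qed
  have conv: "convergent (\<lambda>n. DF n z u)" if z: "z \<in> ball z0 (R/4)" for z u
  proof -
    have "Cauchy (\<lambda>n. DF n z u)"
    proof (rule metric_CauchyI)
      fix e :: real assume e: "e > 0"
      have "(\<lambda>n. 16 * K * t n * norm u / R) \<longlonglongrightarrow> 16 * K * 0 * norm u / R"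
        by (intro tendsto_intros t0) (use R in auto)
      then have "(\<lambda>n. 16 * K * t n * norm u / R) \<longlonglongrightarrow> 0" by simp
      then have "\<forall>\<^sub>F n in sequentially. 16 * K * t n * norm u / R < e"
        using e by (rule order_tendstoD)
      then obtain N where N: "16 * K * t n * norm u / R < e" if "n \<ge> N" for n
        unfolding eventually_sequentially by blast
      show "\<exists>N. \<forall>m\<ge>N. \<forall>n\<ge>N. dist (DF m z u) (DF n z u) < e"
      proof (intro exI allI impI)
        fix m n assume mn: "m \<ge> N" "n \<ge> N"
        have "dist (DF m z u) (DF n z u) \<le> 8 * K * (t m + t n) * norm u / R"
          unfolding dist_norm by (rule DFd[OF z])
        also have "\<dots> = (16 * K * t m * norm u / R + 16 * K * t n * norm u / R) / 2"
          by (simp add: algebra_simps add_divide_distrib)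
        also have "\<dots> < e" using N[OF mn(1)] N[OF mn(2)] by simp
        finally show "dist (DF m z u) (DF n z u) < e" .
      qed
    qed
    then show ?thesis by (rule Cauchy_convergent)
  qed
  define G where "G z u = lim (\<lambda>n. DF n z u)" for z u
  have G: "(\<lambda>n. DF n z u) \<longlonglongrightarrow> G z u" if "z \<in> ball z0 (R/4)" for z u
    using conv[OF that] unfolding G_def by (rule convergent_LIMSEQ_iff[THEN iffD1])
  have DG: "cmod (DF n z u - G z u) \<le> 8 * K * t n * norm u / R" if z: "z \<in> ball z0 (R/4)" for n z u
  proof (rule tendsto_le[OF sequentially_bot])
    show "(\<lambda>m. cmod (DF n z u - DF m z u)) \<longlonglongrightarrow> cmod (DF n z u - G z u)"
      by (intro tendsto_intros G z)
    have "(\<lambda>m. 8 * K * (t n + t m) * norm u / R) \<longlonglongrightarrow> 8 * K * (t n + 0) * norm u / R"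
      by (intro tendsto_intros t0) (use R in auto)
    then show "(\<lambda>m. 8 * K * (t n + t m) * norm u / R) \<longlonglongrightarrow> 8 * K * t n * norm u / R" by simp
  qed (intro always_eventually allI DFd[OF z])
  have "\<exists>g. \<forall>z\<in>ball z0 (R/4). (\<lambda>n. F n z) \<longlonglongrightarrow> g z \<and> (g has_derivative G z) (at z within ball z0 (R/4))"
  proof (rule has_derivative_sequence)
    show "convex (ball z0 (R/4))" by simp
    show "(F n has_derivative DF n z) (at z within ball z0 (R/4))" if "z \<in> ball z0 (R/4)" for n z
      by (rule has_derivative_at_withinI, rule derF) (use that R in auto)
    show "\<forall>\<^sub>F n in sequentially. \<forall>x\<in>ball z0 (R/4). \<forall>h. cmod (DF n x h - G x h) \<le> e * norm h"
      if e: "e > 0" for e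
    proof -
      have "(\<lambda>n. 8 * K * t n / R) \<longlonglongrightarrow> 8 * K * 0 / R"
        by (intro tendsto_intros t0) (use R in auto)
      then have "(\<lambda>n. 8 * K * t n / R) \<longlonglongrightarrow> 0" by simp
      then have "\<forall>\<^sub>F n in sequentially. 8 * K * t n / R < e" using e by (rule order_tendstoD)
      then show ?thesis
      proof eventually_elim
        case (elim n)
        show ?case
        proof (intro ballI allI)
          fix x h assume x: "x \<in> ball z0 (R/4)"
          have "cmod (DF n x h - G x h) \<le> (8 * K * t n / R) * norm h"
            using DG[OF x, of n h] by simp
          also have "\<dots> \<le> e * norm h" using elim by (intro mult_right_mono) auto
          finally show "cmod (DF n x h - G x h) \<le> e * norm h" .
        qed
      qed
    qed
    show "z0 \<in> ball z0 (R/4)" using R by simp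
    show "(\<lambda>n. F n z0) \<longlonglongrightarrow> ?D z0 v"
    proof (rule LIM_zero_cancel, rule tendsto_norm_zero_cancel)
      show "(\<lambda>n. norm (F n z0 - ?D z0 v)) \<longlonglongrightarrow> 0"
      proof (rule tendsto_sandwich[where f = "\<lambda>_. 0" and h = "\<lambda>n. K * t n"])
        show "\<forall>\<^sub>F n in sequentially. norm (F n z0 - ?D z0 v) \<le> K * t n"
          using Fv R by (intro always_eventually allI) auto
        show "(\<lambda>n. K * t n) \<longlonglongrightarrow> 0" using tendsto_mult_right_zero[OF t0] .
      qed auto
    qed
  qed
  then obtain g where "\<forall>z\<in>ball z0 (R/4). (\<lambda>n. F n z) \<longlonglongrightarrow> g z \<and>
      (g has_derivative G z) (at z within ball z0 (R/4))" by (elim exE)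
  then have g: "(\<lambda>n. F n z) \<longlonglongrightarrow> g z" "(g has_derivative G z) (at z within ball z0 (R/4))"
    if "z \<in> ball z0 (R/4)" for z using that by auto
  have gD: "g z = ?D z v" if z: "z \<in> ball z0 (R/4)" for z
  proof (rule LIMSEQ_unique[OF g(1)[OF z]], rule LIM_zero_cancel, rule tendsto_norm_zero_cancel)
    show "(\<lambda>n. norm (F n z - ?D z v)) \<longlonglongrightarrow> 0"
    proof (rule tendsto_sandwich[where f = "\<lambda>_. 0" and h = "\<lambda>n. K * t n"])
      show "\<forall>\<^sub>F n in sequentially. norm (F n z - ?D z v) \<le> K * t n"
        using z R by (intro always_eventually allI Fv) auto
      show "(\<lambda>n. K * t n) \<longlonglongrightarrow> 0" using tendsto_mult_right_zero[OF t0] .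
    qed auto
  qed
  have "((\<lambda>z. ?D z v) has_derivative G z) (at z)" if z: "z \<in> ball z0 (R/4)" for z
  proof -
    have "(g has_derivative G z) (at z)" using g(2)[OF z] unfolding at_within_open[OF z open_ball] .
    then show ?thesis
      by (rule has_derivative_transform_within_open[where s = "ball z0 (R/4)"])
         (use z in \<open>simp_all only: gD open_ball\<close>)
  qed
  moreover have "(\<lambda>n. (?D (z + of_real (t n) *s v) u - ?D z u) / of_real (t n)) \<longlonglongrightarrow> G z u"
    if z: "z \<in> ball z0 (R/4)" for z u
    using G[OF z] unfolding DF_def .
  moreover have "R/4 > 0" "ball z0 (R/4) \<subseteq> S" using R by auto
  ultimately show thesis using t(1) t0 that[of "R/4" t G] by simp
qed

lemma holo_on_frechet_derivative:
  assumes "open S" and f: "holo_on S f"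
  shows "holo_on S (\<lambda>z. frechet_derivative f (at z) v)"
  unfolding holo_on_def
proof
  fix z assume z: "z \<in> S"
  obtain r G t where r: "r > 0" "ball z r \<subseteq> S"
    and t: "\<And>n. t n > (0::real)" "t \<longlonglongrightarrow> 0"
    and G: "\<And>w. w \<in> ball z r \<Longrightarrow> ((\<lambda>z. frechet_derivative f (at z) v) has_derivative G w) (at w)"
    and lim: "\<And>w u. w \<in> ball z r \<Longrightarrow> (\<lambda>n. (frechet_derivative f (at (w + of_real (t n) *s v)) u
        - frechet_derivative f (at w) u) / of_real (t n)) \<longlonglongrightarrow> G w u"
    by (rule directional_derivative_has_derivative[OF assms z, where v = v], rule that) assumption+
  have zr: "z \<in> ball z r" using r by simp
  have "(\<lambda>n. of_real (t n) :: complex) \<longlonglongrightarrow> 0" using tendsto_of_real[OF t(2)] by simp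
  from tendsto_add[OF tendsto_const bounded_linear.tendsto[OF bounded_linear_smult_left this]]
  have "(\<lambda>n. z + of_real (t n) *s v) \<longlonglongrightarrow> z" by simp
  then have ev: "\<forall>\<^sub>F n in sequentially. z + of_real (t n) *s v \<in> S"
    using \<open>open S\<close> z by (rule topological_tendstoD)
  have "G z (c *s u) = c * G z u" for c u
  proof (rule LIMSEQ_unique[OF lim[OF zr]])
    have "(\<lambda>n. c * ((frechet_derivative f (at (z + of_real (t n) *s v)) u
        - frechet_derivative f (at z) u) / of_real (t n))) \<longlonglongrightarrow> c * G z u"
      by (rule tendsto_mult[OF tendsto_const lim[OF zr]])
    then show "(\<lambda>n. (frechet_derivative f (at (z + of_real (t n) *s v)) (c *s u)
        - frechet_derivative f (at z) (c *s u)) / of_real (t n)) \<longlonglongrightarrow> c * G z u"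
      by (rule Lim_transform_eventually, use ev in eventually_elim)
         (simp add: holo_onD(2)[OF f] z right_diff_distrib)
  qed
  then show "\<exists>f'. ((\<lambda>z. frechet_derivative f (at z) v) has_derivative f') (at z) \<and> (\<forall>c u. f' (c *s u) = c * f' u)"
    using G[OF zr] by (intro exI conjI allI) auto
qed

text \<open>The derivative of \<open>z \<mapsto> Df(z)v\<close> in the direction \<open>u\<close> is a limit of difference quotients of
  \<open>z \<mapsto> Df(z)u\<close> in the direction \<open>v\<close>.\<close>

lemma holo_on_mixed_derivatives:
  assumes "open S" and f: "holo_on S f" and z: "z \<in> S"
  shows "frechet_derivative (\<lambda>z. frechet_derivative f (at z) v) (at z) u
       = frechet_derivative (\<lambda>z. frechet_derivative f (at z) u) (at z) v"
proof -
  obtain r G t where r: "r > 0" "ball z r \<subseteq> S"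
    and t: "\<And>n. t n > (0::real)" "t \<longlonglongrightarrow> 0"
    and G: "\<And>w. w \<in> ball z r \<Longrightarrow> ((\<lambda>z. frechet_derivative f (at z) v) has_derivative G w) (at w)"
    and lim: "\<And>w u. w \<in> ball z r \<Longrightarrow> (\<lambda>n. (frechet_derivative f (at (w + of_real (t n) *s v)) u
        - frechet_derivative f (at w) u) / of_real (t n)) \<longlonglongrightarrow> G w u"
    by (rule directional_derivative_has_derivative[OF assms, where v = v], rule that) assumption+
  have zr: "z \<in> ball z r" using r by simp
  let ?h = "\<lambda>z. frechet_derivative f (at z) u"
  have h: "holo_on S ?h" by (rule holo_on_frechet_derivative) fact+
  have "((\<lambda>\<zeta>. ?h (z + \<zeta> *s v)) has_field_derivative frechet_derivative ?h (at z) v) (at 0)"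
    using holo_on_line[OF h, of z 0 v] z by simp
  then have "((\<lambda>y. (?h (z + y *s v) - ?h z) / y) \<longlongrightarrow> frechet_derivative ?h (at z) v) (at 0)"
    by (simp add: has_field_derivative_iff)
  moreover have "filterlim (\<lambda>n. complex_of_real (t n)) (at 0) sequentially"
  proof (rule filterlim_atI)
    show "(\<lambda>n. complex_of_real (t n)) \<longlonglongrightarrow> 0" using tendsto_of_real[OF t(2)] by simp
    have "t n \<noteq> 0" for n using t(1)[of n] by simp
    then show "\<forall>\<^sub>F n in sequentially. complex_of_real (t n) \<noteq> 0" by simp
  qed
  ultimately have "(\<lambda>n. (?h (z + of_real (t n) *s v) - ?h z) / of_real (t n))
      \<longlonglongrightarrow> frechet_derivative ?h (at z) v"
    by (rule filterlim_compose)
  then have "G z u = frechet_derivative ?h (at z) v" by (rule LIMSEQ_unique[OF lim[OF zr]])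
  then show ?thesis using frechet_derivative_at[OF G[OF zr]] by simp
qed

section \<open>Calculus on a complex manifold\<close>

definition complex_linear :: "(complex^'n::finite \<Rightarrow> complex) \<Rightarrow> bool" where
  "complex_linear D \<longleftrightarrow> (\<forall>a v. D (a *s v) = a * D v)"

definition has_cderiv ::
  "('m, 'n::finite) chart \<Rightarrow> ('m \<Rightarrow> complex) \<Rightarrow> 'm \<Rightarrow> (complex^'n \<Rightarrow> complex) \<Rightarrow> bool" where
  "has_cderiv c f p D \<longleftrightarrow>
     ((\<lambda>z. f (param c z)) has_derivative D) (at (coord c p)) \<and> complex_linear D"

definition cderiv ::
  "('m, 'n::finite) chart \<Rightarrow> ('m \<Rightarrow> complex) \<Rightarrow> 'm \<Rightarrow> complex^'n \<Rightarrow> complex" where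
  "cderiv c f p = frechet_derivative (\<lambda>z. f (param c z)) (at (coord c p))"

definition pderiv ::
  "('m, 'n::finite) chart \<Rightarrow> 'n \<Rightarrow> ('m \<Rightarrow> complex) \<Rightarrow> 'm \<Rightarrow> complex" where
  "pderiv c k f p = cderiv c f p (axis k 1)"

definition trans_deriv ::
  "('m, 'n::finite) chart \<Rightarrow> ('m, 'n) chart \<Rightarrow> 'm \<Rightarrow> complex^'n \<Rightarrow> complex^'n" where
  "trans_deriv c d p = frechet_derivative (\<lambda>z. coord d (param c z)) (at (coord c p))"

lemma has_cderiv_unique: "has_cderiv c f p D \<Longrightarrow> cderiv c f p = D"
  unfolding has_cderiv_def cderiv_def by (metis frechet_derivative_at)

lemma has_cderiv_const: "has_cderiv c (\<lambda>_. a) p (\<lambda>_. 0)"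
  unfolding has_cderiv_def complex_linear_def by simp

lemma has_cderiv_add:
  "has_cderiv c f p D \<Longrightarrow> has_cderiv c g p E \<Longrightarrow> has_cderiv c (\<lambda>q. f q + g q) p (\<lambda>v. D v + E v)"
  unfolding has_cderiv_def complex_linear_def
  by (auto intro: has_derivative_add simp: distrib_left)

lemma complex_linear_expand:
  assumes "linear D" "complex_linear D"
  shows "D v = (\<Sum>k\<in>UNIV. v $ k * D (axis k 1))"
proof -
  have "D v = D (\<Sum>k\<in>UNIV. v $ k *s axis k 1)" by (simp add: basis_expansion)
  also have "\<dots> = (\<Sum>k\<in>UNIV. D (v $ k *s axis k 1))" using assms(1) by (rule linear_sum)
  finally show ?thesis using assms(2) by (simp add: complex_linear_def)
qed

lemma has_derivative_vec_componentwise: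
  fixes f :: "'a::real_normed_vector \<Rightarrow> complex^'n::finite"
  assumes "\<And>i. ((\<lambda>z. f z $ i) has_derivative (\<lambda>v. D v $ i)) (at z)"
  shows "(f has_derivative D) (at z)"
proof (subst has_derivative_componentwise_within, intro ballI)
  fix e :: "complex^'n" assume "e \<in> Basis"
  then obtain i b where "e = axis i b" "b \<in> Basis" unfolding Basis_vec_def by auto
  then show "((\<lambda>x. f x \<bullet> e) has_derivative (\<lambda>x. D x \<bullet> e)) (at z)"
    using has_derivative_inner_left[OF assms[of i], of b] by (simp add: inner_axis)
qed

locale cmanifold =
  fixes A :: "('m::{t2_space,second_countable_topology}, 'n::finite) chart set"
  assumes complex_manifold: "complex_manifold A"
begin

lemma chart_at: obtains c where "c \<in> A" "p \<in> cdom c"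
  using complex_manifold unfolding complex_manifold_def by blast

lemma open_cdom [simp]: "c \<in> A \<Longrightarrow> open (cdom c)"
  using complex_manifold unfolding complex_manifold_def by blast

lemma chart_homeomorphism:
  "c \<in> A \<Longrightarrow> homeomorphism (cdom c) (coord c ` cdom c) (coord c) (param c)"
  using complex_manifold unfolding complex_manifold_def by blast

lemma param_coord [simp]: "c \<in> A \<Longrightarrow> p \<in> cdom c \<Longrightarrow> param c (coord c p) = p"
  using chart_homeomorphism[of c] by (simp add: homeomorphism_def)

lemma open_coord_image:
  assumes "c \<in> A" "open U"
  shows "open (coord c ` (U \<inter> cdom c))"
proof -
  have "openin (top_of_set (cdom c)) (U \<inter> cdom c)"
    using \<open>open U\<close> by (auto simp: openin_open)
  then have "openin (top_of_set (coord c ` cdom c)) (coord c ` (U \<inter> cdom c))"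
    using homeomorphism_imp_open_map[OF chart_homeomorphism[OF assms(1)]] by blast
  moreover have "open (coord c ` cdom c)"
    using complex_manifold assms(1) unfolding complex_manifold_def by blast
  ultimately show ?thesis by (simp add: openin_open_eq)
qed

lemma continuous_coord: "c \<in> A \<Longrightarrow> continuous_on (cdom c) (coord c)"
  using chart_homeomorphism[of c] by (simp add: homeomorphism_def)

text \<open>Holomorphy on \<open>U\<close> is this condition at every point of \<open>U\<close>, because \<open>holo_on\<close> is itself a
  pointwise condition. The differential calculus can therefore be done one point at a time.\<close>

definition cdiff :: "('m \<Rightarrow> complex) \<Rightarrow> 'm \<Rightarrow> bool" where
  "cdiff f p \<longleftrightarrow> (\<forall>c\<in>A. p \<in> cdom c \<longrightarrow> (\<exists>D. has_cderiv c f p D))"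

lemma holo_iff: "f \<in> holo A U \<longleftrightarrow> (\<forall>p\<in>U. cdiff f p)"
  unfolding holo_def holo_on_def cdiff_def has_cderiv_def complex_linear_def by auto

lemma cdiffD: "cdiff f p \<Longrightarrow> c \<in> A \<Longrightarrow> p \<in> cdom c \<Longrightarrow> has_cderiv c f p (cderiv c f p)"
  unfolding cdiff_def using has_cderiv_unique by metis

lemma has_cderiv_cong:
  assumes "has_cderiv c f p D" "open W" "p \<in> W" "\<And>q. q \<in> W \<Longrightarrow> f q = g q" "c \<in> A" "p \<in> cdom c"
  shows "has_cderiv c g p D"
proof -
  have "((\<lambda>z. g (param c z)) has_derivative D) (at (coord c p))"
  proof (rule has_derivative_transform_within_open[where s = "coord c ` (W \<inter> cdom c)"])
    show "((\<lambda>z. f (param c z)) has_derivative D) (at (coord c p))"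
      using assms(1) by (simp add: has_cderiv_def)
    show "open (coord c ` (W \<inter> cdom c))" by (rule open_coord_image) fact+
    show "coord c p \<in> coord c ` (W \<inter> cdom c)" using assms by blast
    show "f (param c z) = g (param c z)" if "z \<in> coord c ` (W \<inter> cdom c)" for z
      using that assms by auto
  qed
  then show ?thesis using assms(1) by (simp add: has_cderiv_def)
qed

lemma trans_deriv_derivative:
  assumes c: "c \<in> A" "p \<in> cdom c" and d: "d \<in> A" "p \<in> cdom d"
  shows "((\<lambda>z. coord d (param c z)) has_derivative trans_deriv c d p) (at (coord c p))"
    and "has_cderiv c (\<lambda>q. coord d q $ i) p (\<lambda>v. trans_deriv c d p v $ i)"
proof -
  have "\<forall>i. \<exists>D. has_cderiv c (\<lambda>q. coord d q $ i) p D"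
  proof
    fix i
    have "holo_on (coord c ` (cdom c \<inter> cdom d)) (\<lambda>z. coord d (param c z) $ i)"
      using complex_manifold c d unfolding complex_manifold_def by blast
    moreover have "coord c p \<in> coord c ` (cdom c \<inter> cdom d)" using c d by blast
    ultimately show "\<exists>D. has_cderiv c (\<lambda>q. coord d q $ i) p D"
      unfolding holo_on_def has_cderiv_def complex_linear_def by blast
  qed
  then obtain D where D: "\<And>i. has_cderiv c (\<lambda>q. coord d q $ i) p (D i)" by metis
  have "((\<lambda>z. coord d (param c z)) has_derivative (\<lambda>v. \<chi> i. D i v)) (at (coord c p))"
    by (rule has_derivative_vec_componentwise) (use D in \<open>simp add: has_cderiv_def\<close>)
  then have eq: "(\<lambda>v. \<chi> i. D i v) = trans_deriv c d p"
    and "((\<lambda>z. coord d (param c z)) has_derivative trans_deriv c d p) (at (coord c p))"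
    unfolding trans_deriv_def using frechet_derivative_at by metis+
  then show "((\<lambda>z. coord d (param c z)) has_derivative trans_deriv c d p) (at (coord c p))"
    by simp
  show "has_cderiv c (\<lambda>q. coord d q $ i) p (\<lambda>v. trans_deriv c d p v $ i)"
    using D[of i] by (simp flip: eq)
qed

lemma trans_deriv_linear:
  assumes c: "c \<in> A" "p \<in> cdom c" and d: "d \<in> A" "p \<in> cdom d"
  shows "linear (trans_deriv c d p)" "trans_deriv c d p (a *s v) = a *s trans_deriv c d p v"
proof -
  show "linear (trans_deriv c d p)"
    by (rule has_derivative_linear[OF trans_deriv_derivative(1)[OF assms]])
  show "trans_deriv c d p (a *s v) = a *s trans_deriv c d p v"
    using trans_deriv_derivative(2)[OF assms]
    by (simp add: has_cderiv_def complex_linear_def vec_eq_iff)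
qed

text \<open>The chain rule: differentiability in one chart gives it in all.\<close>

lemma has_cderiv_change_chart:
  assumes c: "c \<in> A" "p \<in> cdom c" and d: "d \<in> A" "p \<in> cdom d" and D: "has_cderiv d f p D"
  shows "has_cderiv c f p (\<lambda>v. D (trans_deriv c d p v))"
proof -
  have 1: "((\<lambda>z. f (param d z)) has_derivative D) (at (coord d (param c (coord c p))))"
    using D c by (simp add: has_cderiv_def)
  have "((\<lambda>z. f (param d (coord d (param c z)))) has_derivative (\<lambda>v. D (trans_deriv c d p v))) (at (coord c p))"
    using has_derivative_compose[OF trans_deriv_derivative(1)[OF c d] 1] .
  moreover have "complex_linear (\<lambda>v. D (trans_deriv c d p v))"
    using D trans_deriv_linear(2)[OF c d] by (simp add: has_cderiv_def complex_linear_def)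
  ultimately have "has_cderiv c (\<lambda>q. f (param d (coord d q))) p (\<lambda>v. D (trans_deriv c d p v))"
    by (simp add: has_cderiv_def)
  then show ?thesis
    by (rule has_cderiv_cong[where W = "cdom d"]) (use c d in simp_all)
qed

lemma cdiffI: "c \<in> A \<Longrightarrow> p \<in> cdom c \<Longrightarrow> has_cderiv c f p D \<Longrightarrow> cdiff f p"
  unfolding cdiff_def using has_cderiv_change_chart by blast

lemma cderiv_change_chart:
  assumes "c \<in> A" "p \<in> cdom c" "d \<in> A" "p \<in> cdom d" "cdiff f p"
  shows "cderiv c f p v = cderiv d f p (trans_deriv c d p v)"
  using has_cderiv_unique[OF has_cderiv_change_chart[OF assms(1-4) cdiffD[OF assms(5,3,4)]]] by simp

lemma cdiff_coord: "c \<in> A \<Longrightarrow> p \<in> cdom c \<Longrightarrow> cdiff (\<lambda>q. coord c q $ i) p"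
  using trans_deriv_derivative(2) cdiffI by blast

lemma cderiv_coord:
  "c \<in> A \<Longrightarrow> p \<in> cdom c \<Longrightarrow> d \<in> A \<Longrightarrow> p \<in> cdom d \<Longrightarrow>
    cderiv c (\<lambda>q. coord d q $ i) p v = trans_deriv c d p v $ i"
  using has_cderiv_unique[OF trans_deriv_derivative(2)] by metis

lemma trans_deriv_self:
  assumes c: "c \<in> A" "p \<in> cdom c"
  shows "trans_deriv c c p v = v"
proof -
  have "((\<lambda>z. coord c (param c z)) has_derivative (\<lambda>v. v)) (at (coord c p))"
  proof (rule has_derivative_transform_within_open[where s = "coord c ` (UNIV \<inter> cdom c)"])
    show "((\<lambda>z. z) has_derivative (\<lambda>v. v)) (at (coord c p))" by simp
    show "open (coord c ` (UNIV \<inter> cdom c))" by (rule open_coord_image) (use c in auto)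
  qed (use c in auto)
  then show ?thesis unfolding trans_deriv_def using frechet_derivative_at by metis
qed

text \<open>The components of \<open>trans_deriv c e p\<close> are derivatives of the coordinates of \<open>e\<close>, so the cocycle
  rule is the change of chart for these functions.\<close>

lemma trans_deriv_trans:
  assumes "c \<in> A" "p \<in> cdom c" "d \<in> A" "p \<in> cdom d" "e \<in> A" "p \<in> cdom e"
  shows "trans_deriv d e p (trans_deriv c d p v) = trans_deriv c e p v"
proof (subst vec_eq_iff, intro allI)
  fix i
  show "trans_deriv d e p (trans_deriv c d p v) $ i = trans_deriv c e p v $ i"
    using cderiv_change_chart[OF assms(1-4) cdiff_coord[OF assms(5,6), of i], of v] assms
    by (simp add: cderiv_coord)
qed

lemma pderiv_coord:
  "c \<in> A \<Longrightarrow> p \<in> cdom c \<Longrightarrow> pderiv c k (\<lambda>q. coord c q $ i) p = (if i = k then 1 else 0)"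
  by (simp add: pderiv_def cderiv_coord trans_deriv_self axis_def)

lemma cderiv_linear:
  assumes "cdiff f p" "c \<in> A" "p \<in> cdom c"
  shows "linear (cderiv c f p)" "complex_linear (cderiv c f p)"
  using cdiffD[OF assms] by (auto simp: has_cderiv_def intro: has_derivative_linear)

lemma cderiv_eq_sum:
  "cdiff f p \<Longrightarrow> c \<in> A \<Longrightarrow> p \<in> cdom c \<Longrightarrow> cderiv c f p v = (\<Sum>k\<in>UNIV. v $ k * pderiv c k f p)"
  unfolding pderiv_def by (intro complex_linear_expand cderiv_linear)

lemma cdiff_cong: "cdiff f p \<Longrightarrow> open W \<Longrightarrow> p \<in> W \<Longrightarrow> (\<And>q. q \<in> W \<Longrightarrow> f q = g q) \<Longrightarrow> cdiff g p"
  unfolding cdiff_def using has_cderiv_cong by blast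

lemma cderiv_cong:
  assumes "open W" "p \<in> W" "\<And>q. q \<in> W \<Longrightarrow> f q = g q" "c \<in> A" "p \<in> cdom c" "cdiff f p"
  shows "cderiv c g p = cderiv c f p"
  using has_cderiv_unique[OF has_cderiv_cong[OF cdiffD[OF assms(6,4,5)] assms(1-5)]] .

lemma pderiv_cong:
  assumes "open W" "p \<in> W" "\<And>q. q \<in> W \<Longrightarrow> f q = g q" "c \<in> A" "p \<in> cdom c" "cdiff f p"
  shows "pderiv c k g p = pderiv c k f p"
  using cderiv_cong[OF assms] by (simp add: pderiv_def)

lemma cdiff_const [simp, intro]: "cdiff (\<lambda>_. a) p"
  unfolding cdiff_def by (intro ballI impI exI[of _ "\<lambda>_. 0"]) (rule has_cderiv_const)

lemma pderiv_const [simp]: "pderiv c k (\<lambda>_. a) p = 0"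
  by (simp add: pderiv_def has_cderiv_unique[OF has_cderiv_const])

lemma cdiff_add [intro]:
  assumes f: "cdiff f p" and g: "cdiff g p"
  shows "cdiff (\<lambda>q. f q + g q) p"
proof -
  obtain c where c: "c \<in> A" "p \<in> cdom c" by (rule chart_at)
  show ?thesis
    by (rule cdiffI[OF c has_cderiv_add[OF cdiffD[OF f c] cdiffD[OF g c]]])
qed

lemma pderiv_add:
  "c \<in> A \<Longrightarrow> p \<in> cdom c \<Longrightarrow> cdiff f p \<Longrightarrow> cdiff g p \<Longrightarrow>
    pderiv c k (\<lambda>q. f q + g q) p = pderiv c k f p + pderiv c k g p"
  by (simp add: pderiv_def has_cderiv_unique[OF has_cderiv_add[OF cdiffD cdiffD]])

lemma has_cderiv_mult:
  assumes "has_cderiv c f p D" "has_cderiv c g p E" "c \<in> A" "p \<in> cdom c"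
  shows "has_cderiv c (\<lambda>q. f q * g q) p (\<lambda>v. f p * E v + D v * g p)"
  using assms has_derivative_mult[of "\<lambda>z. f (param c z)" D "coord c p" UNIV "\<lambda>z. g (param c z)" E]
  by (simp add: has_cderiv_def complex_linear_def distrib_left)

lemma cdiff_mult [intro]:
  assumes f: "cdiff f p" and g: "cdiff g p"
  shows "cdiff (\<lambda>q. f q * g q) p"
proof -
  obtain c where c: "c \<in> A" "p \<in> cdom c" by (rule chart_at)
  show ?thesis
    by (rule cdiffI[OF c has_cderiv_mult[OF cdiffD[OF f c] cdiffD[OF g c] c]])
qed

lemma pderiv_mult:
  "c \<in> A \<Longrightarrow> p \<in> cdom c \<Longrightarrow> cdiff f p \<Longrightarrow> cdiff g p \<Longrightarrow>
    pderiv c k (\<lambda>q. f q * g q) p = f p * pderiv c k g p + pderiv c k f p * g p"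
  by (simp add: pderiv_def has_cderiv_unique[OF has_cderiv_mult[OF cdiffD cdiffD]])

lemma cdiff_diff [intro]: "cdiff f p \<Longrightarrow> cdiff g p \<Longrightarrow> cdiff (\<lambda>q. f q - g q) p"
  using cdiff_add[of f p "\<lambda>q. (-1) * g q"] cdiff_mult[of "\<lambda>_. -1" p g] by simp

lemma pderiv_diff:
  assumes "c \<in> A" "p \<in> cdom c" "cdiff f p" "cdiff g p"
  shows "pderiv c k (\<lambda>q. f q - g q) p = pderiv c k f p - pderiv c k g p"
  using pderiv_add[OF assms(1-3) cdiff_mult[OF cdiff_const assms(4), of "-1"], of k]
    pderiv_mult[OF assms(1,2) cdiff_const assms(4), of k "-1"] by simp

lemma cdiff_sum: "(\<And>i. i \<in> I \<Longrightarrow> cdiff (f i) p) \<Longrightarrow> cdiff (\<lambda>q. \<Sum>i\<in>I. f i q) p"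
  by (induction I rule: infinite_finite_induct) auto

lemma cdiff_inverse:
  assumes "cdiff f p" "f p \<noteq> 0"
  shows "cdiff (\<lambda>q. inverse (f q)) p"
proof -
  obtain c where c: "c \<in> A" "p \<in> cdom c" by (rule chart_at)
  have "((\<lambda>z. f (param c z)) has_derivative cderiv c f p) (at (coord c p))"
    and "complex_linear (cderiv c f p)" using cdiffD[OF assms(1) c] by (auto simp: has_cderiv_def)
  then have "((\<lambda>z. inverse (f (param c z))) has_derivative
      (\<lambda>h. - (inverse (f p) * cderiv c f p h * inverse (f p)))) (at (coord c p))"
    using Deriv.has_derivative_inverse[where f = "\<lambda>z. f (param c z)" and x = "coord c p" and S = UNIV
        and f' = "cderiv c f p"] assms(2) unfolding param_coord[OF c] by blast
  with \<open>complex_linear (cderiv c f p)\<close>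
  have "has_cderiv c (\<lambda>q. inverse (f q)) p (\<lambda>h. - (inverse (f p) * cderiv c f p h * inverse (f p)))"
    by (simp add: has_cderiv_def complex_linear_def)
  then show ?thesis using cdiffI[OF c] by blast
qed

lemma cdiff_divide: "cdiff f p \<Longrightarrow> cdiff g p \<Longrightarrow> g p \<noteq> 0 \<Longrightarrow> cdiff (\<lambda>q. f q / g q) p"
  using cdiff_mult[OF _ cdiff_inverse, of f p g] by (simp add: divide_inverse)

lemma cdiff_isCont:
  assumes "cdiff f p"
  shows "isCont f p"
proof -
  obtain c where c: "c \<in> A" "p \<in> cdom c" by (rule chart_at)
  have f: "isCont (\<lambda>z. f (param c z)) (coord c p)"
    by (rule has_derivative_continuous[OF conjunct1[OF cdiffD[OF assms c, unfolded has_cderiv_def]]])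
  have "isCont (coord c) p"
    using continuous_coord[OF c(1)] c by (simp add: continuous_on_eq_continuous_at)
  from isCont_o2[OF this f] have "isCont (\<lambda>q. f (param c (coord c q))) p" .
  moreover have "\<forall>\<^sub>F q in nhds p. f (param c (coord c q)) = f q"
    unfolding eventually_nhds using c by (intro exI[of _ "cdom c"]) simp
  ultimately show ?thesis by (simp only: isCont_cong)
qed

lemma
  assumes "open U" "f \<in> holo A U" "p \<in> U" and c: "c \<in> A" "p \<in> cdom c"
  shows cdiff_pderiv: "cdiff (pderiv c k f) p"
    and pderiv_commute: "pderiv c j (pderiv c k f) p = pderiv c k (pderiv c j f) p"
proof -
  let ?S = "coord c ` (U \<inter> cdom c)" and ?f = "\<lambda>z. f (param c z)"
  have S: "open ?S" by (rule open_coord_image) fact+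
  have f: "holo_on ?S ?f" using assms(2) c unfolding holo_def by blast
  have p: "coord c p \<in> ?S" using assms by blast
  have eq: "pderiv c k f (param c z) = frechet_derivative ?f (at z) (axis k 1)" if "z \<in> ?S" for k z
    using that c by (auto simp: pderiv_def cderiv_def)
  have d: "((\<lambda>z. pderiv c k f (param c z)) has_derivative
      frechet_derivative (\<lambda>z. frechet_derivative ?f (at z) (axis k 1)) (at (coord c p))) (at (coord c p))" for k
    by (rule has_derivative_transform_within_open
        [OF holo_onD(1)[OF holo_on_frechet_derivative[OF S f] p] S p])
       (simp only: eq)
  then have d': "has_cderiv c (pderiv c k f) p
      (frechet_derivative (\<lambda>z. frechet_derivative ?f (at z) (axis k 1)) (at (coord c p)))" for k
    using holo_onD(2)[OF holo_on_frechet_derivative[OF S f] p]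
    by (simp add: has_cderiv_def complex_linear_def)
  then show "cdiff (pderiv c k f) p" by (rule cdiffI[OF c])
  show "pderiv c j (pderiv c k f) p = pderiv c k (pderiv c j f) p"
    unfolding pderiv_def[of c _ "pderiv c _ f"] has_cderiv_unique[OF d']
    by (rule holo_on_mixed_derivatives[OF S f p])
qed

section \<open>The tangent bundle\<close>

abbreviation "T \<equiv> tangent_bundle A"

definition tvec :: "('m, 'n) chart \<Rightarrow> 'm \<Rightarrow> complex^'n \<Rightarrow> ('m, 'n) tangent" where
  "tvec c p u = (\<lambda>d. if d \<in> A \<and> p \<in> cdom d then trans_deriv c d p u else 0)"

lemma Fib_T_iff:
  "v \<in> Fib T p \<longleftrightarrow> (\<forall>c. c \<notin> A \<or> p \<notin> cdom c \<longrightarrow> v c = 0) \<and>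
     (\<forall>c\<in>A. \<forall>d\<in>A. p \<in> cdom c \<and> p \<in> cdom d \<longrightarrow> v d = trans_deriv c d p (v c))"
  by (simp add: tangent_bundle_def trans_deriv_def)

lemma Scl_T [simp]: "Scl T a v = (\<lambda>c. a *s v c)"
  by (simp add: tangent_bundle_def)

lemma tvec_in_T: "c \<in> A \<Longrightarrow> p \<in> cdom c \<Longrightarrow> tvec c p u \<in> Fib T p"
  by (auto simp: Fib_T_iff tvec_def trans_deriv_trans)

lemma tvec_self [simp]: "c \<in> A \<Longrightarrow> p \<in> cdom c \<Longrightarrow> tvec c p u c = u"
  by (simp add: tvec_def trans_deriv_self)

lemma tvec_eq:
  assumes "v \<in> Fib T p" "c \<in> A" "p \<in> cdom c"
  shows "v = tvec c p (v c)"
  using assms unfolding Fib_T_iff tvec_def fun_eq_iff by (metis (full_types))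

lemma tangent_eqI:
  "v \<in> Fib T p \<Longrightarrow> w \<in> Fib T p \<Longrightarrow> c \<in> A \<Longrightarrow> p \<in> cdom c \<Longrightarrow> v c = w c \<Longrightarrow> v = w"
  using tvec_eq by metis

lemma inv_into_T:
  assumes "c \<in> A" "p \<in> cdom c"
  shows "inv_into (Fib T p) (\<lambda>v. v c) u = tvec c p u"
  by (rule inv_into_f_eq) (use assms tvec_in_T in \<open>auto intro: inj_onI tangent_eqI[OF _ _ assms]\<close>)

lemma dif_eq:
  assumes "cdiff f p" "c \<in> A" "p \<in> cdom c" "v \<in> Fib T p"
  shows "dif A f p v = (\<Sum>k\<in>UNIV. v c $ k * pderiv c k f p)"
proof -
  define d where "d = (SOME d. d \<in> A \<and> p \<in> cdom d)"
  have d: "d \<in> A" "p \<in> cdom d" using assms unfolding d_def by (metis (mono_tags, lifting) someI)+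
  have "dif A f p v = cderiv d f p (v d)"
    using assms(4) by (simp add: dif_def cderiv_def Let_def d_def)
  also have "v d = trans_deriv c d p (v c)" using assms(2-4) d unfolding Fib_T_iff by blast
  also have "cderiv d f p \<dots> = cderiv c f p (v c)"
    by (rule cderiv_change_chart[symmetric]) fact+
  finally show ?thesis using cderiv_eq_sum[OF assms(1-3)] by simp
qed

lemma dif_outside: "v \<notin> Fib T p \<Longrightarrow> dif A f p v = 0"
  by (simp add: dif_def)

lemma dif_tvec: "cdiff f p \<Longrightarrow> c \<in> A \<Longrightarrow> p \<in> cdom c \<Longrightarrow> dif A f p (tvec c p (axis k 1)) = pderiv c k f p"
  by (simp add: dif_eq tvec_in_T axis_def if_distrib[of "\<lambda>x. x * _"] cong: if_cong)

lemma vector_space_T: "vector_space (Scl T)"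
  by unfold_locales (simp_all add: fun_eq_iff vec_eq_iff distrib_left distrib_right mult.assoc)

lemma subspace_T: "module.subspace (Scl T) (Fib T p)"
proof -
  have m: "module (Scl T)" using vector_space_T by (simp add: module_iff_vector_space)
  have lin: "linear (trans_deriv c d p)" "trans_deriv c d p (a *s u) = a *s trans_deriv c d p u"
    if "c \<in> A" "d \<in> A" "p \<in> cdom c \<and> p \<in> cdom d" for c d a u
    using trans_deriv_linear[of c p d] that by auto
  show ?thesis unfolding module.subspace_def[OF m]
  proof (intro conjI ballI allI)
    show "0 \<in> Fib T p" unfolding Fib_T_iff using lin by (simp add: linear_0)
  next
    fix v w assume v: "v \<in> Fib T p" and w: "w \<in> Fib T p"
    show "v + w \<in> Fib T p"
      unfolding Fib_T_iff
    proof (intro conjI allI impI ballI)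
      fix c d assume cd: "c \<in> A" "d \<in> A" "p \<in> cdom c \<and> p \<in> cdom d"
      have "v d = trans_deriv c d p (v c)" "w d = trans_deriv c d p (w c)"
        using v w cd unfolding Fib_T_iff by blast+
      then show "(v + w) d = trans_deriv c d p ((v + w) c)" by (simp add: linear_add[OF lin(1)[OF cd]])
    next
      fix c assume "c \<notin> A \<or> p \<notin> cdom c"
      then have "v c = 0" "w c = 0" using v w unfolding Fib_T_iff by blast+
      then show "(v + w) c = 0" by simp
    qed
  next
    fix a v assume v: "v \<in> Fib T p"
    show "Scl T a v \<in> Fib T p"
      unfolding Fib_T_iff
    proof (intro conjI allI impI ballI)
      fix c d assume cd: "c \<in> A" "d \<in> A" "p \<in> cdom c \<and> p \<in> cdom d"
      have "v d = trans_deriv c d p (v c)" using v cd unfolding Fib_T_iff by blast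
      then show "Scl T a v d = trans_deriv c d p (Scl T a v c)" by (simp add: lin(2)[OF cd])
    next
      fix c assume "c \<notin> A \<or> p \<notin> cdom c"
      then have "v c = 0" using v unfolding Fib_T_iff by blast
      then show "Scl T a v c = 0" by simp
    qed
  qed
qed

lemma holo_bundle_T: "holo_bundle A T"
proof -
  have Triv: "Triv T = {(cdom c, \<lambda>p v. v c) | c. c \<in> A}" by (simp add: tangent_bundle_def)
  have bij: "bij_betw (\<lambda>v. v c) (Fib T p) UNIV" if "c \<in> A" "p \<in> cdom c" for c p
    unfolding bij_betw_def
  proof
    show "inj_on (\<lambda>v. v c) (Fib T p)" using tangent_eqI that by (blast intro: inj_onI)
    have "u \<in> (\<lambda>v. v c) ` Fib T p" for u
      using tvec_in_T[OF that] tvec_self[OF that] by (metis image_eqI)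
    then show "(\<lambda>v. v c) ` Fib T p = UNIV" by blast
  qed
  have tr: "(\<lambda>p. inv_into (Fib T p) (\<lambda>v. v c) x d $ i) \<in> holo A (cdom c \<inter> cdom d)"
    if c: "c \<in> A" and d: "d \<in> A" for c d x i
    unfolding holo_iff
  proof
    fix p assume p: "p \<in> cdom c \<inter> cdom d"
    have "cdiff (\<lambda>p. \<Sum>k\<in>UNIV. x $ k * pderiv c k (\<lambda>q. coord d q $ i) p) p"
      by (intro cdiff_sum cdiff_mult cdiff_const cdiff_pderiv[where U = "cdom d"])
         (use p c d cdiff_coord in \<open>auto simp: holo_iff\<close>)
    then show "cdiff (\<lambda>p. inv_into (Fib T p) (\<lambda>v. v c) x d $ i) p"
    proof (rule cdiff_cong[where W = "cdom c \<inter> cdom d"])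
      fix q assume q: "q \<in> cdom c \<inter> cdom d"
      then show "(\<Sum>k\<in>UNIV. x $ k * pderiv c k (\<lambda>q. coord d q $ i) q)
          = inv_into (Fib T q) (\<lambda>v. v c) x d $ i"
        using c d cderiv_eq_sum[OF cdiff_coord[OF d, of q i] c, of x]
        by (simp add: inv_into_T cderiv_coord tvec_def)
    qed (use p c d in auto)
  qed
  have cover: "(\<Union>(U, \<Phi>)\<in>Triv T. U) = UNIV"
  proof -
    have "p \<in> (\<Union>(U, \<Phi>)\<in>Triv T. U)" for p
      using chart_at[of p] unfolding Triv by blast
    then show ?thesis by blast
  qed
  have op: "open U" if "(U, f) \<in> A" for U f using open_cdom[OF that] by simp
  show ?thesis unfolding holo_bundle_def
    using op vector_space_T subspace_T cover bij tr by (auto simp: Triv)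
qed

end

section \<open>Frames and sections of holomorphic bundles\<close>

definition frame ::
  "('m, 'v::ab_group_add, 'r::finite) hbundle \<Rightarrow> ('m \<Rightarrow> 'v \<Rightarrow> complex^'r) \<Rightarrow> 'r \<Rightarrow> 'm \<Rightarrow> 'v" where
  "frame E \<Phi> k p = inv_into (Fib E p) (\<Phi> p) (axis k 1)"

definition coframe ::
  "('m, 'v::ab_group_add, 'r::finite) hbundle \<Rightarrow> ('m \<Rightarrow> 'v \<Rightarrow> complex^'r) \<Rightarrow> 'r \<Rightarrow> 'm \<Rightarrow> 'v \<Rightarrow> complex"
  where "coframe E \<Phi> k p = (\<lambda>x. if x \<in> Fib E p then \<Phi> p x $ k else 0)"

lemma dual_iff:
  "\<alpha> \<in> Fib (dual_bundle E) p \<longleftrightarrow>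
     (\<forall>x\<in>Fib E p. \<forall>y\<in>Fib E p. \<alpha> (x + y) = \<alpha> x + \<alpha> y) \<and>
     (\<forall>a. \<forall>x\<in>Fib E p. \<alpha> (Scl E a x) = a * \<alpha> x) \<and> (\<forall>x. x \<notin> Fib E p \<longrightarrow> \<alpha> x = 0)"
  unfolding hom_bundle_def trivial_line_def hbundle.simps mem_Collect_eq by blast

locale hbundle_on = cmanifold A for A :: "('m::{t2_space,second_countable_topology}, 'n::finite) chart set" +
  fixes E :: "('m, 'v::ab_group_add, 'r::finite) hbundle"
  assumes holo_bundle: "holo_bundle A E"
begin

lemma module_Scl: "module (Scl E)"
  using holo_bundle unfolding holo_bundle_def module_iff_vector_space by (elim conjE)

lemma subspace_Fib: "module.subspace (Scl E) (Fib E p)"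
  using holo_bundle unfolding holo_bundle_def by (elim conjE allE)

lemma Triv_cover: "(\<Union>(U, \<Phi>)\<in>Triv E. U) = UNIV"
  using holo_bundle unfolding holo_bundle_def by (elim conjE)

lemma Triv_props:
  "\<forall>(U, \<Phi>)\<in>Triv E. open U \<and>
        (\<forall>p\<in>U. bij_betw (\<Phi> p) (Fib E p) UNIV \<and>
           (\<forall>x\<in>Fib E p. \<forall>y\<in>Fib E p. \<Phi> p (x + y) = \<Phi> p x + \<Phi> p y) \<and>
           (\<forall>a. \<forall>x\<in>Fib E p. \<Phi> p (Scl E a x) = a *s \<Phi> p x))"
  using holo_bundle unfolding holo_bundle_def by (elim conjE)

lemma Triv_transition:
  "\<forall>(U, \<Phi>)\<in>Triv E. \<forall>(W, \<Psi>)\<in>Triv E. \<forall>x i.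
        (\<lambda>p. \<Psi> p (inv_into (Fib E p) (\<Phi> p) x) $ i) \<in> holo A (U \<inter> W)"
  using holo_bundle unfolding holo_bundle_def by (elim conjE)

lemma Fib_0 [simp]: "0 \<in> Fib E p"
  by (rule module.subspace_0[OF module_Scl subspace_Fib])

lemma Fib_add [intro]: "x \<in> Fib E p \<Longrightarrow> y \<in> Fib E p \<Longrightarrow> x + y \<in> Fib E p"
  by (rule module.subspace_add[OF module_Scl subspace_Fib])

lemma Fib_scale [intro]: "x \<in> Fib E p \<Longrightarrow> Scl E a x \<in> Fib E p"
  by (rule module.subspace_scale[OF module_Scl subspace_Fib])

lemma triv_at: obtains W \<Phi> where "(W, \<Phi>) \<in> Triv E" "p \<in> W"
proof -
  have "p \<in> (\<Union>(U, \<Phi>)\<in>Triv E. U)" using Triv_cover by simp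
  then show thesis using that by blast
qed

lemma open_triv: "(W, \<Phi>) \<in> Triv E \<Longrightarrow> open W"
  using Triv_props by blast

context
  fixes W \<Phi> p
  assumes \<Phi>: "(W, \<Phi>) \<in> Triv E" "p \<in> W"
begin

lemma triv_bij: "bij_betw (\<Phi> p) (Fib E p) UNIV"
  using Triv_props \<Phi> by blast

lemma triv_add: "x \<in> Fib E p \<Longrightarrow> y \<in> Fib E p \<Longrightarrow> \<Phi> p (x + y) = \<Phi> p x + \<Phi> p y"
  using Triv_props \<Phi> by blast

lemma triv_scale: "x \<in> Fib E p \<Longrightarrow> \<Phi> p (Scl E a x) = a *s \<Phi> p x"
  using Triv_props \<Phi> by blast

lemma triv_eqI: "x \<in> Fib E p \<Longrightarrow> y \<in> Fib E p \<Longrightarrow> (\<And>i. \<Phi> p x $ i = \<Phi> p y $ i) \<Longrightarrow> x = y"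
  using inj_onD[OF bij_betw_imp_inj_on[OF triv_bij], of x y] by (simp add: vec_eq_iff)

lemma triv_0: "\<Phi> p 0 = 0"
  using triv_add[OF Fib_0 Fib_0] by simp

lemma frame_in: "frame E \<Phi> k p \<in> Fib E p"
  unfolding frame_def by (rule inv_into_into) (use triv_bij in \<open>simp add: bij_betw_def\<close>)

lemma triv_frame: "\<Phi> p (frame E \<Phi> k p) = axis k 1"
  unfolding frame_def by (rule f_inv_into_f) (use triv_bij in \<open>simp add: bij_betw_def\<close>)

lemma triv_sum:
  assumes "finite I" "\<And>k. k \<in> I \<Longrightarrow> x k \<in> Fib E p"
  shows "(\<Sum>k\<in>I. Scl E (a k) (x k)) \<in> Fib E p \<and>
    \<Phi> p (\<Sum>k\<in>I. Scl E (a k) (x k)) = (\<Sum>k\<in>I. a k *s \<Phi> p (x k))"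
  using assms
proof (induction I rule: finite_induct)
  case empty
  show ?case using triv_0 by simp
next
  case (insert i I)
  then have "(\<Sum>k\<in>I. Scl E (a k) (x k)) \<in> Fib E p" "Scl E (a i) (x i) \<in> Fib E p" by auto
  then show ?case using insert by (simp add: triv_add triv_scale Fib_add)
qed

lemma frame_expand:
  assumes x: "x \<in> Fib E p"
  shows "x = (\<Sum>k\<in>UNIV. Scl E (\<Phi> p x $ k) (frame E \<Phi> k p))"
proof -
  note * = triv_sum[of UNIV "\<lambda>k. frame E \<Phi> k p" "\<lambda>k. \<Phi> p x $ k", OF finite frame_in]
  have "\<Phi> p (\<Sum>k\<in>UNIV. Scl E (\<Phi> p x $ k) (frame E \<Phi> k p)) = \<Phi> p x"
    using * by (simp add: triv_frame basis_expansion)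
  then show ?thesis using triv_eqI[OF x conjunct1[OF *]] by simp
qed

end

lemma sections_iff:
  "s \<in> sections A E U \<longleftrightarrow> (\<forall>p\<in>U. s p \<in> Fib E p) \<and>
     (\<forall>W \<Phi> p i. (W, \<Phi>) \<in> Triv E \<and> p \<in> U \<and> p \<in> W \<longrightarrow> cdiff (\<lambda>q. \<Phi> q (s q) $ i) p)"
  unfolding sections_def holo_iff by auto

lemma sections_in: "s \<in> sections A E U \<Longrightarrow> p \<in> U \<Longrightarrow> s p \<in> Fib E p"
  unfolding sections_iff by blast

lemma sections_cdiff:
  "s \<in> sections A E U \<Longrightarrow> p \<in> U \<Longrightarrow> (W, \<Phi>) \<in> Triv E \<Longrightarrow> p \<in> W \<Longrightarrow> cdiff (\<lambda>q. \<Phi> q (s q) $ i) p"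
  unfolding sections_iff by blast

lemma sections_subset: "s \<in> sections A E U \<Longrightarrow> U' \<subseteq> U \<Longrightarrow> s \<in> sections A E U'"
  unfolding sections_iff by blast

lemma cdiff_frame:
  assumes "(W, \<Phi>) \<in> Triv E" "p \<in> W" "(W', \<Psi>) \<in> Triv E" "p \<in> W'"
  shows "cdiff (\<lambda>q. \<Psi> q (frame E \<Phi> k q) $ i) p"
proof -
  have "(\<lambda>p. \<Psi> p (inv_into (Fib E p) (\<Phi> p) x) $ i) \<in> holo A (W \<inter> W')" for x i
    using Triv_transition assms by blast
  then show ?thesis unfolding frame_def holo_iff using assms by blast
qed

text \<open>Holomorphy needs to be checked in one trivialization around each point only.\<close>

lemma sectionsI:
  assumes "open U" and Fib: "\<And>p. p \<in> U \<Longrightarrow> s p \<in> Fib E p"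
    and one: "\<And>p. p \<in> U \<Longrightarrow> \<exists>W \<Phi>. (W, \<Phi>) \<in> Triv E \<and> p \<in> W \<and> (\<forall>i. cdiff (\<lambda>q. \<Phi> q (s q) $ i) p)"
  shows "s \<in> sections A E U"
  unfolding sections_iff
proof (intro conjI allI impI ballI)
  fix W' \<Psi> p i assume p: "(W', \<Psi>) \<in> Triv E \<and> p \<in> U \<and> p \<in> W'"
  obtain W \<Phi> where \<Phi>: "(W, \<Phi>) \<in> Triv E" "p \<in> W" and d: "\<And>i. cdiff (\<lambda>q. \<Phi> q (s q) $ i) p"
    using one p by metis
  have "cdiff (\<lambda>q. \<Sum>k\<in>UNIV. \<Phi> q (s q) $ k * \<Psi> q (frame E \<Phi> k q) $ i) p"
    by (intro cdiff_sum cdiff_mult d cdiff_frame[OF \<Phi>]) (use p in auto)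
  then show "cdiff (\<lambda>q. \<Psi> q (s q) $ i) p"
  proof (rule cdiff_cong)
    show "open (U \<inter> W \<inter> W')" using \<open>open U\<close> open_triv \<Phi> p by auto
    show "p \<in> U \<inter> W \<inter> W'" using \<Phi> p by auto
    fix q assume q: "q \<in> U \<inter> W \<inter> W'"
    have "\<Psi> q (s q) = \<Psi> q (\<Sum>k\<in>UNIV. Scl E (\<Phi> q (s q) $ k) (frame E \<Phi> k q))"
      by (rule arg_cong[OF frame_expand[OF \<Phi>(1) _ Fib]]) (use q in auto)
    also have "\<dots> = (\<Sum>k\<in>UNIV. \<Phi> q (s q) $ k *s \<Psi> q (frame E \<Phi> k q))"
      by (rule conjunct2[OF triv_sum]) (use frame_in[OF \<Phi>(1)] q p in auto)
    finally show "(\<Sum>k\<in>UNIV. \<Phi> q (s q) $ k * \<Psi> q (frame E \<Phi> k q) $ i) = \<Psi> q (s q) $ i"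
      by simp
  qed
qed (rule Fib)

lemma sections_local:
  assumes "open U" and loc: "\<And>p. p \<in> U \<Longrightarrow> \<exists>W. open W \<and> p \<in> W \<and> s \<in> sections A E W"
  shows "s \<in> sections A E U"
proof (rule sectionsI[OF assms(1)])
  fix p assume "p \<in> U"
  then obtain W where W: "p \<in> W" "s \<in> sections A E W" using loc by blast
  show "s p \<in> Fib E p" using sections_in W by blast
  obtain W' \<Phi> where "(W', \<Phi>) \<in> Triv E" "p \<in> W'" by (rule triv_at)
  then show "\<exists>W \<Phi>. (W, \<Phi>) \<in> Triv E \<and> p \<in> W \<and> (\<forall>i. cdiff (\<lambda>q. \<Phi> q (s q) $ i) p)"
    using sections_cdiff[OF W(2,1)] by metis
qed

lemma sections_cong:
  assumes "open U" "s \<in> sections A E U" "\<And>p. p \<in> U \<Longrightarrow> s p = t p"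
  shows "t \<in> sections A E U"
  unfolding sections_iff
proof (intro conjI allI impI ballI)
  fix p assume "p \<in> U" then show "t p \<in> Fib E p" using sections_in[OF assms(2)] assms(3) by metis
next
  fix W \<Phi> p i assume p: "(W, \<Phi>) \<in> Triv E \<and> p \<in> U \<and> p \<in> W"
  show "cdiff (\<lambda>q. \<Phi> q (t q) $ i) p"
    by (rule cdiff_cong[OF sections_cdiff[OF assms(2), of p W \<Phi>], of U]) (use p assms in auto)
qed

lemma sections_add:
  assumes "open U" "s \<in> sections A E U" "t \<in> sections A E U"
  shows "(\<lambda>q. s q + t q) \<in> sections A E U"
proof (rule sectionsI[OF assms(1)])
  fix p assume p: "p \<in> U"
  show "s p + t p \<in> Fib E p" using sections_in assms p by (intro Fib_add) auto
  obtain W \<Phi> where \<Phi>: "(W, \<Phi>) \<in> Triv E" "p \<in> W" by (rule triv_at)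
  have "cdiff (\<lambda>q. \<Phi> q (s q + t q) $ i) p" for i
  proof (rule cdiff_cong)
    show "cdiff (\<lambda>q. \<Phi> q (s q) $ i + \<Phi> q (t q) $ i) p"
      by (intro cdiff_add sections_cdiff[OF assms(2) p \<Phi>] sections_cdiff[OF assms(3) p \<Phi>])
    show "open (U \<inter> W)" "p \<in> U \<inter> W" using open_triv \<Phi> p assms(1) by auto
    show "\<Phi> q (s q) $ i + \<Phi> q (t q) $ i = \<Phi> q (s q + t q) $ i" if "q \<in> U \<inter> W" for q
      using that triv_add[OF \<Phi>(1), of q] sections_in[OF assms(2)] sections_in[OF assms(3)] by simp
  qed
  then show "\<exists>W \<Phi>. (W, \<Phi>) \<in> Triv E \<and> p \<in> W \<and> (\<forall>i. cdiff (\<lambda>q. \<Phi> q (s q + t q) $ i) p)"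
    using \<Phi> by metis
qed

lemma sections_scale:
  assumes "open U" "f \<in> holo A U" "s \<in> sections A E U"
  shows "(\<lambda>q. Scl E (f q) (s q)) \<in> sections A E U"
proof (rule sectionsI[OF assms(1)])
  fix p assume p: "p \<in> U"
  show "Scl E (f p) (s p) \<in> Fib E p" using sections_in assms p by (intro Fib_scale) auto
  obtain W \<Phi> where \<Phi>: "(W, \<Phi>) \<in> Triv E" "p \<in> W" by (rule triv_at)
  have "cdiff (\<lambda>q. \<Phi> q (Scl E (f q) (s q)) $ i) p" for i
  proof (rule cdiff_cong)
    show "cdiff (\<lambda>q. f q * \<Phi> q (s q) $ i) p"
      using assms(2) p by (intro cdiff_mult sections_cdiff[OF assms(3) p \<Phi>]) (auto simp: holo_iff)
    show "open (U \<inter> W)" "p \<in> U \<inter> W" using open_triv \<Phi> p assms(1) by auto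
    show "f q * \<Phi> q (s q) $ i = \<Phi> q (Scl E (f q) (s q)) $ i" if "q \<in> U \<inter> W" for q
      using that triv_scale[OF \<Phi>(1), of q] sections_in[OF assms(3)] by simp
  qed
  then show "\<exists>W \<Phi>. (W, \<Phi>) \<in> Triv E \<and> p \<in> W \<and> (\<forall>i. cdiff (\<lambda>q. \<Phi> q (Scl E (f q) (s q)) $ i) p)"
    using \<Phi> by metis
qed

text \<open>Sections are continuous in a trivialization, so they are determined by their values on a
  dense set.\<close>

lemma sections_eq_if_dense:
  assumes "open U" "s \<in> sections A E U" "t \<in> sections A E U" "closure R = UNIV"
    and eq: "\<And>p. p \<in> U \<inter> R \<Longrightarrow> s p = t p" and p: "p \<in> U"
  shows "s p = t p"
proof -
  obtain W \<Phi> where \<Phi>: "(W, \<Phi>) \<in> Triv E" "p \<in> W" by (rule triv_at)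
  show ?thesis
  proof (rule triv_eqI[OF \<Phi>])
    show "s p \<in> Fib E p" "t p \<in> Fib E p" using assms sections_in by auto
    fix i
    define h where "h q = \<Phi> q (s q) $ i - \<Phi> q (t q) $ i" for q
    have "isCont h p"
      unfolding h_def
      by (intro cdiff_isCont cdiff_diff sections_cdiff[OF assms(2) p \<Phi>] sections_cdiff[OF assms(3) p \<Phi>])
    have "h p = 0"
    proof (rule ccontr)
      assume "h p \<noteq> 0"
      then have "h p \<in> - {0}" by simp
      then obtain S where S: "open S" "p \<in> S" "\<And>q. q \<in> S \<Longrightarrow> h q \<in> - {0}"
        using \<open>isCont h p\<close> open_Compl[OF closed_singleton[of "0 :: complex"]]
        unfolding continuous_at_open by metis
      have "open (S \<inter> U)" "p \<in> S \<inter> U" using S p assms(1) by auto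
      then have "S \<inter> U \<inter> R \<noteq> {}"
        using open_Int_closure_eq_empty[of "S \<inter> U" R] assms(4) by blast
      then obtain q where "q \<in> S" "q \<in> U \<inter> R" by blast
      then show False using S(3)[of q] eq[of q] by (simp add: h_def)
    qed
    then show "\<Phi> p (s p) $ i = \<Phi> p (t p) $ i" by (simp add: h_def)
  qed
qed

text \<open>The matrix entries of a homomorphism are the coordinates of the images of a frame.\<close>

lemma hom_sectionsI:
  assumes "\<And>p. p \<in> U \<Longrightarrow> P p \<in> Fib (hom_bundle F E) p"
    and "\<And>W \<Phi> k. (W, \<Phi>) \<in> Triv F \<Longrightarrow> (\<lambda>q. P q (frame F \<Phi> k q)) \<in> sections A E (U \<inter> W)"
  shows "P \<in> sections A (hom_bundle F E) U"
proof -
  have "(\<lambda>p. \<Psi> p (P p (frame F \<Phi> k p)) $ i) \<in> holo A (U \<inter> (W \<inter> W'))"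
    if "(W, \<Phi>) \<in> Triv F" "(W', \<Psi>) \<in> Triv E" for W \<Phi> W' \<Psi> i k
    unfolding holo_iff using sections_cdiff[OF assms(2)[OF that(1)] _ that(2)] by blast
  then have *: "(\<lambda>p. \<Psi> p (P p (inv_into (Fib F p) (\<Phi> p) (axis k 1))) $ i) \<in> holo A (U \<inter> (W \<inter> W'))"
    if "(W, \<Phi>) \<in> Triv F" "(W', \<Psi>) \<in> Triv E" for W \<Phi> W' \<Psi> i k
    using that unfolding frame_def by blast
  show ?thesis
    unfolding sections_def mem_Collect_eq
    by (intro conjI ballI assms(1)) (auto simp: hom_bundle_def intro!: *)
qed

lemma coframe_dual:
  assumes "(W, \<Phi>) \<in> Triv E" "p \<in> W"
  shows "coframe E \<Phi> k p \<in> Fib (dual_bundle E) p"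
  unfolding dual_iff coframe_def
  by (simp add: triv_add[OF assms] triv_scale[OF assms] Fib_add Fib_scale)

lemma dual_0: "\<alpha> \<in> Fib (dual_bundle E) p \<Longrightarrow> \<alpha> 0 = 0"
  unfolding dual_iff by (metis Fib_0 add_cancel_right_right)

lemma dual_sum:
  assumes \<alpha>: "\<alpha> \<in> Fib (dual_bundle E) p" and "finite I" "\<And>k. k \<in> I \<Longrightarrow> x k \<in> Fib E p"
  shows "\<alpha> (\<Sum>k\<in>I. Scl E (a k) (x k)) = (\<Sum>k\<in>I. a k * \<alpha> (x k))"
  using assms(2,3)
proof (induction I rule: finite_induct)
  case empty
  show ?case using dual_0[OF \<alpha>] by simp
next
  case (insert i I)
  have "(\<Sum>k\<in>I. Scl E (a k) (x k)) \<in> Fib E p"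
    by (rule module.subspace_sum[OF module_Scl subspace_Fib]) (use insert in auto)
  then show ?case using insert \<alpha> unfolding dual_iff by (simp add: Fib_scale)
qed

lemma dual_expand:
  assumes "(W, \<Phi>) \<in> Triv E" "p \<in> W" and \<alpha>: "\<alpha> \<in> Fib (dual_bundle E) p" "x \<in> Fib E p"
  shows "\<alpha> x = (\<Sum>k\<in>UNIV. \<Phi> p x $ k * \<alpha> (frame E \<Phi> k p))"
  using dual_sum[OF \<alpha>(1), of UNIV "\<lambda>k. frame E \<Phi> k p" "\<lambda>k. \<Phi> p x $ k"]
    frame_expand[OF assms(1,2) \<alpha>(2)] frame_in[OF assms(1,2)] by simp

lemma dual_add: "\<alpha> \<in> Fib (dual_bundle E) p \<Longrightarrow> \<beta> \<in> Fib (dual_bundle E) p \<Longrightarrow> \<alpha> + \<beta> \<in> Fib (dual_bundle E) p"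
  unfolding dual_iff by (simp add: distrib_left)

lemma dual_scale: "\<alpha> \<in> Fib (dual_bundle E) p \<Longrightarrow> (\<lambda>x. a * \<alpha> x) \<in> Fib (dual_bundle E) p"
  unfolding dual_iff by (simp add: distrib_left)

lemma dual_eqI:
  assumes "(W, \<Phi>) \<in> Triv E" "p \<in> W" "\<alpha> \<in> Fib (dual_bundle E) p" "\<beta> \<in> Fib (dual_bundle E) p"
    "\<And>k. \<alpha> (frame E \<Phi> k p) = \<beta> (frame E \<Phi> k p)"
  shows "\<alpha> = \<beta>"
proof
  fix x show "\<alpha> x = \<beta> x"
    using dual_expand[OF assms(1-3), of x] dual_expand[OF assms(1,2,4), of x] assms(3-5)
    unfolding dual_iff by (cases "x \<in> Fib E p") auto
qed

end

section \<open>The exterior square of a bundle of rank 2\<close>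

locale hbundle2_on = hbundle_on A E
  for A :: "('m::{t2_space,second_countable_topology}, 'n::finite) chart set"
    and E :: "('m, 'v::ab_group_add, 2) hbundle"
begin

lemma ext2_iff:
  "B \<in> Fib (ext2 E) p \<longleftrightarrow>
     (\<forall>\<alpha>\<in>Fib (dual_bundle E) p. \<forall>\<beta>\<in>Fib (dual_bundle E) p. \<forall>\<gamma>\<in>Fib (dual_bundle E) p.
        B (\<alpha> + \<beta>) \<gamma> = B \<alpha> \<gamma> + B \<beta> \<gamma> \<and> B \<gamma> (\<alpha> + \<beta>) = B \<gamma> \<alpha> + B \<gamma> \<beta>) \<and>
     (\<forall>a. \<forall>\<alpha>\<in>Fib (dual_bundle E) p. \<forall>\<beta>\<in>Fib (dual_bundle E) p.
        B (\<lambda>x. a * \<alpha> x) \<beta> = a * B \<alpha> \<beta> \<and> B \<alpha> (\<lambda>x. a * \<beta> x) = a * B \<alpha> \<beta>) \<and>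
     (\<forall>\<alpha>\<in>Fib (dual_bundle E) p. B \<alpha> \<alpha> = 0) \<and>
     (\<forall>\<alpha> \<beta>. \<alpha> \<notin> Fib (dual_bundle E) p \<or> \<beta> \<notin> Fib (dual_bundle E) p \<longrightarrow> B \<alpha> \<beta> = 0)"
  by (simp add: ext2_def Let_def)

lemma Scl_ext2: "Scl (ext2 E) a B = (\<lambda>\<alpha> \<beta>. a * B \<alpha> \<beta>)"
  by (simp add: ext2_def)

lemma wedge_in:
  assumes "x \<in> Fib E p" "y \<in> Fib E p"
  shows "wedge E p x y \<in> Fib (ext2 E) p"
  unfolding ext2_iff wedge_def
  by (simp add: dual_add dual_scale algebra_simps)

context
  fixes W \<Phi> p
  assumes \<Phi>: "(W, \<Phi>) \<in> Triv E" "p \<in> W"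
begin

text \<open>Expanding both arguments in the dual frame, bilinearity and skew symmetry leave a single coefficient.\<close>

lemma ext2_expand:
  assumes B: "B \<in> Fib (ext2 E) p" and \<alpha>: "\<alpha> \<in> Fib (dual_bundle E) p" and \<beta>: "\<beta> \<in> Fib (dual_bundle E) p"
  shows "B \<alpha> \<beta> = (\<alpha> (frame E \<Phi> 1 p) * \<beta> (frame E \<Phi> 2 p) - \<alpha> (frame E \<Phi> 2 p) * \<beta> (frame E \<Phi> 1 p))
    * B (coframe E \<Phi> 1 p) (coframe E \<Phi> 2 p)"
proof -
  let ?e = "\<lambda>k. frame E \<Phi> k p" and ?f = "\<lambda>k. coframe E \<Phi> k p"
  let ?E' = "Fib (dual_bundle E) p"
  have f: "?f k \<in> ?E'" for k by (rule coframe_dual[OF \<Phi>])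
  have fe: "?f k (?e j) = (if k = j then 1 else 0)" for k j
    using frame_in[OF \<Phi>] triv_frame[OF \<Phi>] by (simp add: coframe_def axis_def)
  have exp: "\<gamma> = (\<lambda>x. \<gamma> (?e 1) * ?f 1 x) + (\<lambda>x. \<gamma> (?e 2) * ?f 2 x)" if \<gamma>: "\<gamma> \<in> ?E'" for \<gamma>
    by (rule dual_eqI[OF \<Phi> \<gamma> dual_add[OF dual_scale[OF f] dual_scale[OF f]]])
       (use exhaust_2 in \<open>auto simp: fe\<close>)
  have add: "B (\<gamma> + \<delta>) \<epsilon> = B \<gamma> \<epsilon> + B \<delta> \<epsilon>" "B \<epsilon> (\<gamma> + \<delta>) = B \<epsilon> \<gamma> + B \<epsilon> \<delta>"
    if "\<gamma> \<in> ?E'" "\<delta> \<in> ?E'" "\<epsilon> \<in> ?E'" for \<gamma> \<delta> \<epsilon>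
    using B that unfolding ext2_iff by blast+
  have scale: "B (\<lambda>x. a * \<gamma> x) \<delta> = a * B \<gamma> \<delta>" "B \<gamma> (\<lambda>x. a * \<delta> x) = a * B \<gamma> \<delta>"
    if "\<gamma> \<in> ?E'" "\<delta> \<in> ?E'" for a \<gamma> \<delta>
    using B that unfolding ext2_iff by blast+
  have alt: "B \<gamma> \<gamma> = 0" if "\<gamma> \<in> ?E'" for \<gamma>
    using B that unfolding ext2_iff by blast
  have "B (?f 1 + ?f 2) (?f 1 + ?f 2) = 0" by (intro alt dual_add f)
  moreover have "B (?f 1 + ?f 2) (?f 1 + ?f 2) = B (?f 1) (?f 2) + B (?f 2) (?f 1)"
    by (simp only: add f dual_add alt[OF f] add_0_left add_0_right)
       (rule add.commute)
  ultimately have "B (?f 2) (?f 1) + B (?f 1) (?f 2) = 0" by (simp only: add.commute)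
  then have skew: "B (?f 2) (?f 1) = - B (?f 1) (?f 2)" by (simp only: eq_neg_iff_add_eq_0)
  have "B \<alpha> \<beta> = B ((\<lambda>x. \<alpha> (?e 1) * ?f 1 x) + (\<lambda>x. \<alpha> (?e 2) * ?f 2 x))
      ((\<lambda>x. \<beta> (?e 1) * ?f 1 x) + (\<lambda>x. \<beta> (?e 2) * ?f 2 x))"
    using exp[OF \<alpha>] exp[OF \<beta>] by simp
  also have "\<dots> = \<alpha> (?e 1) * (\<beta> (?e 2) * B (?f 1) (?f 2)) + \<alpha> (?e 2) * (\<beta> (?e 1) * B (?f 2) (?f 1))"
    by (simp add: add scale f dual_add dual_scale alt)
  finally show ?thesis by (simp add: skew algebra_simps)
qed

lemma ext2_eqI:
  assumes "B \<in> Fib (ext2 E) p" "B' \<in> Fib (ext2 E) p"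
    "B (coframe E \<Phi> 1 p) (coframe E \<Phi> 2 p) = B' (coframe E \<Phi> 1 p) (coframe E \<Phi> 2 p)"
  shows "B = B'"
proof (intro ext)
  fix \<alpha> \<beta>
  show "B \<alpha> \<beta> = B' \<alpha> \<beta>"
  proof (cases "\<alpha> \<in> Fib (dual_bundle E) p \<and> \<beta> \<in> Fib (dual_bundle E) p")
    case True
    then show ?thesis using ext2_expand[OF assms(1)] ext2_expand[OF assms(2)] assms(3) by simp
  next
    case False
    then show ?thesis using assms(1,2) unfolding ext2_iff by (metis (no_types, lifting))
  qed
qed

lemma wedge_coframe:
  assumes "x \<in> Fib E p" "y \<in> Fib E p"
  shows "wedge E p x y (coframe E \<Phi> 1 p) (coframe E \<Phi> 2 p)
    = \<Phi> p x $ 1 * \<Phi> p y $ 2 - \<Phi> p y $ 1 * \<Phi> p x $ 2"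
  using assms coframe_dual[OF \<Phi>] by (simp add: wedge_def coframe_def)

lemma wedge_frame_coframe:
  "wedge E p (frame E \<Phi> 1 p) (frame E \<Phi> 2 p) (coframe E \<Phi> 1 p) (coframe E \<Phi> 2 p) = 1"
  by (simp add: wedge_coframe frame_in[OF \<Phi>] triv_frame[OF \<Phi>] axis_def)

lemma wedge_eq_scale:
  assumes "x \<in> Fib E p" "y \<in> Fib E p"
  shows "wedge E p x y = Scl (ext2 E) (\<Phi> p x $ 1 * \<Phi> p y $ 2 - \<Phi> p y $ 1 * \<Phi> p x $ 2)
    (wedge E p (frame E \<Phi> 1 p) (frame E \<Phi> 2 p))"
proof (rule ext2_eqI)
  show "wedge E p x y \<in> Fib (ext2 E) p" by (rule wedge_in[OF assms])
  have w: "wedge E p (frame E \<Phi> 1 p) (frame E \<Phi> 2 p) \<in> Fib (ext2 E) p"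
    by (intro wedge_in frame_in[OF \<Phi>])
  show "Scl (ext2 E) a (wedge E p (frame E \<Phi> 1 p) (frame E \<Phi> 2 p)) \<in> Fib (ext2 E) p" for a
    using w unfolding ext2_iff Scl_ext2 by (simp add: distrib_left)
qed (simp add: wedge_coframe assms Scl_ext2 wedge_frame_coframe)

text \<open>The left-hand side is the frame that enters the trivializations of \<open>Hom(\<Lambda>\<^sup>2E, F)\<close>.\<close>

lemma ext2_frame:
  "inv_into (Fib (ext2 E) p) (\<lambda>B. \<chi> i. B (\<lambda>x. if x \<in> Fib E p then \<Phi> p x $ 1 else 0)
      (\<lambda>x. if x \<in> Fib E p then \<Phi> p x $ 2 else 0)) (axis (1::1) 1)
    = wedge E p (frame E \<Phi> 1 p) (frame E \<Phi> 2 p)"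
  unfolding coframe_def[symmetric]
proof (rule inv_into_f_eq)
  show "inj_on (\<lambda>B. \<chi> i::1. B (coframe E \<Phi> 1 p) (coframe E \<Phi> 2 p)) (Fib (ext2 E) p)"
    by (rule inj_onI) (auto simp: vec_eq_iff intro: ext2_eqI)
  show "wedge E p (frame E \<Phi> 1 p) (frame E \<Phi> 2 p) \<in> Fib (ext2 E) p"
    by (intro wedge_in frame_in[OF \<Phi>])
qed (simp add: wedge_frame_coframe vec_eq_iff axis_def)

end

end

section \<open>Differentials on a complex surface\<close>

locale csurface = cmanifold A for A :: "('m::{t2_space,second_countable_topology}, 2) chart set"
begin

sublocale TB: hbundle2_on A "tangent_bundle A"
  by unfold_locales (rule holo_bundle_T)

lemma Triv_T_eq: "Triv T = {(cdom c, \<lambda>p v. v c) | c. c \<in> A}"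
  by (simp add: tangent_bundle_def)

lemma Triv_T: "c \<in> A \<Longrightarrow> (cdom c, \<lambda>p v. v c) \<in> Triv T"
  unfolding Triv_T_eq by blast

abbreviation vframe :: "('m, 2) chart \<Rightarrow> 2 \<Rightarrow> 'm \<Rightarrow> ('m, 2) tangent" where
  "vframe c \<equiv> frame T (\<lambda>p v. v c)"

abbreviation dcoord :: "('m, 2) chart \<Rightarrow> 2 \<Rightarrow> 'm \<Rightarrow> ('m, 2) tangent \<Rightarrow> complex" where
  "dcoord c \<equiv> coframe T (\<lambda>p v. v c)"

lemma vframe_eq: "c \<in> A \<Longrightarrow> p \<in> cdom c \<Longrightarrow> vframe c k p = tvec c p (axis k 1)"
  by (simp add: frame_def inv_into_T)

lemma dif_sum2:
  "cdiff f p \<Longrightarrow> c \<in> A \<Longrightarrow> p \<in> cdom c \<Longrightarrow> v \<in> Fib T p \<Longrightarrow>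
    dif A f p v = v c $ 1 * pderiv c 1 f p + v c $ 2 * pderiv c 2 f p"
  by (simp add: dif_eq sum_2)

lemma dif_vframe: "cdiff f p \<Longrightarrow> c \<in> A \<Longrightarrow> p \<in> cdom c \<Longrightarrow> dif A f p (vframe c k p) = pderiv c k f p"
  by (simp add: vframe_eq dif_tvec)

lemma dif_in_dual: "cdiff f p \<Longrightarrow> dif A f p \<in> Fib (dual_bundle T) p"
proof -
  assume f: "cdiff f p"
  obtain c where c: "c \<in> A" "p \<in> cdom c" by (rule chart_at)
  show ?thesis
    unfolding dual_iff
  proof (intro conjI ballI allI impI)
    show "dif A f p (x + y) = dif A f p x + dif A f p y" if "x \<in> Fib T p" "y \<in> Fib T p" for x y
      by (simp add: dif_sum2[OF f c] that TB.Fib_add distrib_right)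
    show "dif A f p (Scl T a x) = a * dif A f p x" if "x \<in> Fib T p" for a x
      using TB.Fib_scale[OF that, of a] by (simp add: dif_sum2[OF f c] that distrib_left)
  qed (rule dif_outside)
qed

lemma dif_coord:
  assumes c: "c \<in> A" "p \<in> cdom c"
  shows "dif A (\<lambda>q. coord c q $ k) p = dcoord c k p"
proof (rule TB.dual_eqI[OF Triv_T[OF c(1)] c(2)])
  show "dif A (\<lambda>q. coord c q $ k) p \<in> Fib (dual_bundle T) p"
    by (intro dif_in_dual cdiff_coord c)
  show "dcoord c k p \<in> Fib (dual_bundle T) p"
    by (rule TB.coframe_dual[OF Triv_T[OF c(1)] c(2)])
  show "dif A (\<lambda>q. coord c q $ k) p (vframe c j p) = dcoord c k p (vframe c j p)" for j
    unfolding dif_vframe[OF cdiff_coord[OF c] c] pderiv_coord[OF c]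
    using TB.triv_frame[OF Triv_T[OF c(1)] c(2)] TB.frame_in[OF Triv_T[OF c(1)] c(2)]
    by (simp add: coframe_def axis_def)
qed

lemma holo_coord: "c \<in> A \<Longrightarrow> (\<lambda>q. coord c q $ k) \<in> holo A (cdom c)"
  by (simp add: holo_iff cdiff_coord)

text \<open>The witness is a linear function of the coordinates. Pointwise identities in a covector can thus be
  tested on differentials of functions.\<close>

lemma dual_T_eq_dif:
  assumes c: "c \<in> A" "p \<in> cdom c" and \<alpha>: "\<alpha> \<in> Fib (dual_bundle T) p"
  obtains f where "f \<in> holo A (cdom c)" "dif A f p = \<alpha>"
proof
  let ?f = "\<lambda>q. \<alpha> (vframe c 1 p) * coord c q $ 1 + \<alpha> (vframe c 2 p) * coord c q $ 2"
  have f: "cdiff ?f q" if "q \<in> cdom c" for q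
    using that c by (intro cdiff_add cdiff_mult cdiff_const cdiff_coord)
  then show "?f \<in> holo A (cdom c)" by (simp add: holo_iff)
  show "dif A ?f p = \<alpha>"
  proof (rule TB.dual_eqI[OF Triv_T[OF c(1)] c(2) dif_in_dual[OF f[OF c(2)]] \<alpha>])
    have "pderiv c k ?f p = \<alpha> (vframe c k p)" for k :: 2
      using exhaust_2[of k] c
      by (auto simp: pderiv_add pderiv_mult cdiff_mult cdiff_coord pderiv_coord)
    then show "dif A ?f p (vframe c k p) = \<alpha> (vframe c k p)" for k
      using dif_vframe[OF f[OF c(2)] c] by simp
  qed
qed

lemma dif_mult:
  assumes "cdiff f p" "cdiff g p"
  shows "dif A (\<lambda>q. f q * g q) p = (\<lambda>v. f p * dif A g p v) + (\<lambda>v. g p * dif A f p v)"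
proof
  fix v
  obtain c where c: "c \<in> A" "p \<in> cdom c" by (rule chart_at)
  show "dif A (\<lambda>q. f q * g q) p v = ((\<lambda>v. f p * dif A g p v) + (\<lambda>v. g p * dif A f p v)) v"
    by (cases "v \<in> Fib T p")
       (simp_all add: dif_outside dif_sum2[OF _ c] assms cdiff_mult pderiv_mult[OF c] algebra_simps)
qed

lemma dif_add:
  assumes "cdiff f p" "cdiff g p"
  shows "dif A (\<lambda>q. f q + g q) p = dif A f p + dif A g p"
proof
  fix v
  obtain c where c: "c \<in> A" "p \<in> cdom c" by (rule chart_at)
  show "dif A (\<lambda>q. f q + g q) p v = (dif A f p + dif A g p) v"
    by (cases "v \<in> Fib T p")
       (simp_all add: dif_outside dif_sum2[OF _ c] assms cdiff_add pderiv_add[OF c] algebra_simps)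
qed

lemma dif_const: "dif A (\<lambda>_. a) p = (\<lambda>_. 0)"
proof
  fix v
  obtain c where c: "c \<in> A" "p \<in> cdom c" by (rule chart_at)
  show "dif A (\<lambda>_. a) p v = 0"
    by (cases "v \<in> Fib T p") (simp_all add: dif_outside dif_sum2[OF _ c])
qed

lemma dif_cong:
  assumes "cdiff f p" "open W" "p \<in> W" "\<And>q. q \<in> W \<Longrightarrow> f q = g q"
  shows "dif A g p = dif A f p"
proof
  fix v
  obtain c where c: "c \<in> A" "p \<in> cdom c" by (rule chart_at)
  have g: "cdiff g p" by (rule cdiff_cong[OF assms])
  have "pderiv c k g p = pderiv c k f p" for k by (rule pderiv_cong[OF assms(2-4) c assms(1)])
  then show "dif A g p v = dif A f p v"
    by (cases "v \<in> Fib T p") (simp_all add: dif_outside dif_sum2[OF _ c] assms(1) g)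
qed

text \<open>The coordinate functions of a chart separate tangent vectors. This is the uniqueness behind the
  definite descriptions of \<open>hamiltonian\<close> and \<open>lie_bracket\<close>.\<close>

lemma tangent_eq_difI:
  assumes "X \<in> Fib T p" "Y \<in> Fib T p"
    and eq: "\<And>W g. open W \<Longrightarrow> p \<in> W \<Longrightarrow> g \<in> holo A W \<Longrightarrow> dif A g p X = dif A g p Y"
  shows "X = Y"
proof -
  obtain c where c: "c \<in> A" "p \<in> cdom c" by (rule chart_at)
  have "X c $ k = Y c $ k" for k
    using eq[OF open_cdom[OF c(1)] c(2) holo_coord[OF c(1), of k]] assms(1,2)
    by (simp add: dif_coord[OF c] coframe_def)
  then have "X c = Y c" by (simp add: vec_eq_iff)
  then show ?thesis by (rule tangent_eqI[OF assms(1,2) c])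
qed

section \<open>Bivector fields and Poisson brackets\<close>

text \<open>The coefficient of \<open>\<partial>\<^sub>1 \<and> \<partial>\<^sub>2\<close>.\<close>

definition bcoef :: "('m, 2) chart \<Rightarrow> ('m \<Rightarrow> 'm bivector) \<Rightarrow> 'm \<Rightarrow> complex" where
  "bcoef c B p = B p (dcoord c 1 p) (dcoord c 2 p)"

lemma Triv_ext2_T: "Triv (ext2 T) = {(cdom c, \<lambda>p B. \<chi> i. B (dcoord c 1 p) (dcoord c 2 p)) | c. c \<in> A}"
proof -
  have "Triv (ext2 T) = {(U, \<lambda>p B. \<chi> i. B (coframe T \<Phi> 1 p) (coframe T \<Phi> 2 p)) | U \<Phi>. (U, \<Phi>) \<in> Triv T}"
    unfolding ext2_def coframe_def hbundle.simps ..
  then show ?thesis unfolding Triv_T_eq by blast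
qed

lemma ext2_T_sectionsI:
  assumes "\<And>p. p \<in> U \<Longrightarrow> B p \<in> Fib (ext2 T) p"
    and "\<And>c p. c \<in> A \<Longrightarrow> p \<in> U \<Longrightarrow> p \<in> cdom c \<Longrightarrow> cdiff (bcoef c B) p"
  shows "B \<in> sections A (ext2 T) U"
proof -
  have *: "(\<lambda>p. B p (dcoord c 1 p) (dcoord c 2 p)) \<in> holo A (U \<inter> cdom c)" if "c \<in> A" for c
    using assms(2)[OF that] unfolding holo_iff bcoef_def by blast
  show ?thesis
    unfolding sections_def mem_Collect_eq
  proof (intro conjI ballI assms(1))
    fix x assume "x \<in> Triv (ext2 T)"
    then obtain c where "x = (cdom c, \<lambda>p B. \<chi> i. B (dcoord c 1 p) (dcoord c 2 p))" "c \<in> A"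
      unfolding Triv_ext2_T by blast
    then show "case x of (W, \<Phi>) \<Rightarrow> \<forall>i. (\<lambda>p. \<Phi> p (B p) $ i) \<in> holo A (U \<inter> W)"
      using * by simp
  qed
qed

lemma sections_ext2_T:
  assumes "B \<in> sections A (ext2 T) U" "p \<in> U"
  shows "B p \<in> Fib (ext2 T) p" and "c \<in> A \<Longrightarrow> p \<in> cdom c \<Longrightarrow> cdiff (bcoef c B) p"
proof -
  show "B p \<in> Fib (ext2 T) p" using assms unfolding sections_def by blast
  assume c: "c \<in> A" "p \<in> cdom c"
  have mem: "(cdom c, \<lambda>p B. \<chi> i. B (dcoord c 1 p) (dcoord c 2 p)) \<in> Triv (ext2 T)"
    using c unfolding Triv_ext2_T by blast
  have "\<forall>(W, \<Phi>)\<in>Triv (ext2 T). \<forall>i. (\<lambda>p. \<Phi> p (B p) $ i) \<in> holo A (U \<inter> W)"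
    using assms(1) unfolding sections_def by blast
  from bspec[OF this mem] have "(\<lambda>p. (\<chi> i::1. B p (dcoord c 1 p) (dcoord c 2 p)) $ 1) \<in> holo A (U \<inter> cdom c)"
    unfolding prod.case by blast
  then show "cdiff (bcoef c B) p"
    using assms(2) c unfolding bcoef_def[abs_def] holo_iff by simp
qed

lemma bivector_dif:
  assumes "B p \<in> Fib (ext2 T) p" "cdiff f p" "cdiff g p" and c: "c \<in> A" "p \<in> cdom c"
  shows "B p (dif A f p) (dif A g p)
    = (pderiv c 1 f p * pderiv c 2 g p - pderiv c 2 f p * pderiv c 1 g p) * bcoef c B p"
  using TB.ext2_expand[OF Triv_T[OF c(1)] c(2) assms(1) dif_in_dual[OF assms(2)] dif_in_dual[OF assms(3)]]
  by (simp add: bcoef_def dif_vframe assms c)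

text \<open>The Jacobi identity for \<open>\<sigma> = H \<partial>\<^sub>1 \<and> \<partial>\<^sub>2\<close> in a chart. The variables stand for the first and second partial
  derivatives; equality of mixed partial derivatives is built into the notation.\<close>

lemma jacobi_algebra:
  fixes H H1 H2 f1 f2 g1 g2 h1 h2 f11 f12 f22 g11 g12 g22 h11 h12 h22 :: complex
  shows "(f1 * ((g1 * h2 - g2 * h1) * H2 + (g1 * h22 + g12 * h2 - (g2 * h12 + g22 * h1)) * H)
        - f2 * ((g1 * h2 - g2 * h1) * H1 + (g1 * h12 + g11 * h2 - (g2 * h11 + g12 * h1)) * H)) * H
     + (g1 * ((h1 * f2 - h2 * f1) * H2 + (h1 * f22 + h12 * f2 - (h2 * f12 + h22 * f1)) * H)
        - g2 * ((h1 * f2 - h2 * f1) * H1 + (h1 * f12 + h11 * f2 - (h2 * f11 + h12 * f1)) * H)) * H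
     + (h1 * ((f1 * g2 - f2 * g1) * H2 + (f1 * g22 + f12 * g2 - (f2 * g12 + f22 * g1)) * H)
        - h2 * ((f1 * g2 - f2 * g1) * H1 + (f1 * g12 + f11 * g2 - (f2 * g11 + f12 * g1)) * H)) * H = 0"
  by algebra

context
  fixes \<sigma> :: "'m \<Rightarrow> 'm bivector"
  assumes \<sigma>: "\<sigma> \<in> sections A (ext2 T) UNIV"
begin

lemma poisson_bracket_chart:
  "cdiff f p \<Longrightarrow> cdiff g p \<Longrightarrow> c \<in> A \<Longrightarrow> p \<in> cdom c \<Longrightarrow> poisson_bracket A \<sigma> f g p
    = (pderiv c 1 f p * pderiv c 2 g p - pderiv c 2 f p * pderiv c 1 g p) * bcoef c \<sigma> p"
  unfolding poisson_bracket_def by (rule bivector_dif) (use sections_ext2_T[OF \<sigma>] in auto)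

lemma
  assumes "open U" "f \<in> holo A U" "g \<in> holo A U" "p \<in> U" and c: "c \<in> A" "p \<in> cdom c"
  shows cdiff_poisson_bracket: "cdiff (poisson_bracket A \<sigma> f g) p"
    and pderiv_poisson_bracket: "pderiv c k (poisson_bracket A \<sigma> f g) p =
      (pderiv c 1 f p * pderiv c 2 g p - pderiv c 2 f p * pderiv c 1 g p) * pderiv c k (bcoef c \<sigma>) p
      + (pderiv c 1 f p * pderiv c k (pderiv c 2 g) p + pderiv c k (pderiv c 1 f) p * pderiv c 2 g p
        - (pderiv c 2 f p * pderiv c k (pderiv c 1 g) p + pderiv c k (pderiv c 2 f) p * pderiv c 1 g p))
        * bcoef c \<sigma> p"
proof -
  let ?P = "\<lambda>q. (pderiv c 1 f q * pderiv c 2 g q - pderiv c 2 f q * pderiv c 1 g q) * bcoef c \<sigma> q"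
  have d: "cdiff (pderiv c k f) p" "cdiff (pderiv c k g) p" "cdiff (bcoef c \<sigma>) p" for k
    using cdiff_pderiv[OF assms(1) _ assms(4) c] assms(2,3) sections_ext2_T(2)[OF \<sigma> _ c] by auto
  have P: "cdiff ?P p" by (intro cdiff_mult cdiff_diff d)
  have W: "open (U \<inter> cdom c)" "p \<in> U \<inter> cdom c" using assms by auto
  have eq: "?P q = poisson_bracket A \<sigma> f g q" if "q \<in> U \<inter> cdom c" for q
    using poisson_bracket_chart[of f q g c] that assms by (simp add: holo_iff)
  show "cdiff (poisson_bracket A \<sigma> f g) p" by (rule cdiff_cong[OF P W eq])
  have "pderiv c k (poisson_bracket A \<sigma> f g) p = pderiv c k ?P p"
    by (rule pderiv_cong[OF W eq c P])
  also have "\<dots> = (pderiv c 1 f p * pderiv c 2 g p - pderiv c 2 f p * pderiv c 1 g p) * pderiv c k (bcoef c \<sigma>) p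
      + (pderiv c 1 f p * pderiv c k (pderiv c 2 g) p + pderiv c k (pderiv c 1 f) p * pderiv c 2 g p
        - (pderiv c 2 f p * pderiv c k (pderiv c 1 g) p + pderiv c k (pderiv c 2 f) p * pderiv c 1 g p))
        * bcoef c \<sigma> p"
    by (simp add: pderiv_mult[OF c] pderiv_diff[OF c] cdiff_mult cdiff_diff d)
  finally show "pderiv c k (poisson_bracket A \<sigma> f g) p = \<dots>" .
qed

lemma holo_poisson_bracket:
  assumes "open U" "f \<in> holo A U" "g \<in> holo A U"
  shows "poisson_bracket A \<sigma> f g \<in> holo A U"
  unfolding holo_iff
proof
  fix p assume p: "p \<in> U"
  obtain c where c: "c \<in> A" "p \<in> cdom c" by (rule chart_at)
  show "cdiff (poisson_bracket A \<sigma> f g) p" by (rule cdiff_poisson_bracket[OF assms p c])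
qed

lemma poisson_bracket_mult:
  assumes "cdiff f p" "cdiff g p" "cdiff h p"
  shows "poisson_bracket A \<sigma> f (\<lambda>q. g q * h q) p
    = g p * poisson_bracket A \<sigma> f h p + h p * poisson_bracket A \<sigma> f g p"
proof -
  obtain c where c: "c \<in> A" "p \<in> cdom c" by (rule chart_at)
  show ?thesis
    by (simp add: poisson_bracket_chart[OF _ _ c] assms cdiff_mult pderiv_mult[OF c] algebra_simps)
qed

lemma poisson_bracket_skew:
  assumes "cdiff f p" "cdiff g p"
  shows "poisson_bracket A \<sigma> f g p = - poisson_bracket A \<sigma> g f p"
proof -
  obtain c where c: "c \<in> A" "p \<in> cdom c" by (rule chart_at)
  show ?thesis by (simp add: poisson_bracket_chart[OF _ _ c] assms algebra_simps)
qed

lemma poisson_jacobi: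
  assumes "open U" "f \<in> holo A U" "g \<in> holo A U" "h \<in> holo A U" "p \<in> U"
  shows "poisson_bracket A \<sigma> f (poisson_bracket A \<sigma> g h) p
       + poisson_bracket A \<sigma> g (poisson_bracket A \<sigma> h f) p
       + poisson_bracket A \<sigma> h (poisson_bracket A \<sigma> f g) p = 0"
proof -
  obtain c where c: "c \<in> A" "p \<in> cdom c" by (rule chart_at)
  have d: "cdiff f p" "cdiff g p" "cdiff h p" using assms by (auto simp: holo_iff)
  have comm: "pderiv c 2 (pderiv c 1 k) p = pderiv c 1 (pderiv c 2 k) p" if "k \<in> holo A U" for k
    by (rule pderiv_commute[OF assms(1) that assms(5) c])
  show ?thesis
    using jacobi_algebra
    by (simp add: poisson_bracket_chart[OF _ _ c] d cdiff_poisson_bracket[OF assms(1) _ _ assms(5) c] assms(2-4)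
        pderiv_poisson_bracket[OF assms(1) _ _ assms(5) c] comm)
qed

lemma poisson_structure: "poisson_structure A \<sigma>"
  unfolding poisson_structure_def using \<sigma> poisson_jacobi by blast

text \<open>The Hamiltonian vector field has the coordinates \<open>\<sigma>(df, dz\<^sub>k)\<close>.\<close>

lemma hamiltonian_props:
  assumes f: "cdiff f p"
  shows "hamiltonian A \<sigma> f p \<in> Fib T p"
    and "cdiff g p \<Longrightarrow> dif A g p (hamiltonian A \<sigma> f p) = poisson_bracket A \<sigma> f g p"
proof -
  obtain c where c: "c \<in> A" "p \<in> cdom c" by (rule chart_at)
  define X where "X = tvec c p (\<chi> k. poisson_bracket A \<sigma> f (\<lambda>q. coord c q $ k) p)"
  have XT: "X \<in> Fib T p" unfolding X_def by (rule tvec_in_T[OF c])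
  have Xc: "X c $ k = poisson_bracket A \<sigma> f (\<lambda>q. coord c q $ k) p" for k
    by (simp add: X_def tvec_self[OF c])
  have X: "dif A g p X = poisson_bracket A \<sigma> f g p" if "cdiff g p" for g
    using that f
    by (simp add: dif_sum2[OF _ c XT] Xc poisson_bracket_chart[OF _ _ c] cdiff_coord[OF c] pderiv_coord[OF c]
        algebra_simps)
  have "hamiltonian A \<sigma> f p = X"
    unfolding hamiltonian_def
  proof (rule the_equality)
    show "X \<in> Fib T p \<and> (\<forall>W g. open W \<and> p \<in> W \<and> g \<in> holo A W \<longrightarrow> dif A g p X = poisson_bracket A \<sigma> f g p)"
      using XT X by (auto simp: holo_iff)
    fix Y assume Y: "Y \<in> Fib T p \<and> (\<forall>W g. open W \<and> p \<in> W \<and> g \<in> holo A W \<longrightarrow> dif A g p Y = poisson_bracket A \<sigma> f g p)"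
    show "Y = X"
    proof (rule tangent_eq_difI)
      fix W g assume "open W" "p \<in> W" "g \<in> holo A W"
      then show "dif A g p Y = dif A g p X" using Y X by (simp add: holo_iff)
    qed (use Y XT in auto)
  qed
  then show "hamiltonian A \<sigma> f p \<in> Fib T p"
    and "cdiff g p \<Longrightarrow> dif A g p (hamiltonian A \<sigma> f p) = poisson_bracket A \<sigma> f g p"
    using XT X by auto
qed

end

section \<open>Lie brackets\<close>

lemma
  assumes "open U" "X \<in> sections A T U" "g \<in> holo A U" "p \<in> U" and c: "c \<in> A" "p \<in> cdom c"
  shows cdiff_dif_vector: "cdiff (\<lambda>q. dif A g q (X q)) p"
    and pderiv_dif_vector: "pderiv c k (\<lambda>q. dif A g q (X q)) p =
      X p c $ 1 * pderiv c k (pderiv c 1 g) p + pderiv c k (\<lambda>q. X q c $ 1) p * pderiv c 1 g p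
      + (X p c $ 2 * pderiv c k (pderiv c 2 g) p + pderiv c k (\<lambda>q. X q c $ 2) p * pderiv c 2 g p)"
proof -
  let ?P = "\<lambda>q. X q c $ 1 * pderiv c 1 g q + X q c $ 2 * pderiv c 2 g q"
  have d: "cdiff (pderiv c k g) p" "cdiff (\<lambda>q. X q c $ k) p" for k
    using cdiff_pderiv[OF assms(1,3,4) c] TB.sections_cdiff[OF assms(2,4) Triv_T[OF c(1)] c(2)] by auto
  have P: "cdiff ?P p" by (intro cdiff_add cdiff_mult d)
  have W: "open (U \<inter> cdom c)" "p \<in> U \<inter> cdom c" using assms by auto
  have eq: "?P q = dif A g q (X q)" if "q \<in> U \<inter> cdom c" for q
    using dif_sum2[of g q c "X q"] that assms TB.sections_in[OF assms(2)] by (simp add: holo_iff)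
  show "cdiff (\<lambda>q. dif A g q (X q)) p" by (rule cdiff_cong[OF P W eq])
  have "pderiv c k (\<lambda>q. dif A g q (X q)) p = pderiv c k ?P p"
    by (rule pderiv_cong[OF W eq c P])
  also have "\<dots> = X p c $ 1 * pderiv c k (pderiv c 1 g) p + pderiv c k (\<lambda>q. X q c $ 1) p * pderiv c 1 g p
      + (X p c $ 2 * pderiv c k (pderiv c 2 g) p + pderiv c k (\<lambda>q. X q c $ 2) p * pderiv c 2 g p)"
    by (simp add: pderiv_mult[OF c] pderiv_add[OF c] cdiff_mult d)
  finally show "pderiv c k (\<lambda>q. dif A g q (X q)) p = \<dots>" .
qed

text \<open>In a chart the bracket has the coordinates \<open>X(Y\<^sub>k) - Y(X\<^sub>k)\<close>: the second derivatives of \<open>g\<close> cancel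
  because they are symmetric.\<close>

lemma lie_bracket_props:
  assumes "open U" "X \<in> sections A T U" "Y \<in> sections A T U" "p \<in> U"
  shows "lie_bracket A X Y p \<in> Fib T p"
    and "open W \<Longrightarrow> p \<in> W \<Longrightarrow> g \<in> holo A W \<Longrightarrow> dif A g p (lie_bracket A X Y p) =
      dif A (\<lambda>q. dif A g q (Y q)) p (X p) - dif A (\<lambda>q. dif A g q (X q)) p (Y p)"
proof -
  obtain c where c: "c \<in> A" "p \<in> cdom c" by (rule chart_at)
  define u where "u k = X p c $ 1 * pderiv c 1 (\<lambda>q. Y q c $ k) p + X p c $ 2 * pderiv c 2 (\<lambda>q. Y q c $ k) p
      - (Y p c $ 1 * pderiv c 1 (\<lambda>q. X q c $ k) p + Y p c $ 2 * pderiv c 2 (\<lambda>q. X q c $ k) p)" for k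
  define Z where "Z = tvec c p (\<chi> k. u k)"
  have ZT: "Z \<in> Fib T p" unfolding Z_def by (rule tvec_in_T[OF c])
  have Zc: "Z c $ k = u k" for k by (simp add: Z_def tvec_self[OF c])
  have XY: "X p \<in> Fib T p" "Y p \<in> Fib T p" using assms TB.sections_in by auto
  have Z: "dif A g p Z = dif A (\<lambda>q. dif A g q (Y q)) p (X p) - dif A (\<lambda>q. dif A g q (X q)) p (Y p)"
    if W: "open W" "p \<in> W" "g \<in> holo A W" for W g
  proof -
    have UW: "open (U \<inter> W)" "p \<in> U \<inter> W" using assms W by auto
    have XU: "X \<in> sections A T (U \<inter> W)" "Y \<in> sections A T (U \<inter> W)"
      using assms TB.sections_subset by blast+
    have gU: "g \<in> holo A (U \<inter> W)" using W by (auto simp: holo_iff)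
    have g: "cdiff g p" using W by (simp add: holo_iff)
    have comm: "pderiv c 2 (pderiv c 1 g) p = pderiv c 1 (pderiv c 2 g) p"
      by (rule pderiv_commute[OF W(1,3,2) c])
    have d: "cdiff (\<lambda>q. dif A g q (Y q)) p" "cdiff (\<lambda>q. dif A g q (X q)) p"
      using cdiff_dif_vector[OF UW(1) _ gU UW(2) c] XU by auto
    show ?thesis
      unfolding dif_sum2[OF g c ZT] dif_sum2[OF d(1) c XY(1)] dif_sum2[OF d(2) c XY(2)]
        pderiv_dif_vector[OF UW(1) XU(1) gU UW(2) c] pderiv_dif_vector[OF UW(1) XU(2) gU UW(2) c]
        Zc u_def comm
      by (simp add: algebra_simps)
  qed
  have "lie_bracket A X Y p = Z"
    unfolding lie_bracket_def
  proof (rule the_equality)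
    show "Z \<in> Fib T p \<and> (\<forall>W g. open W \<and> p \<in> W \<and> g \<in> holo A W \<longrightarrow>
        dif A g p Z = dif A (\<lambda>q. dif A g q (Y q)) p (X p) - dif A (\<lambda>q. dif A g q (X q)) p (Y p))"
      using ZT Z by blast
    fix Z' assume Z': "Z' \<in> Fib T p \<and> (\<forall>W g. open W \<and> p \<in> W \<and> g \<in> holo A W \<longrightarrow>
        dif A g p Z' = dif A (\<lambda>q. dif A g q (Y q)) p (X p) - dif A (\<lambda>q. dif A g q (X q)) p (Y p))"
    show "Z' = Z"
      by (rule tangent_eq_difI) (use Z' ZT Z in auto)
  qed
  then show "lie_bracket A X Y p \<in> Fib T p"
    and "open W \<Longrightarrow> p \<in> W \<Longrightarrow> g \<in> holo A W \<Longrightarrow> dif A g p (lie_bracket A X Y p) =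
      dif A (\<lambda>q. dif A g q (Y q)) p (X p) - dif A (\<lambda>q. dif A g q (X q)) p (Y p)"
    using ZT Z by auto
qed

section \<open>Further properties of Poisson brackets\<close>

lemma
  assumes B: "B \<in> Fib (ext2 T) p" and \<alpha>: "\<alpha> \<in> Fib (dual_bundle T) p" and \<beta>: "\<beta> \<in> Fib (dual_bundle T) p"
  shows bivector_add1: "\<gamma> \<in> Fib (dual_bundle T) p \<Longrightarrow> B (\<alpha> + \<beta>) \<gamma> = B \<alpha> \<gamma> + B \<beta> \<gamma>"
    and bivector_add2: "\<gamma> \<in> Fib (dual_bundle T) p \<Longrightarrow> B \<gamma> (\<alpha> + \<beta>) = B \<gamma> \<alpha> + B \<gamma> \<beta>"
    and bivector_scale1: "B (\<lambda>x. a * \<alpha> x) \<beta> = a * B \<alpha> \<beta>"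
    and bivector_scale2: "B \<alpha> (\<lambda>x. a * \<beta> x) = a * B \<alpha> \<beta>"
  using B \<alpha> \<beta> unfolding TB.ext2_iff by blast+

lemma cdiff_bivector_dif:
  assumes "open U" "f \<in> holo A U" "g \<in> holo A U" "p \<in> U"
    and B: "\<And>q. q \<in> U \<Longrightarrow> B q \<in> Fib (ext2 T) q" "\<And>c. c \<in> A \<Longrightarrow> p \<in> cdom c \<Longrightarrow> cdiff (bcoef c B) p"
  shows "cdiff (\<lambda>q. B q (dif A f q) (dif A g q)) p"
proof -
  obtain c where c: "c \<in> A" "p \<in> cdom c" by (rule chart_at)
  have "cdiff (\<lambda>q. (pderiv c 1 f q * pderiv c 2 g q - pderiv c 2 f q * pderiv c 1 g q) * bcoef c B q) p"
    by (intro cdiff_mult cdiff_diff B c cdiff_pderiv[OF assms(1) _ assms(4) c] assms(2,3))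
  then show ?thesis
  proof (rule cdiff_cong)
    show "open (U \<inter> cdom c)" "p \<in> U \<inter> cdom c" using assms(1,4) c by auto
    show "(pderiv c 1 f q * pderiv c 2 g q - pderiv c 2 f q * pderiv c 1 g q) * bcoef c B q
        = B q (dif A f q) (dif A g q)" if "q \<in> U \<inter> cdom c" for q
      using bivector_dif[of B q f g c] B(1)[of q] that c assms(2,3) by (simp add: holo_iff)
  qed
qed

text \<open>The frame of the cotangent bundle that belongs to a chart consists of the differentials of the
  coordinates.\<close>

lemma Triv_dual_T:
  assumes "(W, \<Phi>) \<in> Triv (dual_bundle T)"
  obtains c where "c \<in> A" "W = cdom c" "\<And>p k. p \<in> cdom c \<Longrightarrow> frame (dual_bundle T) \<Phi> k p = dcoord c (snd k) p"
proof -
  have "\<exists>c\<in>A. W = cdom c \<and> \<Phi> = (\<lambda>p L. \<chi> k. L (vframe c (snd k) p))"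
    using assms unfolding hom_bundle_def trivial_line_def hbundle.simps Triv_T_eq frame_def by force
  then obtain c where c: "c \<in> A" "W = cdom c" "\<Phi> = (\<lambda>p L. \<chi> k. L (vframe c (snd k) p))" by blast
  have "frame (dual_bundle T) \<Phi> k p = dcoord c (snd k) p" if p: "p \<in> cdom c" for p k
    unfolding frame_def
  proof (rule inv_into_f_eq)
    note \<Phi>T = Triv_T[OF c(1)] p
    show "inj_on (\<Phi> p) (Fib (dual_bundle T) p)"
    proof (rule inj_onI)
      fix \<alpha> \<beta> assume \<alpha>: "\<alpha> \<in> Fib (dual_bundle T) p" "\<beta> \<in> Fib (dual_bundle T) p" "\<Phi> p \<alpha> = \<Phi> p \<beta>"
      have "\<alpha> (vframe c j p) = \<beta> (vframe c j p)" for j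
        using arg_cong[OF \<alpha>(3), of "\<lambda>x. x $ (1, j)"] by (simp add: c(3))
      then show "\<alpha> = \<beta>" by (rule TB.dual_eqI[OF \<Phi>T \<alpha>(1,2)])
    qed
    show "dcoord c (snd k) p \<in> Fib (dual_bundle T) p" by (rule TB.coframe_dual[OF \<Phi>T])
    have "dcoord c i p (vframe c j p) = (if i = j then 1 else 0)" for i j
      using TB.frame_in[OF \<Phi>T] TB.triv_frame[OF \<Phi>T] by (simp add: coframe_def axis_def)
    then show "\<Phi> p (dcoord c (snd k) p) = axis k 1"
      by (simp add: c(3) vec_eq_iff axis_def prod_eq_iff num1_eq_iff)
  qed
  then show thesis using that c by blast
qed

lemma poisson_bracket_const:
  assumes \<sigma>: "\<sigma> \<in> sections A (ext2 T) UNIV" and f: "cdiff f p"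
  shows "poisson_bracket A \<sigma> f (\<lambda>_. a) p = 0"
proof -
  obtain c where c: "c \<in> A" "p \<in> cdom c" by (rule chart_at)
  show ?thesis by (simp add: poisson_bracket_chart[OF \<sigma> f cdiff_const c])
qed

lemma poisson_bracket_derivation:
  assumes \<sigma>: "\<sigma> \<in> sections A (ext2 T) UNIV" and U: "open U" and f: "f \<in> holo A U" and g: "g \<in> holo A U"
    and h: "h \<in> holo A U" and p: "p \<in> U"
  shows "poisson_bracket A \<sigma> (poisson_bracket A \<sigma> f g) h p
    = poisson_bracket A \<sigma> f (poisson_bracket A \<sigma> g h) p - poisson_bracket A \<sigma> g (poisson_bracket A \<sigma> f h) p"
proof -
  let ?b = "poisson_bracket A \<sigma>"
  have d: "cdiff k p" if "k \<in> holo A U" for k using that p by (simp add: holo_iff)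
  note hb = holo_poisson_bracket[OF \<sigma> U]
  have 1: "?b h (?b f g) p = - ?b (?b f g) h p"
    by (rule poisson_bracket_skew[OF \<sigma> d[OF h] d[OF hb[OF f g]]])
  have "dif A (?b h f) p = dif A (\<lambda>q. -1 * ?b f h q) p"
  proof (rule dif_cong[OF _ U p])
    show "cdiff (\<lambda>q. -1 * ?b f h q) p" by (intro cdiff_mult cdiff_const d hb f h)
    show "-1 * ?b f h q = ?b h f q" if "q \<in> U" for q
      using poisson_bracket_skew[OF \<sigma>, of h q f] f h that by (simp add: holo_iff)
  qed
  then have "?b g (?b h f) p = ?b g (\<lambda>q. -1 * ?b f h q) p"
    by (simp add: poisson_bracket_def[of A \<sigma> g])
  also have "\<dots> = -1 * ?b g (?b f h) p + ?b f h p * ?b g (\<lambda>_. -1) p"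
    by (rule poisson_bracket_mult[OF \<sigma> d[OF g] cdiff_const d[OF hb[OF f h]]])
  also have "\<dots> = - ?b g (?b f h) p"
    using poisson_bracket_const[OF \<sigma> d[OF g], of "-1"] by simp
  finally have 2: "?b g (?b h f) p = - ?b g (?b f h) p" .
  show ?thesis
    using poisson_jacobi[OF \<sigma> U f g h p] unfolding 1 2 by (simp add: algebra_simps)
qed

end

section \<open>The Poisson structure \<open>s1 \<and> s2\<close>\<close>

locale wedge_poisson = csurface A
  for A :: "('m::{t2_space,second_countable_topology}, 2) chart set" +
  fixes V :: "('m, 'v::ab_group_add, 2) hbundle"
    and \<theta> :: "'m \<Rightarrow> (('v \<Rightarrow> complex) \<Rightarrow> ('v \<Rightarrow> complex) \<Rightarrow> complex) \<Rightarrow> 'm bivector"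
    and s1 s2 :: "'m \<Rightarrow> 'v"
    and \<sigma> :: "'m \<Rightarrow> 'm bivector"
    and C :: "'m set"
  assumes V: "holo_bundle A V"
    and \<theta>: "bundle_iso A (ext2 V) (ext2 (tangent_bundle A)) \<theta>"
    and s1: "s1 \<in> sections A V UNIV"
    and s2: "s2 \<in> sections A V UNIV"
    and generic: "closure {p. lin_indep2 V (s1 p) (s2 p)} = UNIV"
    and \<sigma>_def: "\<sigma> = (\<lambda>p. \<theta> p (wedge V p (s1 p) (s2 p)))"
    and C_def: "C = {p. \<sigma> p = 0}"
begin

sublocale V: hbundle2_on A V
  by unfold_locales (rule V)

lemma s_in [simp]: "s1 p \<in> Fib V p" "s2 p \<in> Fib V p"
  using V.sections_in s1 s2 by auto

text \<open>The coordinate of \<open>x \<and> y\<close> with respect to \<open>e\<^sub>1 \<and> e\<^sub>2\<close>, for the frame \<open>e\<^sub>1, e\<^sub>2\<close> of the trivialization \<open>\<Phi>\<close>.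
  On \<open>s1, s2\<close> it is a local equation of \<open>C\<close>.\<close>

definition vdet :: "('m \<Rightarrow> 'v \<Rightarrow> complex^2) \<Rightarrow> 'm \<Rightarrow> 'v \<Rightarrow> 'v \<Rightarrow> complex" where
  "vdet \<Phi> p x y = \<Phi> p x $ 1 * \<Phi> p y $ 2 - \<Phi> p y $ 1 * \<Phi> p x $ 2"

definition \<omega> :: "('m \<Rightarrow> 'v \<Rightarrow> complex^2) \<Rightarrow> 'm \<Rightarrow> 'm bivector" where
  "\<omega> \<Phi> p = \<theta> p (wedge V p (frame V \<Phi> 1 p) (frame V \<Phi> 2 p))"

lemma \<theta>_in: "B \<in> Fib (ext2 V) p \<Longrightarrow> \<theta> p B \<in> Fib (ext2 T) p"
  and \<theta>_scale: "B \<in> Fib (ext2 V) p \<Longrightarrow> \<theta> p (Scl (ext2 V) a B) = Scl (ext2 T) a (\<theta> p B)"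
proof -
  have "\<theta> p \<in> Fib (hom_bundle (ext2 V) (ext2 T)) p"
    using \<theta> unfolding bundle_iso_def sections_def by blast
  then have "(\<forall>x\<in>Fib (ext2 V) p. \<theta> p x \<in> Fib (ext2 T) p) \<and>
      (\<forall>a. \<forall>x\<in>Fib (ext2 V) p. \<theta> p (Scl (ext2 V) a x) = Scl (ext2 T) a (\<theta> p x))"
    unfolding hom_bundle_def hbundle.simps mem_Collect_eq by blast
  then show "B \<in> Fib (ext2 V) p \<Longrightarrow> \<theta> p B \<in> Fib (ext2 T) p"
    and "B \<in> Fib (ext2 V) p \<Longrightarrow> \<theta> p (Scl (ext2 V) a B) = Scl (ext2 T) a (\<theta> p B)" by auto
qed

lemma \<theta>_inj: "inj_on (\<theta> p) (Fib (ext2 V) p)"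
  using \<theta> unfolding bundle_iso_def by (blast intro: bij_betw_imp_inj_on)

context
  fixes W \<Phi>
  assumes \<Phi>: "(W, \<Phi>) \<in> Triv V"
begin

lemma \<omega>_in: "p \<in> W \<Longrightarrow> \<omega> \<Phi> p \<in> Fib (ext2 T) p"
  unfolding \<omega>_def by (intro \<theta>_in V.wedge_in V.frame_in[OF \<Phi>])

lemma \<theta>_wedge:
  assumes p: "p \<in> W" and xy: "x \<in> Fib V p" "y \<in> Fib V p"
  shows "\<theta> p (wedge V p x y) = (\<lambda>\<alpha> \<beta>. vdet \<Phi> p x y * \<omega> \<Phi> p \<alpha> \<beta>)"
proof -
  have "wedge V p (frame V \<Phi> 1 p) (frame V \<Phi> 2 p) \<in> Fib (ext2 V) p"
    by (intro V.wedge_in V.frame_in[OF \<Phi>] p)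
  from \<theta>_scale[OF this] show ?thesis
    by (simp add: V.wedge_eq_scale[OF \<Phi> p xy] TB.Scl_ext2 \<omega>_def vdet_def)
qed

lemma \<sigma>_eq: "p \<in> W \<Longrightarrow> \<sigma> p \<alpha> \<beta> = vdet \<Phi> p (s1 p) (s2 p) * \<omega> \<Phi> p \<alpha> \<beta>"
  unfolding \<sigma>_def by (simp add: \<theta>_wedge)

lemma \<omega>_nonzero:
  assumes p: "p \<in> W"
  shows "\<omega> \<Phi> p \<noteq> 0"
proof
  let ?w = "wedge V p (frame V \<Phi> 1 p) (frame V \<Phi> 2 p)"
  assume 0: "\<omega> \<Phi> p = 0"
  have w: "?w \<in> Fib (ext2 V) p" by (intro V.wedge_in V.frame_in[OF \<Phi>] p)
  have z: "Scl (ext2 V) 0 ?w \<in> Fib (ext2 V) p"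
    unfolding V.Scl_ext2 V.ext2_iff by simp
  have "\<theta> p (Scl (ext2 V) 0 ?w) = \<theta> p ?w"
    unfolding \<theta>_scale[OF w] using 0 by (simp add: TB.Scl_ext2 \<omega>_def fun_eq_iff)
  then have "Scl (ext2 V) 0 ?w = ?w" using inj_onD[OF \<theta>_inj _ z w] by blast
  then have "?w (coframe V \<Phi> 1 p) (coframe V \<Phi> 2 p) = 0"
    by (metis V.Scl_ext2 mult_zero_left)
  then show False using V.wedge_frame_coframe[OF \<Phi> p] by simp
qed

lemma C_iff: "p \<in> W \<Longrightarrow> p \<in> C \<longleftrightarrow> vdet \<Phi> p (s1 p) (s2 p) = 0"
proof
  assume p: "p \<in> W" and C: "p \<in> C"
  show "vdet \<Phi> p (s1 p) (s2 p) = 0"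
  proof (rule ccontr)
    assume n: "vdet \<Phi> p (s1 p) (s2 p) \<noteq> 0"
    have "\<omega> \<Phi> p \<alpha> \<beta> = 0" for \<alpha> \<beta>
      using \<sigma>_eq[OF p, of \<alpha> \<beta>] n C by (simp add: C_def)
    then have "\<omega> \<Phi> p = 0" by (simp add: fun_eq_iff)
    then show False using \<omega>_nonzero[OF p] by simp
  qed
next
  assume "p \<in> W" "vdet \<Phi> p (s1 p) (s2 p) = 0"
  then show "p \<in> C" using \<sigma>_eq by (simp add: C_def fun_eq_iff)
qed

text \<open>The coefficient of \<open>\<omega>\<close> is the one matrix entry of \<open>\<theta>\<close>, a map between line bundles.\<close>

lemma cdiff_\<omega>:
  assumes p: "p \<in> W" and c: "c \<in> A" "p \<in> cdom c"
  shows "cdiff (bcoef c (\<omega> \<Phi>)) p"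
proof -
  define \<Phi>2 :: "'m \<Rightarrow> (('v \<Rightarrow> complex) \<Rightarrow> ('v \<Rightarrow> complex) \<Rightarrow> complex) \<Rightarrow> complex^1"
    where "\<Phi>2 = (\<lambda>p B. \<chi> i. B (\<lambda>x. if x \<in> Fib V p then \<Phi> p x $ 1 else 0)
      (\<lambda>x. if x \<in> Fib V p then \<Phi> p x $ 2 else 0))"
  define \<Psi>2 :: "'m \<Rightarrow> 'm bivector \<Rightarrow> complex^1"
    where "\<Psi>2 = (\<lambda>p B. \<chi> i. B (dcoord c 1 p) (dcoord c 2 p))"
  have 1: "(W, \<Phi>2) \<in> Triv (ext2 V)"
    unfolding ext2_def hbundle.simps \<Phi>2_def using \<Phi> by blast
  have 2: "(cdom c, \<Psi>2) \<in> Triv (ext2 T)"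
    unfolding Triv_ext2_T \<Psi>2_def using c by blast
  define \<Omega> :: "'m \<Rightarrow> ((('v \<Rightarrow> complex) \<Rightarrow> ('v \<Rightarrow> complex) \<Rightarrow> complex) \<Rightarrow> 'm bivector) \<Rightarrow> complex^(1 \<times> 1)"
    where "\<Omega> = (\<lambda>p L. \<chi> k. \<Psi>2 p (L (inv_into (Fib (ext2 V) p) (\<Phi>2 p) (axis (snd k) 1))) $ fst k)"
  have mem: "(W \<inter> cdom c, \<Omega>) \<in> Triv (hom_bundle (ext2 V) (ext2 T))"
    unfolding hom_bundle_def hbundle.simps \<Omega>_def using 1 2 by blast
  have "\<forall>(U, \<Xi>)\<in>Triv (hom_bundle (ext2 V) (ext2 T)). \<forall>i. (\<lambda>p. \<Xi> p (\<theta> p) $ i) \<in> holo A (UNIV \<inter> U)"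
    using \<theta> unfolding bundle_iso_def sections_def by blast
  from bspec[OF this mem] have "\<forall>i. (\<lambda>p. \<Omega> p (\<theta> p) $ i) \<in> holo A (UNIV \<inter> (W \<inter> cdom c))"
    unfolding prod.case .
  then have "(\<lambda>p. \<Omega> p (\<theta> p) $ (1, 1)) \<in> holo A (UNIV \<inter> (W \<inter> cdom c))" by blast
  then have "cdiff (\<lambda>p. \<Omega> p (\<theta> p) $ (1, 1)) p" using p c unfolding holo_iff by blast
  then show ?thesis
  proof (rule cdiff_cong)
    show "open (W \<inter> cdom c)" "p \<in> W \<inter> cdom c" using V.open_triv[OF \<Phi>] c p by auto
    fix q assume "q \<in> W \<inter> cdom c"
    then have "inv_into (Fib (ext2 V) q) (\<Phi>2 q) (axis (1::1) 1)
        = wedge V q (frame V \<Phi> 1 q) (frame V \<Phi> 2 q)"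
      unfolding \<Phi>2_def using V.ext2_frame[OF \<Phi>] by blast
    then show "\<Omega> q (\<theta> q) $ (1, 1) = bcoef c (\<omega> \<Phi>) q"
      by (simp add: \<Omega>_def \<Psi>2_def bcoef_def \<omega>_def)
  qed
qed

lemma cdiff_vdet:
  assumes "s \<in> sections A V U" "t \<in> sections A V U" "p \<in> U" "p \<in> W"
  shows "cdiff (\<lambda>q. vdet \<Phi> q (s q) (t q)) p"
  unfolding vdet_def
  by (intro cdiff_diff cdiff_mult V.sections_cdiff[OF assms(1,3) \<Phi> assms(4)]
      V.sections_cdiff[OF assms(2,3) \<Phi> assms(4)])

end

lemma \<sigma>_section: "\<sigma> \<in> sections A (ext2 T) UNIV"
proof (rule ext2_T_sectionsI)
  fix p
  show "\<sigma> p \<in> Fib (ext2 T) p" unfolding \<sigma>_def by (intro \<theta>_in V.wedge_in s_in)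
  fix c assume c: "c \<in> A" "p \<in> cdom c"
  obtain W \<Phi> where \<Phi>: "(W, \<Phi>) \<in> Triv V" "p \<in> W" by (rule V.triv_at)
  have "cdiff (\<lambda>q. vdet \<Phi> q (s1 q) (s2 q) * bcoef c (\<omega> \<Phi>) q) p"
    by (intro cdiff_mult cdiff_vdet[OF \<Phi>(1) s1 s2] cdiff_\<omega>[OF \<Phi>(1)] c \<Phi>(2) UNIV_I)
  then show "cdiff (bcoef c \<sigma>) p"
    by (rule cdiff_cong[OF _ V.open_triv[OF \<Phi>(1)] \<Phi>(2)]) (simp add: bcoef_def \<sigma>_eq[OF \<Phi>(1)])
qed

lemma open_compl_C: "open (- C)"
proof (subst open_subopen, intro ballI)
  fix p assume p: "p \<in> - C"
  obtain W \<Phi> where \<Phi>: "(W, \<Phi>) \<in> Triv V" "p \<in> W" by (rule V.triv_at)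
  have "isCont (\<lambda>q. vdet \<Phi> q (s1 q) (s2 q)) p"
    by (rule cdiff_isCont[OF cdiff_vdet[OF \<Phi>(1) s1 s2 UNIV_I \<Phi>(2)]])
  moreover have "vdet \<Phi> p (s1 p) (s2 p) \<in> - {0}" using p C_iff[OF \<Phi>] by simp
  ultimately obtain S where S: "open S" "p \<in> S" "\<And>q. q \<in> S \<Longrightarrow> vdet \<Phi> q (s1 q) (s2 q) \<in> - {0}"
    using open_Compl[OF closed_singleton[of "0 :: complex"]]
    unfolding continuous_at_open by metis
  have "S \<inter> W \<subseteq> - C" using S(3) C_iff[OF \<Phi>(1)] by blast
  then show "\<exists>T. open T \<and> p \<in> T \<and> T \<subseteq> - C"
    using S(1,2) \<Phi>(2) V.open_triv[OF \<Phi>(1)] by (intro exI[of _ "S \<inter> W"]) auto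
qed

text \<open>If the determinant of \<open>s1, s2\<close> vanishes at \<open>p\<close>, its cofactors are the coefficients of linear relations between the two
  vectors, so independence forces first \<open>s1 p = 0\<close> and then a contradiction.\<close>

lemma dense_compl_C: "closure (- C) = UNIV"
proof -
  have "{p. lin_indep2 V (s1 p) (s2 p)} \<subseteq> - C"
  proof
    fix p assume "p \<in> {p. lin_indep2 V (s1 p) (s2 p)}"
    then have ind: "a = 0 \<and> b = 0" if "Scl V a (s1 p) + Scl V b (s2 p) = 0" for a b
      using that unfolding lin_indep2_def by blast
    obtain W \<Phi> where \<Phi>: "(W, \<Phi>) \<in> Triv V" "p \<in> W" by (rule V.triv_at)
    have ind': "a = 0 \<and> b = 0"
      if "\<And>i. a * \<Phi> p (s1 p) $ i + b * \<Phi> p (s2 p) $ i = 0" for a b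
      by (rule ind, rule V.triv_eqI[OF \<Phi>])
         (use that in \<open>auto simp: V.triv_add[OF \<Phi>] V.triv_scale[OF \<Phi>] V.triv_0[OF \<Phi>] V.Fib_add V.Fib_scale\<close>)
    show "p \<in> - C"
    proof
      assume "p \<in> C"
      then have d: "\<Phi> p (s1 p) $ 1 * \<Phi> p (s2 p) $ 2 = \<Phi> p (s2 p) $ 1 * \<Phi> p (s1 p) $ 2"
        using C_iff[OF \<Phi>] by (simp add: vdet_def)
      have "\<Phi> p (s2 p) $ j * \<Phi> p (s1 p) $ i + - (\<Phi> p (s1 p) $ j) * \<Phi> p (s2 p) $ i = 0" for i j
        using d exhaust_2[of i] exhaust_2[of j] by (auto simp: algebra_simps)
      then have "\<Phi> p (s1 p) $ j = 0" for j using ind' by (metis neg_equal_0_iff_equal)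
      then show False using ind'[of 1 0] by simp
    qed
  qed
  then have "closure {p. lin_indep2 V (s1 p) (s2 p)} \<subseteq> closure (- C)" by (rule closure_mono)
  then show ?thesis using generic by auto
qed

lemma eq_if_eq_off_C:
  assumes "open U" "s \<in> sections A V U" "t \<in> sections A V U"
    "\<And>p. p \<in> U \<Longrightarrow> p \<notin> C \<Longrightarrow> s p = t p" "p \<in> U"
  shows "s p = t p"
  by (rule V.sections_eq_if_dense[OF assms(1-3) dense_compl_C _ assms(5)]) (use assms(4) in auto)

text \<open>The choice is unique off \<open>C\<close> only; on \<open>C\<close> the value is meaningless.\<close>

definition coefs :: "'m \<Rightarrow> 'v \<Rightarrow> complex \<times> complex" where
  "coefs p x = (SOME ab. x = Scl V (fst ab) (s1 p) + Scl V (snd ab) (s2 p))"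

abbreviation "coef1 p x \<equiv> fst (coefs p x)"
abbreviation "coef2 p x \<equiv> snd (coefs p x)"

lemma
  assumes \<Phi>: "(W, \<Phi>) \<in> Triv V" "p \<in> W"
  shows vdet_comb1: "vdet \<Phi> p (Scl V a (s1 p) + Scl V b (s2 p)) (s2 p) = a * vdet \<Phi> p (s1 p) (s2 p)"
    and vdet_comb2: "vdet \<Phi> p (s1 p) (Scl V a (s1 p) + Scl V b (s2 p)) = b * vdet \<Phi> p (s1 p) (s2 p)"
  by (simp_all add: vdet_def V.triv_add[OF \<Phi>] V.triv_scale[OF \<Phi>] V.Fib_scale algebra_simps)

lemma
  assumes p: "p \<notin> C" and x: "x \<in> Fib V p"
  shows coefs_expand: "x = Scl V (coef1 p x) (s1 p) + Scl V (coef2 p x) (s2 p)"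
    and coef1_eq: "(W, \<Phi>) \<in> Triv V \<Longrightarrow> p \<in> W \<Longrightarrow> coef1 p x = vdet \<Phi> p x (s2 p) / vdet \<Phi> p (s1 p) (s2 p)"
    and coef2_eq: "(W, \<Phi>) \<in> Triv V \<Longrightarrow> p \<in> W \<Longrightarrow> coef2 p x = vdet \<Phi> p (s1 p) x / vdet \<Phi> p (s1 p) (s2 p)"
proof -
  obtain W' \<Psi> where \<Psi>: "(W', \<Psi>) \<in> Triv V" "p \<in> W'" by (rule V.triv_at)
  let ?d = "vdet \<Psi> p (s1 p) (s2 p)"
  let ?ab = "(vdet \<Psi> p x (s2 p) / ?d, vdet \<Psi> p (s1 p) x / ?d)"
  have d: "?d \<noteq> 0" using C_iff[OF \<Psi>] p by simp
  \<comment> \<open>Cramer's rule\<close>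
  have "?d * \<Psi> p x $ i = vdet \<Psi> p x (s2 p) * \<Psi> p (s1 p) $ i + vdet \<Psi> p (s1 p) x * \<Psi> p (s2 p) $ i" for i
    using exhaust_2[of i] by (auto simp: vdet_def algebra_simps)
  then have comp: "\<Psi> p x $ i = (vdet \<Psi> p x (s2 p) * \<Psi> p (s1 p) $ i + vdet \<Psi> p (s1 p) x * \<Psi> p (s2 p) $ i) / ?d" for i
    using d by (metis nonzero_mult_div_cancel_left)
  have "x = Scl V (fst ?ab) (s1 p) + Scl V (snd ?ab) (s2 p)"
  proof (rule V.triv_eqI[OF \<Psi> x])
    show "Scl V (fst ?ab) (s1 p) + Scl V (snd ?ab) (s2 p) \<in> Fib V p"
      by (intro V.Fib_add V.Fib_scale s_in)
    fix i
    have comb: "\<Psi> p (Scl V a (s1 p) + Scl V b (s2 p)) $ i = a * \<Psi> p (s1 p) $ i + b * \<Psi> p (s2 p) $ i" for a b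
      by (simp add: V.triv_add[OF \<Psi>] V.triv_scale[OF \<Psi>] V.Fib_scale)
    show "\<Psi> p x $ i = \<Psi> p (Scl V (fst ?ab) (s1 p) + Scl V (snd ?ab) (s2 p)) $ i"
      unfolding comb fst_conv snd_conv times_divide_eq_left add_divide_distrib[symmetric] by (rule comp)
  qed
  then have "\<exists>ab. x = Scl V (fst ab) (s1 p) + Scl V (snd ab) (s2 p)" by (rule exI[of _ ?ab])
  from someI_ex[OF this] show *: "x = Scl V (coef1 p x) (s1 p) + Scl V (coef2 p x) (s2 p)"
    unfolding coefs_def .
  assume \<Phi>: "(W, \<Phi>) \<in> Triv V" "p \<in> W"
  then have d: "vdet \<Phi> p (s1 p) (s2 p) \<noteq> 0" using C_iff[OF \<Phi>] p by simp
  have "vdet \<Phi> p x (s2 p) = coef1 p x * vdet \<Phi> p (s1 p) (s2 p)"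
    using vdet_comb1[OF \<Phi>, of "coef1 p x" "coef2 p x"] * by simp
  then show "coef1 p x = vdet \<Phi> p x (s2 p) / vdet \<Phi> p (s1 p) (s2 p)" using d by simp
  have "vdet \<Phi> p (s1 p) x = coef2 p x * vdet \<Phi> p (s1 p) (s2 p)"
    using vdet_comb2[OF \<Phi>, of "coef1 p x" "coef2 p x"] * by simp
  then show "coef2 p x = vdet \<Phi> p (s1 p) x / vdet \<Phi> p (s1 p) (s2 p)" using d by simp
qed

lemma
  assumes p: "p \<notin> C"
  shows coef1_comb: "coef1 p (Scl V a (s1 p) + Scl V b (s2 p)) = a"
    and coef2_comb: "coef2 p (Scl V a (s1 p) + Scl V b (s2 p)) = b"
proof -
  obtain W \<Phi> where \<Phi>: "(W, \<Phi>) \<in> Triv V" "p \<in> W" by (rule V.triv_at)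
  have d: "vdet \<Phi> p (s1 p) (s2 p) \<noteq> 0" using C_iff[OF \<Phi>] p by simp
  have x: "Scl V a (s1 p) + Scl V b (s2 p) \<in> Fib V p" by (simp add: V.Fib_add V.Fib_scale)
  show "coef1 p (Scl V a (s1 p) + Scl V b (s2 p)) = a"
    using coef1_eq[OF p x \<Phi>] vdet_comb1[OF \<Phi>] d by simp
  show "coef2 p (Scl V a (s1 p) + Scl V b (s2 p)) = b"
    using coef2_eq[OF p x \<Phi>] vdet_comb2[OF \<Phi>] d by simp
qed

lemma scl_simps:
  "Scl V a (x + y) = Scl V a x + Scl V a y"
  "Scl V (a + b) x = Scl V a x + Scl V b x"
  "Scl V (a - b) x = Scl V a x - Scl V b x"
  "Scl V a (Scl V b x) = Scl V (a * b) x"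
  "Scl V 0 x = 0" "Scl V 1 x = x" "Scl V a 0 = 0"
  using V.module_Scl
  by (simp_all add: module.scale_right_distrib module.scale_left_distrib module.scale_left_diff_distrib
      module.scale_scale module.scale_zero_left module.scale_one module.scale_zero_right)

lemma
  assumes p: "p \<notin> C"
  shows coef1_s1: "coef1 p (s1 p) = 1" and coef1_s2: "coef1 p (s2 p) = 0"
    and coef2_s1: "coef2 p (s1 p) = 0" and coef2_s2: "coef2 p (s2 p) = 1"
  using coef1_comb[OF p, of 1 0] coef1_comb[OF p, of 0 1] coef2_comb[OF p, of 1 0] coef2_comb[OF p, of 0 1]
  by (simp_all add: scl_simps)

lemma
  assumes p: "p \<notin> C" and x: "x \<in> Fib V p" and y: "y \<in> Fib V p"
  shows coef1_add: "coef1 p (x + y) = coef1 p x + coef1 p y"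
    and coef2_add: "coef2 p (x + y) = coef2 p x + coef2 p y"
proof -
  have "x + y = Scl V (coef1 p x + coef1 p y) (s1 p) + Scl V (coef2 p x + coef2 p y) (s2 p)"
    by (subst coefs_expand[OF p x], subst coefs_expand[OF p y]) (simp add: scl_simps)
  then show "coef1 p (x + y) = coef1 p x + coef1 p y" "coef2 p (x + y) = coef2 p x + coef2 p y"
    using coef1_comb[OF p] coef2_comb[OF p] by auto
qed

lemma
  assumes p: "p \<notin> C" and x: "x \<in> Fib V p"
  shows coef1_scale: "coef1 p (Scl V a x) = a * coef1 p x"
    and coef2_scale: "coef2 p (Scl V a x) = a * coef2 p x"
proof -
  have "Scl V a x = Scl V (a * coef1 p x) (s1 p) + Scl V (a * coef2 p x) (s2 p)"
    by (subst coefs_expand[OF p x]) (simp add: scl_simps)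
  then show "coef1 p (Scl V a x) = a * coef1 p x" "coef2 p (Scl V a x) = a * coef2 p x"
    using coef1_comb[OF p] coef2_comb[OF p] by auto
qed

lemma
  assumes U: "open U" and s: "s \<in> sections A V U" and p: "p \<in> U" "p \<notin> C"
  shows cdiff_coef1: "cdiff (\<lambda>q. coef1 q (s q)) p"
    and cdiff_coef2: "cdiff (\<lambda>q. coef2 q (s q)) p"
proof -
  obtain W \<Phi> where \<Phi>: "(W, \<Phi>) \<in> Triv V" "p \<in> W" by (rule V.triv_at)
  have d: "vdet \<Phi> p (s1 p) (s2 p) \<noteq> 0" using C_iff[OF \<Phi>] p by simp
  have W: "open (U \<inter> W \<inter> - C)" "p \<in> U \<inter> W \<inter> - C"
    using U V.open_triv[OF \<Phi>(1)] open_compl_C \<Phi>(2) p by auto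
  note dd = cdiff_vdet[OF \<Phi>(1) s1 s2 UNIV_I \<Phi>(2)]
  have sU: "s1 \<in> sections A V U" "s2 \<in> sections A V U" using s1 s2 V.sections_subset by blast+
  show "cdiff (\<lambda>q. coef1 q (s q)) p"
    by (rule cdiff_cong[OF cdiff_divide[OF cdiff_vdet[OF \<Phi>(1) s sU(2) p(1) \<Phi>(2)] dd d] W])
       (use coef1_eq[OF _ _ \<Phi>(1)] V.sections_in[OF s] in auto)
  show "cdiff (\<lambda>q. coef2 q (s q)) p"
    by (rule cdiff_cong[OF cdiff_divide[OF cdiff_vdet[OF \<Phi>(1) sU(1) s p(1) \<Phi>(2)] dd d] W])
       (use coef2_eq[OF _ _ \<Phi>(1)] V.sections_in[OF s] in auto)
qed

section \<open>The flat connection off \<open>C\<close>\<close>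

definition flat_nabla :: "'m set \<Rightarrow> ('m \<Rightarrow> 'v) \<Rightarrow> 'm \<Rightarrow> ('m, 2) tangent \<Rightarrow> 'v" where
  "flat_nabla U s p X =
     (if X \<in> Fib T p
      then Scl V (dif A (\<lambda>q. coef1 q (s q)) p X) (s1 p) + Scl V (dif A (\<lambda>q. coef2 q (s q)) p X) (s2 p)
      else 0)"

lemma dif_coef_cong:
  assumes "open U" "s \<in> sections A V U" "\<And>q. q \<in> U \<Longrightarrow> t q = s q" "p \<in> U" "p \<notin> C"
  shows "dif A (\<lambda>q. coef1 q (t q)) p = dif A (\<lambda>q. coef1 q (s q)) p"
    and "dif A (\<lambda>q. coef2 q (t q)) p = dif A (\<lambda>q. coef2 q (s q)) p"
  using dif_cong[OF cdiff_coef1[OF assms(1,2,4,5)] assms(1,4), of "\<lambda>q. coef1 q (t q)"]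
    dif_cong[OF cdiff_coef2[OF assms(1,2,4,5)] assms(1,4), of "\<lambda>q. coef2 q (t q)"] assms(3)
  by simp_all

lemma
  assumes U: "open U" "p \<in> U" "p \<notin> C" and s: "s \<in> sections A V U" and t: "t \<in> sections A V U"
  shows dif_coef1_add: "dif A (\<lambda>q. coef1 q (s q + t q)) p
      = dif A (\<lambda>q. coef1 q (s q)) p + dif A (\<lambda>q. coef1 q (t q)) p"
    and dif_coef2_add: "dif A (\<lambda>q. coef2 q (s q + t q)) p
      = dif A (\<lambda>q. coef2 q (s q)) p + dif A (\<lambda>q. coef2 q (t q)) p"
proof -
  have W: "open (U \<inter> - C)" "p \<in> U \<inter> - C" using U open_compl_C by auto
  note d = cdiff_coef1[OF U(1) s U(2,3)] cdiff_coef1[OF U(1) t U(2,3)]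
    cdiff_coef2[OF U(1) s U(2,3)] cdiff_coef2[OF U(1) t U(2,3)]
  have eq: "coef1 q (s q) + coef1 q (t q) = coef1 q (s q + t q)"
    "coef2 q (s q) + coef2 q (t q) = coef2 q (s q + t q)" if "q \<in> U \<inter> - C" for q
    using that coef1_add coef2_add V.sections_in[OF s] V.sections_in[OF t] by auto
  show "dif A (\<lambda>q. coef1 q (s q + t q)) p = dif A (\<lambda>q. coef1 q (s q)) p + dif A (\<lambda>q. coef1 q (t q)) p"
    using dif_cong[OF cdiff_add[OF d(1,2)] W eq(1)] dif_add[OF d(1,2)] by simp
  show "dif A (\<lambda>q. coef2 q (s q + t q)) p = dif A (\<lambda>q. coef2 q (s q)) p + dif A (\<lambda>q. coef2 q (t q)) p"
    using dif_cong[OF cdiff_add[OF d(3,4)] W eq(2)] dif_add[OF d(3,4)] by simp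
qed

lemma
  assumes U: "open U" "p \<in> U" "p \<notin> C" and f: "f \<in> holo A U" and s: "s \<in> sections A V U"
  shows dif_coef1_scale: "dif A (\<lambda>q. coef1 q (Scl V (f q) (s q))) p
      = (\<lambda>v. f p * dif A (\<lambda>q. coef1 q (s q)) p v) + (\<lambda>v. coef1 p (s p) * dif A f p v)"
    and dif_coef2_scale: "dif A (\<lambda>q. coef2 q (Scl V (f q) (s q))) p
      = (\<lambda>v. f p * dif A (\<lambda>q. coef2 q (s q)) p v) + (\<lambda>v. coef2 p (s p) * dif A f p v)"
proof -
  have W: "open (U \<inter> - C)" "p \<in> U \<inter> - C" using U open_compl_C by auto
  have d: "cdiff f p" using f U by (simp add: holo_iff)
  note d1 = cdiff_coef1[OF U(1) s U(2,3)] and d2 = cdiff_coef2[OF U(1) s U(2,3)]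
  have eq: "f q * coef1 q (s q) = coef1 q (Scl V (f q) (s q))"
    "f q * coef2 q (s q) = coef2 q (Scl V (f q) (s q))" if "q \<in> U \<inter> - C" for q
    using that coef1_scale coef2_scale V.sections_in[OF s] by auto
  show "dif A (\<lambda>q. coef1 q (Scl V (f q) (s q))) p
      = (\<lambda>v. f p * dif A (\<lambda>q. coef1 q (s q)) p v) + (\<lambda>v. coef1 p (s p) * dif A f p v)"
    using dif_cong[OF cdiff_mult[OF d d1] W eq(1)] dif_mult[OF d d1] by simp
  show "dif A (\<lambda>q. coef2 q (Scl V (f q) (s q))) p
      = (\<lambda>v. f p * dif A (\<lambda>q. coef2 q (s q)) p v) + (\<lambda>v. coef2 p (s p) * dif A f p v)"
    using dif_cong[OF cdiff_mult[OF d d2] W eq(2)] dif_mult[OF d d2] by simp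
qed

lemma frame_comb_section:
  assumes "open U" "g \<in> holo A U" "h \<in> holo A U"
  shows "(\<lambda>q. Scl V (g q) (s1 q) + Scl V (h q) (s2 q)) \<in> sections A V U"
  using s1 s2 V.sections_subset by (intro V.sections_add V.sections_scale assms) blast+

lemma flat_nabla_vframe:
  assumes U: "open U" "U \<subseteq> - C" and s: "s \<in> sections A V U" and c: "c \<in> A"
  shows "(\<lambda>q. flat_nabla U s q (vframe c k q)) \<in> sections A V (U \<inter> cdom c)"
proof (rule V.sections_cong)
  have sU: "(\<lambda>q. coef1 q (s q)) \<in> holo A U" "(\<lambda>q. coef2 q (s q)) \<in> holo A U"
    using cdiff_coef1[OF U(1) s] cdiff_coef2[OF U(1) s] U(2) by (auto simp: holo_iff)
  show op: "open (U \<inter> cdom c)" using U c by auto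
  show "(\<lambda>q. Scl V (pderiv c k (\<lambda>q. coef1 q (s q)) q) (s1 q)
      + Scl V (pderiv c k (\<lambda>q. coef2 q (s q)) q) (s2 q)) \<in> sections A V (U \<inter> cdom c)"
    by (rule frame_comb_section[OF op])
       (use cdiff_pderiv[OF U(1) sU(1) _ c] cdiff_pderiv[OF U(1) sU(2) _ c] in \<open>auto simp: holo_iff\<close>)
  fix q assume q: "q \<in> U \<inter> cdom c"
  then have "vframe c k q \<in> Fib T q" using TB.frame_in[OF Triv_T[OF c]] by blast
  then show "Scl V (pderiv c k (\<lambda>q. coef1 q (s q)) q) (s1 q)
      + Scl V (pderiv c k (\<lambda>q. coef2 q (s q)) q) (s2 q) = flat_nabla U s q (vframe c k q)"
    using q c sU by (simp add: flat_nabla_def dif_vframe holo_iff)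
qed

lemma flat_nabla_fib:
  assumes U: "open U" "U \<subseteq> - C" and s: "s \<in> sections A V U" and p: "p \<in> U"
  shows "flat_nabla U s p \<in> Fib (hom_bundle T V) p"
proof -
  have pC: "p \<notin> C" using U p by blast
  note du = dif_in_dual[OF cdiff_coef1[OF U(1) s p pC]] dif_in_dual[OF cdiff_coef2[OF U(1) s p pC]]
  note du' = du[unfolded dual_iff]
  show ?thesis
    unfolding hom_bundle_def hbundle.simps mem_Collect_eq
  proof (intro conjI ballI allI impI)
    fix x assume x: "x \<in> Fib T p"
    then show "flat_nabla U s p x \<in> Fib V p"
      by (simp add: flat_nabla_def V.Fib_add V.Fib_scale)
    show "flat_nabla U s p (x + y) = flat_nabla U s p x + flat_nabla U s p y" if y: "y \<in> Fib T p" for y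
      using x y du' TB.Fib_add[OF x y] by (simp add: flat_nabla_def scl_simps algebra_simps)
    show "flat_nabla U s p (Scl T a x) = Scl V a (flat_nabla U s p x)" for a
      using x du' TB.Fib_scale[OF x, of a] by (simp add: flat_nabla_def scl_simps del: Scl_T)
  qed (simp add: flat_nabla_def)
qed

lemma flat_nabla_leibniz:
  assumes U: "open U" "U \<subseteq> - C" and f: "f \<in> holo A U" and s: "s \<in> sections A V U" and p: "p \<in> U"
    and X: "X \<in> Fib T p"
  shows "flat_nabla U (\<lambda>q. Scl V (f q) (s q)) p X
    = Scl V (dif A f p X) (s p) + Scl V (f p) (flat_nabla U s p X)"
proof -
  have pC: "p \<notin> C" using U p by blast
  have "Scl V (dif A f p X) (s p) = Scl V (dif A f p X) (Scl V (coef1 p (s p)) (s1 p) + Scl V (coef2 p (s p)) (s2 p))"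
    using coefs_expand[OF pC V.sections_in[OF s p]] by (rule arg_cong)
  then show ?thesis
    unfolding flat_nabla_def dif_coef1_scale[OF U(1) p pC f s] dif_coef2_scale[OF U(1) p pC f s]
    using X by (simp add: scl_simps algebra_simps)
qed

lemma flat_nabla_sheaf_map: "sheaf_map A (- C) V (hom_bundle T V) flat_nabla"
  unfolding sheaf_map_def
proof (intro conjI allI impI ballI; elim conjE)
  fix U s assume U: "open U" "U \<subseteq> - C" and s: "s \<in> sections A V U"
  show "flat_nabla U s \<in> sections A (hom_bundle T V) U"
  proof (rule V.hom_sectionsI)
    show "flat_nabla U s p \<in> Fib (hom_bundle T V) p" if "p \<in> U" for p
      by (rule flat_nabla_fib[OF U s that])
    fix W \<Phi> k assume "(W, \<Phi>) \<in> Triv T"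
    then obtain c where "c \<in> A" "W = cdom c" "\<Phi> = (\<lambda>p v. v c)" unfolding Triv_T_eq by blast
    then show "(\<lambda>q. flat_nabla U s q (frame T \<Phi> k q)) \<in> sections A V (U \<inter> W)"
      using flat_nabla_vframe[OF U s] by simp
  qed
next
  fix U U' s s' p
  assume a: "open U" "U \<subseteq> - C" "open U'" "U' \<subseteq> U" "s \<in> sections A V U" "s' \<in> sections A V U'"
    "\<forall>p\<in>U'. s' p = s p" "p \<in> U'"
  have "s \<in> sections A V U'" using a V.sections_subset by blast
  then show "flat_nabla U' s' p = flat_nabla U s p"
    using dif_coef_cong[of U' s s' p] a by (auto simp: flat_nabla_def fun_eq_iff)
next
  fix U s t p assume a: "open U" "U \<subseteq> - C" "s \<in> sections A V U" "t \<in> sections A V U" "p \<in> U"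
  then have pC: "p \<notin> C" by blast
  show "flat_nabla U (\<lambda>q. s q + t q) p = flat_nabla U s p + flat_nabla U t p"
    unfolding fun_eq_iff plus_fun_def flat_nabla_def dif_coef1_add[OF a(1,5) pC a(3,4)]
      dif_coef2_add[OF a(1,5) pC a(3,4)]
    by (simp add: scl_simps algebra_simps)
next
  fix U s a p assume U: "open U" "U \<subseteq> - C" and s: "s \<in> sections A V U" and p: "p \<in> U"
  have "flat_nabla U (\<lambda>q. Scl V a (s q)) p X = Scl V a (flat_nabla U s p X)" for X
  proof (cases "X \<in> Fib T p")
    case True
    have "(\<lambda>_. a) \<in> holo A U" by (simp add: holo_iff)
    from flat_nabla_leibniz[OF U this s p True] show ?thesis by (simp add: dif_const scl_simps)
  qed (simp add: flat_nabla_def scl_simps)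
  then show "flat_nabla U (\<lambda>q. Scl V a (s q)) p = Scl (hom_bundle T V) a (flat_nabla U s p)"
    by (simp add: fun_eq_iff hom_bundle_def)
qed

text \<open>The coefficients of \<open>\<nabla>\<^sub>Y s\<close> are \<open>Y(f\<^sub>i)\<close>, so the curvature compares \<open>X(Y f\<^sub>i) - Y(X f\<^sub>i)\<close> with \<open>[X, Y] f\<^sub>i\<close>.\<close>

lemma flat_nabla_curvature:
  assumes U: "open U" "U \<subseteq> - C" and s: "s \<in> sections A V U" and X: "X \<in> sections A T U"
    and Y: "Y \<in> sections A T U" and p: "p \<in> U"
  shows "flat_nabla U (\<lambda>q. flat_nabla U s q (Y q)) p (X p) - flat_nabla U (\<lambda>q. flat_nabla U s q (X q)) p (Y p)
    = flat_nabla U s p (lie_bracket A X Y p)"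
proof -
  define f1 where "f1 = (\<lambda>q. coef1 q (s q))"
  define f2 where "f2 = (\<lambda>q. coef2 q (s q))"
  have f: "f1 \<in> holo A U" "f2 \<in> holo A U"
    using cdiff_coef1[OF U(1) s] cdiff_coef2[OF U(1) s] U(2) by (auto simp: holo_iff f1_def f2_def)
  have d: "cdiff (\<lambda>q. dif A f q (Z q)) q" if "f \<in> holo A U" "Z \<in> sections A T U" "q \<in> U" for f Z q
    using chart_at[of q] cdiff_dif_vector[OF U(1) that(2,1,3)] by metis
  have nab: "flat_nabla U (\<lambda>q. flat_nabla U s q (Z q)) p v
      = Scl V (dif A (\<lambda>q. dif A f1 q (Z q)) p v) (s1 p) + Scl V (dif A (\<lambda>q. dif A f2 q (Z q)) p v) (s2 p)"
    if Z: "Z \<in> sections A T U" and v: "v \<in> Fib T p" for Z v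
  proof -
    have eq: "flat_nabla U s q (Z q) = Scl V (dif A f1 q (Z q)) (s1 q) + Scl V (dif A f2 q (Z q)) (s2 q)"
      if "q \<in> U" for q
      using TB.sections_in[OF Z that] by (simp add: flat_nabla_def f1_def f2_def)
    have "dif A (\<lambda>q. coef1 q (flat_nabla U s q (Z q))) p = dif A (\<lambda>q. dif A f1 q (Z q)) p"
      by (rule dif_cong[OF d[OF f(1) Z p] U(1) p]) (use eq coef1_comb U(2) in auto)
    moreover have "dif A (\<lambda>q. coef2 q (flat_nabla U s q (Z q))) p = dif A (\<lambda>q. dif A f2 q (Z q)) p"
      by (rule dif_cong[OF d[OF f(2) Z p] U(1) p]) (use eq coef2_comb U(2) in auto)
    ultimately show ?thesis using v by (simp add: flat_nabla_def)
  qed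
  have XY: "X p \<in> Fib T p" "Y p \<in> Fib T p" using TB.sections_in X Y p by auto
  note L = lie_bracket_props[OF U(1) X Y p]
  have "flat_nabla U s p (lie_bracket A X Y p) = Scl V (dif A f1 p (lie_bracket A X Y p)) (s1 p)
      + Scl V (dif A f2 p (lie_bracket A X Y p)) (s2 p)"
    using L(1) by (simp add: flat_nabla_def f1_def f2_def)
  then show ?thesis
    unfolding L(2)[OF U(1) p f(1)] L(2)[OF U(1) p f(2)] nab[OF X XY(2)] nab[OF Y XY(1)]
    by (simp add: scl_simps algebra_simps)
qed

lemma flat_connection_flat_nabla: "flat_connection A (- C) V flat_nabla"
  unfolding flat_connection_def
  using flat_nabla_sheaf_map flat_nabla_leibniz flat_nabla_curvature by blast

lemma flat_nabla_s1_s2: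
  assumes p: "p \<in> - C"
  shows "flat_nabla (- C) s1 p = 0" "flat_nabla (- C) s2 p = 0"
proof -
  have "dif A (\<lambda>q. coef1 q (s1 q)) p = (\<lambda>_. 0)" "dif A (\<lambda>q. coef2 q (s2 q)) p = (\<lambda>_. 0)"
    "dif A (\<lambda>q. coef1 q (s2 q)) p = (\<lambda>_. 0)" "dif A (\<lambda>q. coef2 q (s1 q)) p = (\<lambda>_. 0)"
    using dif_cong[OF cdiff_const open_compl_C p, of 1 "\<lambda>q. coef1 q (s1 q)"]
      dif_cong[OF cdiff_const open_compl_C p, of 1 "\<lambda>q. coef2 q (s2 q)"]
      dif_cong[OF cdiff_const open_compl_C p, of 0 "\<lambda>q. coef1 q (s2 q)"]
      dif_cong[OF cdiff_const open_compl_C p, of 0 "\<lambda>q. coef2 q (s1 q)"]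
    by (simp_all add: dif_const coef1_s1 coef1_s2 coef2_s1 coef2_s2)
  then show "flat_nabla (- C) s1 p = 0" "flat_nabla (- C) s2 p = 0"
    by (simp_all add: flat_nabla_def fun_eq_iff scl_simps)
qed

text \<open>The Leibniz rule determines a connection by its values on the frame \<open>s1, s2\<close>.\<close>

lemma flat_connection_unique:
  assumes nab: "flat_connection A (- C) V nab"
    and 0: "\<forall>p\<in>- C. nab (- C) s1 p = 0 \<and> nab (- C) s2 p = 0"
    and U: "open U" "U \<subseteq> - C" and s: "s \<in> sections A V U" and p: "p \<in> U" and X: "X \<in> Fib T p"
  shows "nab U s p X = flat_nabla U s p X"
proof -
  let ?f1 = "\<lambda>q. coef1 q (s q)" and ?f2 = "\<lambda>q. coef2 q (s q)"
  have f: "?f1 \<in> holo A U" "?f2 \<in> holo A U"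
    using cdiff_coef1[OF U(1) s] cdiff_coef2[OF U(1) s] U(2) by (auto simp: holo_iff)
  have sm: "sheaf_map A (- C) V (hom_bundle T V) nab"
    using nab unfolding flat_connection_def by (elim conjE)
  have sm_restrict: "\<forall>U U' s s'. open U \<and> U \<subseteq> - C \<and> open U' \<and> U' \<subseteq> U \<and> s \<in> sections A V U \<and>
      s' \<in> sections A V U' \<and> (\<forall>p\<in>U'. s' p = s p) \<longrightarrow> (\<forall>p\<in>U'. nab U' s' p = nab U s p)"
    using sm unfolding sheaf_map_def by (elim conjE)
  have sm_add: "\<forall>U s t. open U \<and> U \<subseteq> - C \<and> s \<in> sections A V U \<and> t \<in> sections A V U \<longrightarrow>
      (\<forall>p\<in>U. nab U (\<lambda>q. s q + t q) p = nab U s p + nab U t p)"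
    using sm unfolding sheaf_map_def by (elim conjE)
  have nab_leibniz: "\<forall>U f s. open U \<and> U \<subseteq> - C \<and> f \<in> holo A U \<and> s \<in> sections A V U \<longrightarrow>
      (\<forall>p\<in>U. \<forall>X\<in>Fib T p. nab U (\<lambda>q. Scl V (f q) (s q)) p X
        = Scl V (dif A f p X) (s p) + Scl V (f p) (nab U s p X))"
    using nab unfolding flat_connection_def by (elim conjE)
  have restr: "nab U1 t' q = nab U0 t q"
    if "open U0" "U0 \<subseteq> - C" "open U1" "U1 \<subseteq> U0" "t \<in> sections A V U0" "t' \<in> sections A V U1"
      "\<forall>q\<in>U1. t' q = t q" "q \<in> U1" for U0 U1 t t' q
    using sm_restrict[rule_format, of U0 U1 t t' q] that by simp
  have add: "nab U (\<lambda>q. t q + t' q) p = nab U t p + nab U t' p"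
    if "t \<in> sections A V U" "t' \<in> sections A V U" for t t'
    using sm_add[rule_format, of U t t' p] that U p by simp
  have leib: "nab U (\<lambda>q. Scl V (f q) (t q)) p X = Scl V (dif A f p X) (t p) + Scl V (f p) (nab U t p X)"
    if "f \<in> holo A U" "t \<in> sections A V U" for f t
    using nab_leibniz[rule_format, of U f t p X] that U p X by simp
  have sU: "s1 \<in> sections A V U" "s2 \<in> sections A V U" "s1 \<in> sections A V (- C)" "s2 \<in> sections A V (- C)"
    using s1 s2 V.sections_subset by blast+
  have z: "nab U s1 p = 0" "nab U s2 p = 0"
    using restr[OF open_compl_C subset_refl U sU(3,1) _ p] restr[OF open_compl_C subset_refl U sU(4,2) _ p] 0 U p
    by auto
  have sc: "(\<lambda>q. Scl V (?f1 q) (s1 q)) \<in> sections A V U" "(\<lambda>q. Scl V (?f2 q) (s2 q)) \<in> sections A V U"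
    by (intro V.sections_scale U f sU)+
  have eq: "\<forall>q\<in>U. Scl V (?f1 q) (s1 q) + Scl V (?f2 q) (s2 q) = s q"
    using coefs_expand[OF _ V.sections_in[OF s]] U(2) by (metis ComplD subsetD)
  have "nab U s p = nab U (\<lambda>q. Scl V (?f1 q) (s1 q) + Scl V (?f2 q) (s2 q)) p"
    using restr[OF U U(1) subset_refl s V.sections_add[OF U(1) sc] eq p] by simp
  also have "\<dots> = nab U (\<lambda>q. Scl V (?f1 q) (s1 q)) p + nab U (\<lambda>q. Scl V (?f2 q) (s2 q)) p"
    by (rule add[OF sc])
  finally have "nab U s p X = nab U (\<lambda>q. Scl V (?f1 q) (s1 q)) p X + nab U (\<lambda>q. Scl V (?f2 q) (s2 q)) p X"
    by simp
  then show ?thesis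
    unfolding leib[OF f(1) sU(1)] leib[OF f(2) sU(2)]
    using X by (simp add: z scl_simps flat_nabla_def)
qed

section \<open>Extension across \<open>C\<close>\<close>

text \<open>The \<open>i\<close>-th coordinate of \<open>\<Delta> \<omega>(\<alpha>, dN) - \<omega>(\<alpha>, da) adj(a) N\<close>. By Cramer's rule the entries of \<open>adj(a) N\<close> are the
  two determinants in which \<open>s\<close> replaces \<open>s1\<close> or \<open>s2\<close>.\<close>

definition ext_coef ::
  "('m \<Rightarrow> 'v \<Rightarrow> complex^2) \<Rightarrow> ('m \<Rightarrow> 'v) \<Rightarrow> 'm \<Rightarrow> (('m, 2) tangent \<Rightarrow> complex) \<Rightarrow> 2 \<Rightarrow> complex" where
  "ext_coef \<Phi> s p \<alpha> i =
     vdet \<Phi> p (s1 p) (s2 p) * \<omega> \<Phi> p \<alpha> (dif A (\<lambda>q. \<Phi> q (s q) $ i) p)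
     - vdet \<Phi> p (s p) (s2 p) * \<omega> \<Phi> p \<alpha> (dif A (\<lambda>q. \<Phi> q (s1 q) $ i) p)
     - vdet \<Phi> p (s1 p) (s p) * \<omega> \<Phi> p \<alpha> (dif A (\<lambda>q. \<Phi> q (s2 q) $ i) p)"

definition ext_op ::
  "('m \<Rightarrow> 'v \<Rightarrow> complex^2) \<Rightarrow> ('m \<Rightarrow> 'v) \<Rightarrow> 'm \<Rightarrow> (('m, 2) tangent \<Rightarrow> complex) \<Rightarrow> 'v" where
  "ext_op \<Phi> s p \<alpha> = Scl V (ext_coef \<Phi> s p \<alpha> 1) (frame V \<Phi> 1 p) + Scl V (ext_coef \<Phi> s p \<alpha> 2) (frame V \<Phi> 2 p)"

text \<open>By \<open>ext_op_unique\<close> the choice of the trivialization does not matter. The value off the cotangent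
  space is the default of \<open>hom_bundle\<close>.\<close>

definition poisson_op :: "('m \<Rightarrow> 'v) \<Rightarrow> 'm \<Rightarrow> (('m, 2) tangent \<Rightarrow> complex) \<Rightarrow> 'v" where
  "poisson_op s p \<alpha> = (if \<alpha> \<in> Fib (dual_bundle T) p
     then ext_op (SOME \<Phi>. \<exists>W. (W, \<Phi>) \<in> Triv V \<and> p \<in> W) s p \<alpha> else 0)"

context
  fixes W \<Phi>
  assumes \<Phi>: "(W, \<Phi>) \<in> Triv V"
begin

lemma ext_op_in: "p \<in> W \<Longrightarrow> ext_op \<Phi> s p \<alpha> \<in> Fib V p"
  unfolding ext_op_def by (intro V.Fib_add V.Fib_scale V.frame_in[OF \<Phi>])

lemma triv_ext_op:
  assumes p: "p \<in> W"
  shows "\<Phi> p (ext_op \<Phi> s p \<alpha>) $ i = ext_coef \<Phi> s p \<alpha> i"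
  using exhaust_2[of i] unfolding ext_op_def
  by (auto simp: V.triv_add[OF \<Phi> p] V.triv_scale[OF \<Phi> p] V.Fib_scale V.frame_in[OF \<Phi> p]
      V.triv_frame[OF \<Phi> p] axis_def)

lemma ext_op_section:
  assumes U: "open U" and s: "s \<in> sections A V U" and f: "f \<in> holo A U"
  shows "(\<lambda>p. ext_op \<Phi> s p (dif A f p)) \<in> sections A V (U \<inter> W)"
proof (rule V.sectionsI)
  have W: "open W" by (rule V.open_triv[OF \<Phi>])
  show "open (U \<inter> W)" using U W by auto
  fix p assume p: "p \<in> U \<inter> W"
  then have pU: "p \<in> U" and pW: "p \<in> W" by auto
  show "ext_op \<Phi> s p (dif A f p) \<in> Fib V p" using ext_op_in pW by blast
  have sU: "s1 \<in> sections A V U" "s2 \<in> sections A V U" using s1 s2 V.sections_subset by blast+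
  have om: "cdiff (\<lambda>q. \<omega> \<Phi> q (dif A f q) (dif A (\<lambda>r. \<Phi> r (t r) $ i) q)) p"
    if t: "t \<in> sections A V U" for t i
  proof (rule cdiff_bivector_dif)
    show "open (U \<inter> W)" "p \<in> U \<inter> W" using U W p by auto
    show "f \<in> holo A (U \<inter> W)" using f by (auto simp: holo_iff)
    show "(\<lambda>r. \<Phi> r (t r) $ i) \<in> holo A (U \<inter> W)"
      using V.sections_cdiff[OF t _ \<Phi>] by (auto simp: holo_iff)
    show "\<omega> \<Phi> q \<in> Fib (ext2 T) q" if "q \<in> U \<inter> W" for q
      using that \<omega>_in[OF \<Phi>] by blast
  qed (rule cdiff_\<omega>[OF \<Phi> pW])
  have "cdiff (\<lambda>q. ext_coef \<Phi> s q (dif A f q) i) p" for i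
    unfolding ext_coef_def
    by (intro cdiff_diff cdiff_mult om s sU cdiff_vdet[OF \<Phi> _ _ pU pW])
  then have "cdiff (\<lambda>q. \<Phi> q (ext_op \<Phi> s q (dif A f q)) $ i) p" for i
    by (rule cdiff_cong[OF _ W pW]) (rule triv_ext_op[symmetric])
  then show "\<exists>W \<Phi>'. (W, \<Phi>') \<in> Triv V \<and> p \<in> W \<and> (\<forall>i. cdiff (\<lambda>q. \<Phi>' q (ext_op \<Phi> s q (dif A f q)) $ i) p)"
    using \<Phi> pW by (intro exI conjI allI) auto
qed

text \<open>Off \<open>C\<close> one has \<open>N = f\<^sub>1 S\<^sub>1 + f\<^sub>2 S\<^sub>2\<close> with \<open>S\<^sub>1, S\<^sub>2\<close> the columns of \<open>a\<close>; the terms \<open>f\<^sub>j \<Delta> \<omega>(\<alpha>, dS\<^sub>j)\<close> of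
  \<open>\<Delta> \<omega>(\<alpha>, dN)\<close> cancel against the two corrections, and \<open>\<Delta> \<omega>(\<alpha>, df\<^sub>j) S\<^sub>j\<close> remains.\<close>

lemma ext_op_off_C:
  assumes U: "open U" and s: "s \<in> sections A V U" and p: "p \<in> U" "p \<in> W" "p \<notin> C"
    and \<alpha>: "\<alpha> \<in> Fib (dual_bundle T) p"
  shows "ext_op \<Phi> s p \<alpha> = Scl V (\<sigma> p \<alpha> (dif A (\<lambda>q. coef1 q (s q)) p)) (s1 p)
    + Scl V (\<sigma> p \<alpha> (dif A (\<lambda>q. coef2 q (s q)) p)) (s2 p)"
proof (rule V.triv_eqI[OF \<Phi> p(2)])
  show "ext_op \<Phi> s p \<alpha> \<in> Fib V p" by (rule ext_op_in[OF p(2)])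
  show "Scl V (\<sigma> p \<alpha> (dif A (\<lambda>q. coef1 q (s q)) p)) (s1 p)
    + Scl V (\<sigma> p \<alpha> (dif A (\<lambda>q. coef2 q (s q)) p)) (s2 p) \<in> Fib V p"
    by (intro V.Fib_add V.Fib_scale s_in)
  fix i
  let ?f1 = "\<lambda>q. coef1 q (s q)" and ?f2 = "\<lambda>q. coef2 q (s q)"
  let ?S1 = "\<lambda>q. \<Phi> q (s1 q) $ i" and ?S2 = "\<lambda>q. \<Phi> q (s2 q) $ i"
  have f: "cdiff ?f1 p" "cdiff ?f2 p" using cdiff_coef1[OF U s p(1,3)] cdiff_coef2[OF U s p(1,3)] by auto
  have S: "cdiff ?S1 p" "cdiff ?S2 p"
    using V.sections_cdiff[OF s1 UNIV_I \<Phi> p(2)] V.sections_cdiff[OF s2 UNIV_I \<Phi> p(2)] by auto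
  have eq: "?f1 q * ?S1 q + ?f2 q * ?S2 q = \<Phi> q (s q) $ i" if q: "q \<in> U \<inter> W \<inter> - C" for q
  proof -
    have qW: "q \<in> W" and "q \<notin> C" "q \<in> U" using q by auto
    have "\<Phi> q (s q) = \<Phi> q (Scl V (?f1 q) (s1 q) + Scl V (?f2 q) (s2 q))"
      by (rule arg_cong[OF coefs_expand]) (use \<open>q \<notin> C\<close> \<open>q \<in> U\<close> V.sections_in[OF s] in auto)
    also have "\<dots> = ?f1 q *s \<Phi> q (s1 q) + ?f2 q *s \<Phi> q (s2 q)"
      by (simp add: V.triv_add[OF \<Phi> qW] V.triv_scale[OF \<Phi> qW] V.Fib_scale)
    finally show ?thesis by simp
  qed
  have W': "open (U \<inter> W \<inter> - C)" "p \<in> U \<inter> W \<inter> - C"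
    using U V.open_triv[OF \<Phi>] open_compl_C p by auto
  have N: "dif A (\<lambda>q. \<Phi> q (s q) $ i) p =
      ((\<lambda>v. ?f1 p * dif A ?S1 p v) + (\<lambda>v. ?S1 p * dif A ?f1 p v))
      + ((\<lambda>v. ?f2 p * dif A ?S2 p v) + (\<lambda>v. ?S2 p * dif A ?f2 p v))"
    using dif_cong[OF cdiff_add[OF cdiff_mult[OF f(1) S(1)] cdiff_mult[OF f(2) S(2)]] W' eq]
    by (simp only: dif_add[OF cdiff_mult[OF f(1) S(1)] cdiff_mult[OF f(2) S(2)]]
        dif_mult[OF f(1) S(1)] dif_mult[OF f(2) S(2)])
  note om = \<omega>_in[OF \<Phi> p(2)]
  note duals = dif_in_dual[OF f(1)] dif_in_dual[OF f(2)] dif_in_dual[OF S(1)] dif_in_dual[OF S(2)]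
  have oN: "\<omega> \<Phi> p \<alpha> (dif A (\<lambda>q. \<Phi> q (s q) $ i) p) =
      ?f1 p * \<omega> \<Phi> p \<alpha> (dif A ?S1 p) + ?S1 p * \<omega> \<Phi> p \<alpha> (dif A ?f1 p)
      + (?f2 p * \<omega> \<Phi> p \<alpha> (dif A ?S2 p) + ?S2 p * \<omega> \<Phi> p \<alpha> (dif A ?f2 p))"
    unfolding N
    by (simp only: bivector_add2[OF om] bivector_scale2[OF om] TB.dual_add TB.dual_scale duals \<alpha>)
  have x: "s p = Scl V (?f1 p) (s1 p) + Scl V (?f2 p) (s2 p)"
    by (rule coefs_expand[OF p(3) V.sections_in[OF s p(1)]])
  have d: "vdet \<Phi> p (s p) (s2 p) = ?f1 p * vdet \<Phi> p (s1 p) (s2 p)"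
    "vdet \<Phi> p (s1 p) (s p) = ?f2 p * vdet \<Phi> p (s1 p) (s2 p)"
    using vdet_comb1[OF \<Phi> p(2), of "?f1 p" "?f2 p", folded x]
      vdet_comb2[OF \<Phi> p(2), of "?f1 p" "?f2 p", folded x] .
  show "\<Phi> p (ext_op \<Phi> s p \<alpha>) $ i = \<Phi> p (Scl V (\<sigma> p \<alpha> (dif A ?f1 p)) (s1 p)
      + Scl V (\<sigma> p \<alpha> (dif A ?f2 p)) (s2 p)) $ i"
    unfolding triv_ext_op[OF p(2)] ext_coef_def oN d \<sigma>_eq[OF \<Phi> p(2)]
    by (simp add: V.triv_add[OF \<Phi> p(2)] V.triv_scale[OF \<Phi> p(2)] V.Fib_scale algebra_simps)
qed

end

text \<open>Both sides are holomorphic and agree off \<open>C\<close>.\<close>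

lemma ext_op_unique:
  assumes \<Phi>: "(W, \<Phi>) \<in> Triv V" "p \<in> W" and \<Psi>: "(W', \<Psi>) \<in> Triv V" "p \<in> W'"
    and U: "open U" and s: "s \<in> sections A V U" and p: "p \<in> U" and \<alpha>: "\<alpha> \<in> Fib (dual_bundle T) p"
  shows "ext_op \<Phi> s p \<alpha> = ext_op \<Psi> s p \<alpha>"
proof -
  obtain c where c: "c \<in> A" "p \<in> cdom c" by (rule chart_at)
  obtain f where f: "f \<in> holo A (cdom c)" "dif A f p = \<alpha>" by (rule dual_T_eq_dif[OF c \<alpha>])
  let ?U = "U \<inter> cdom c"
  have U': "open ?U" using U c by auto
  have s': "s \<in> sections A V ?U" using s V.sections_subset by blast
  have f': "f \<in> holo A ?U" using f(1) by (simp add: holo_iff)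
  have sec: "(\<lambda>p. ext_op \<Phi> s p (dif A f p)) \<in> sections A V (?U \<inter> W \<inter> W')"
    "(\<lambda>p. ext_op \<Psi> s p (dif A f p)) \<in> sections A V (?U \<inter> W \<inter> W')"
    by (rule V.sections_subset[OF ext_op_section[OF \<Phi>(1) U' s' f']], blast)
       (rule V.sections_subset[OF ext_op_section[OF \<Psi>(1) U' s' f']], blast)
  have "ext_op \<Phi> s p (dif A f p) = ext_op \<Psi> s p (dif A f p)"
  proof (rule eq_if_eq_off_C[OF _ sec])
    show "open (?U \<inter> W \<inter> W')" using U' V.open_triv[OF \<Phi>(1)] V.open_triv[OF \<Psi>(1)] by auto
    show "p \<in> ?U \<inter> W \<inter> W'" using p c \<Phi> \<Psi> by auto
    fix q assume q: "q \<in> ?U \<inter> W \<inter> W'" "q \<notin> C"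
    have "dif A f q \<in> Fib (dual_bundle T) q" using f q by (intro dif_in_dual) (simp add: holo_iff)
    then show "ext_op \<Phi> s q (dif A f q) = ext_op \<Psi> s q (dif A f q)"
      using ext_op_off_C[OF \<Phi>(1) U s] ext_op_off_C[OF \<Psi>(1) U s] q by simp
  qed
  then show ?thesis using f by simp
qed

lemma poisson_op_eq:
  assumes \<Phi>: "(W, \<Phi>) \<in> Triv V" "p \<in> W"
    and U: "open U" and s: "s \<in> sections A V U" and p: "p \<in> U" and \<alpha>: "\<alpha> \<in> Fib (dual_bundle T) p"
  shows "poisson_op s p \<alpha> = ext_op \<Phi> s p \<alpha>"
proof -
  define \<Psi> where "\<Psi> = (SOME \<Phi>. \<exists>W. (W, \<Phi>) \<in> Triv V \<and> p \<in> W)"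
  have "\<exists>\<Phi> W. (W, \<Phi>) \<in> Triv V \<and> p \<in> W" using \<Phi> by blast
  from someI_ex[OF this] obtain W' where \<Psi>: "(W', \<Psi>) \<in> Triv V" "p \<in> W'"
    unfolding \<Psi>_def by blast
  show ?thesis
    using ext_op_unique[OF \<Psi> \<Phi> U s p \<alpha>] \<alpha> by (simp add: poisson_op_def \<Psi>_def)
qed

lemma poisson_op_section:
  assumes U: "open U" and s: "s \<in> sections A V U" and f: "f \<in> holo A U"
  shows "(\<lambda>p. poisson_op s p (dif A f p)) \<in> sections A V U"
proof (rule V.sections_local[OF U])
  fix p assume p: "p \<in> U"
  obtain W \<Phi> where \<Phi>: "(W, \<Phi>) \<in> Triv V" "p \<in> W" by (rule V.triv_at)
  have op: "open (U \<inter> W)" using U V.open_triv[OF \<Phi>(1)] by auto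
  have "(\<lambda>p. poisson_op s p (dif A f p)) \<in> sections A V (U \<inter> W)"
  proof (rule V.sections_cong[OF op ext_op_section[OF \<Phi>(1) U s f]])
    fix q assume q: "q \<in> U \<inter> W"
    have "dif A f q \<in> Fib (dual_bundle T) q" using f q by (intro dif_in_dual) (simp add: holo_iff)
    then show "ext_op \<Phi> s q (dif A f q) = poisson_op s q (dif A f q)"
      using poisson_op_eq[OF \<Phi>(1) _ U s] q by simp
  qed
  then show "\<exists>W. open W \<and> p \<in> W \<and> (\<lambda>p. poisson_op s p (dif A f p)) \<in> sections A V W"
    using op p \<Phi> by (intro exI[of _ "U \<inter> W"]) auto
qed

lemma poisson_op_off_C:
  assumes U: "open U" and s: "s \<in> sections A V U" and p: "p \<in> U" "p \<notin> C"
    and \<alpha>: "\<alpha> \<in> Fib (dual_bundle T) p"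
  shows "poisson_op s p \<alpha> = Scl V (\<sigma> p \<alpha> (dif A (\<lambda>q. coef1 q (s q)) p)) (s1 p)
    + Scl V (\<sigma> p \<alpha> (dif A (\<lambda>q. coef2 q (s q)) p)) (s2 p)"
proof -
  obtain W \<Phi> where \<Phi>: "(W, \<Phi>) \<in> Triv V" "p \<in> W" by (rule V.triv_at)
  show ?thesis
    using poisson_op_eq[OF \<Phi> U s p(1) \<alpha>] ext_op_off_C[OF \<Phi>(1) U s p(1) \<Phi>(2) p(2) \<alpha>] by simp
qed

lemma poisson_op_in: "poisson_op s p \<alpha> \<in> Fib V p"
proof -
  obtain W \<Phi> where \<Phi>: "(W, \<Phi>) \<in> Triv V" "p \<in> W" by (rule V.triv_at)
  define \<Psi> where "\<Psi> = (SOME \<Phi>. \<exists>W. (W, \<Phi>) \<in> Triv V \<and> p \<in> W)"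
  have "\<exists>\<Phi> W. (W, \<Phi>) \<in> Triv V \<and> p \<in> W" using \<Phi> by blast
  from someI_ex[OF this] obtain W' where \<Psi>: "(W', \<Psi>) \<in> Triv V" "p \<in> W'"
    unfolding \<Psi>_def by blast
  show ?thesis using ext_op_in[OF \<Psi>] by (simp add: poisson_op_def \<Psi>_def[symmetric])
qed

lemma poisson_op_linear:
  assumes \<alpha>: "\<alpha> \<in> Fib (dual_bundle T) p"
    and U: "open U" and s: "s \<in> sections A V U" and p: "p \<in> U"
  shows "\<beta> \<in> Fib (dual_bundle T) p \<Longrightarrow> poisson_op s p (\<alpha> + \<beta>) = poisson_op s p \<alpha> + poisson_op s p \<beta>"
    and "poisson_op s p (\<lambda>x. a * \<alpha> x) = Scl V a (poisson_op s p \<alpha>)"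
proof -
  obtain W \<Phi> where \<Phi>: "(W, \<Phi>) \<in> Triv V" "p \<in> W" by (rule V.triv_at)
  note om = \<omega>_in[OF \<Phi>]
  have duals: "dif A (\<lambda>q. \<Phi> q (t q) $ i) p \<in> Fib (dual_bundle T) p" if "t \<in> sections A V U" for t i
    by (rule dif_in_dual[OF V.sections_cdiff[OF that p \<Phi>]])
  have sU: "s1 \<in> sections A V U" "s2 \<in> sections A V U" using s1 s2 V.sections_subset by blast+
  {
    assume \<beta>: "\<beta> \<in> Fib (dual_bundle T) p"
    have "ext_coef \<Phi> s p (\<alpha> + \<beta>) i = ext_coef \<Phi> s p \<alpha> i + ext_coef \<Phi> s p \<beta> i" for i
      unfolding ext_coef_def bivector_add1[OF om \<alpha> \<beta> duals[OF s]] bivector_add1[OF om \<alpha> \<beta> duals[OF sU(1)]]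
        bivector_add1[OF om \<alpha> \<beta> duals[OF sU(2)]]
      by (simp add: algebra_simps)
    then show "poisson_op s p (\<alpha> + \<beta>) = poisson_op s p \<alpha> + poisson_op s p \<beta>"
      unfolding poisson_op_eq[OF \<Phi> U s p TB.dual_add[OF \<alpha> \<beta>]] poisson_op_eq[OF \<Phi> U s p \<alpha>]
        poisson_op_eq[OF \<Phi> U s p \<beta>]
      by (simp add: ext_op_def scl_simps algebra_simps)
  }
  have "ext_coef \<Phi> s p (\<lambda>x. a * \<alpha> x) i = a * ext_coef \<Phi> s p \<alpha> i" for i
    unfolding ext_coef_def bivector_scale1[OF om \<alpha> duals[OF s]] bivector_scale1[OF om \<alpha> duals[OF sU(1)]]
      bivector_scale1[OF om \<alpha> duals[OF sU(2)]]
    by (simp add: algebra_simps)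
  then show "poisson_op s p (\<lambda>x. a * \<alpha> x) = Scl V a (poisson_op s p \<alpha>)"
    unfolding poisson_op_eq[OF \<Phi> U s p TB.dual_scale[OF \<alpha>]] poisson_op_eq[OF \<Phi> U s p \<alpha>]
    by (simp add: ext_op_def scl_simps)
qed

lemma poisson_op_cong:
  assumes U: "open U" and s: "s \<in> sections A V U" and t: "\<And>q. q \<in> U \<Longrightarrow> t q = s q" and p: "p \<in> U"
  shows "poisson_op t p \<alpha> = poisson_op s p \<alpha>"
proof (cases "\<alpha> \<in> Fib (dual_bundle T) p")
  case True
  obtain W \<Phi> where \<Phi>: "(W, \<Phi>) \<in> Triv V" "p \<in> W" by (rule V.triv_at)
  have t': "t \<in> sections A V U" by (rule V.sections_cong[OF U s]) (simp add: t)
  have "dif A (\<lambda>q. \<Phi> q (t q) $ i) p = dif A (\<lambda>q. \<Phi> q (s q) $ i) p" for i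
    by (rule dif_cong[OF V.sections_cdiff[OF s p \<Phi>] U p]) (simp add: t)
  then show ?thesis
    unfolding poisson_op_eq[OF \<Phi> U s p True] poisson_op_eq[OF \<Phi> U t' p True]
    by (simp add: ext_op_def ext_coef_def t p)
qed (simp add: poisson_op_def)

section \<open>The Poisson module structure\<close>

lemma poisson_op_dif_off_C:
  assumes U: "open U" and s: "s \<in> sections A V U" and f: "f \<in> holo A U" and p: "p \<in> U" "p \<notin> C"
  shows "poisson_op s p (dif A f p) = Scl V (poisson_bracket A \<sigma> f (\<lambda>q. coef1 q (s q)) p) (s1 p)
    + Scl V (poisson_bracket A \<sigma> f (\<lambda>q. coef2 q (s q)) p) (s2 p)"
proof -
  have "dif A f p \<in> Fib (dual_bundle T) p" using f p by (intro dif_in_dual) (simp add: holo_iff)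
  from poisson_op_off_C[OF U s p this] show ?thesis unfolding poisson_bracket_def .
qed

lemma poisson_op_leibniz:
  assumes U: "open U" and s: "s \<in> sections A V U" and f: "f \<in> holo A U" and g: "g \<in> holo A U" and p: "p \<in> U"
  shows "poisson_op (\<lambda>q. Scl V (g q) (s q)) p (dif A f p)
    = Scl V (poisson_bracket A \<sigma> f g p) (s p) + Scl V (g p) (poisson_op s p (dif A f p))"
proof (rule eq_if_eq_off_C[OF U _ _ _ p])
  have gs: "(\<lambda>q. Scl V (g q) (s q)) \<in> sections A V U" by (rule V.sections_scale[OF U g s])
  show "(\<lambda>p. poisson_op (\<lambda>q. Scl V (g q) (s q)) p (dif A f p)) \<in> sections A V U"
    by (rule poisson_op_section[OF U gs f])
  show "(\<lambda>p. Scl V (poisson_bracket A \<sigma> f g p) (s p) + Scl V (g p) (poisson_op s p (dif A f p))) \<in> sections A V U"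
    by (rule V.sections_add[OF U V.sections_scale[OF U holo_poisson_bracket[OF \<sigma>_section U f g] s]
          V.sections_scale[OF U g poisson_op_section[OF U s f]]])
  fix p assume p: "p \<in> U" "p \<notin> C"
  let ?c1 = "\<lambda>q. coef1 q (s q)" and ?c2 = "\<lambda>q. coef2 q (s q)"
  have d: "cdiff f p" "cdiff g p" using f g p by (auto simp: holo_iff)
  have c: "cdiff ?c1 p" "cdiff ?c2 p" using cdiff_coef1[OF U s p] cdiff_coef2[OF U s p] by auto
  note \<sigma>p = sections_ext2_T(1)[OF \<sigma>_section UNIV_I, of p]
  note lin = bivector_add2[OF \<sigma>p TB.dual_scale TB.dual_scale] bivector_scale2[OF \<sigma>p]
  have "poisson_bracket A \<sigma> f (\<lambda>q. coef1 q (Scl V (g q) (s q))) p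
      = g p * poisson_bracket A \<sigma> f ?c1 p + ?c1 p * poisson_bracket A \<sigma> f g p"
    "poisson_bracket A \<sigma> f (\<lambda>q. coef2 q (Scl V (g q) (s q))) p
      = g p * poisson_bracket A \<sigma> f ?c2 p + ?c2 p * poisson_bracket A \<sigma> f g p"
    unfolding poisson_bracket_def dif_coef1_scale[OF U p g s] dif_coef2_scale[OF U p g s]
    by (simp_all only: lin dif_in_dual d c)
  moreover have "Scl V b (s p) = Scl V (b * ?c1 p) (s1 p) + Scl V (b * ?c2 p) (s2 p)" for b
  proof -
    have "Scl V b (s p) = Scl V b (Scl V (?c1 p) (s1 p) + Scl V (?c2 p) (s2 p))"
      by (rule arg_cong[OF coefs_expand[OF p(2) V.sections_in[OF s p(1)]]])
    then show ?thesis by (simp add: scl_simps)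
  qed
  ultimately show "poisson_op (\<lambda>q. Scl V (g q) (s q)) p (dif A f p)
    = Scl V (poisson_bracket A \<sigma> f g p) (s p) + Scl V (g p) (poisson_op s p (dif A f p))"
    unfolding poisson_op_dif_off_C[OF U s f p] poisson_op_dif_off_C[OF U gs f p]
    by (simp add: scl_simps mult.commute add_ac)
qed

lemma poisson_op_scale:
  assumes U: "open U" and s: "s \<in> sections A V U" and f: "f \<in> holo A U" and p: "p \<in> U"
  shows "poisson_op (\<lambda>q. Scl V a (s q)) p (dif A f p) = Scl V a (poisson_op s p (dif A f p))"
proof -
  have "(\<lambda>_. a) \<in> holo A U" by (simp add: holo_iff)
  moreover have "cdiff f p" using f p by (simp add: holo_iff)
  ultimately show ?thesis
    using poisson_op_leibniz[OF U s f _ p, of "\<lambda>_. a"] poisson_bracket_const[OF \<sigma>_section]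
    by (simp add: scl_simps)
qed

lemma poisson_op_add:
  assumes U: "open U" and s: "s \<in> sections A V U" and t: "t \<in> sections A V U" and f: "f \<in> holo A U" and p: "p \<in> U"
  shows "poisson_op (\<lambda>q. s q + t q) p (dif A f p) = poisson_op s p (dif A f p) + poisson_op t p (dif A f p)"
proof (rule eq_if_eq_off_C[OF U _ _ _ p])
  have st: "(\<lambda>q. s q + t q) \<in> sections A V U" by (rule V.sections_add[OF U s t])
  show "(\<lambda>p. poisson_op (\<lambda>q. s q + t q) p (dif A f p)) \<in> sections A V U"
    by (rule poisson_op_section[OF U st f])
  show "(\<lambda>p. poisson_op s p (dif A f p) + poisson_op t p (dif A f p)) \<in> sections A V U"
    by (rule V.sections_add[OF U poisson_op_section[OF U s f] poisson_op_section[OF U t f]])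
  fix p assume p: "p \<in> U" "p \<notin> C"
  have d: "cdiff f p" using f p by (auto simp: holo_iff)
  note c = cdiff_coef1[OF U s p] cdiff_coef2[OF U s p] cdiff_coef1[OF U t p] cdiff_coef2[OF U t p]
  note \<sigma>p = sections_ext2_T(1)[OF \<sigma>_section UNIV_I, of p]
  have "poisson_bracket A \<sigma> f (\<lambda>q. coef1 q (s q + t q)) p
      = poisson_bracket A \<sigma> f (\<lambda>q. coef1 q (s q)) p + poisson_bracket A \<sigma> f (\<lambda>q. coef1 q (t q)) p"
    "poisson_bracket A \<sigma> f (\<lambda>q. coef2 q (s q + t q)) p
      = poisson_bracket A \<sigma> f (\<lambda>q. coef2 q (s q)) p + poisson_bracket A \<sigma> f (\<lambda>q. coef2 q (t q)) p"
    unfolding poisson_bracket_def dif_coef1_add[OF U p s t] dif_coef2_add[OF U p s t]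
    by (simp_all only: bivector_add2[OF \<sigma>p] dif_in_dual d c)
  then show "poisson_op (\<lambda>q. s q + t q) p (dif A f p) = poisson_op s p (dif A f p) + poisson_op t p (dif A f p)"
    unfolding poisson_op_dif_off_C[OF U s f p] poisson_op_dif_off_C[OF U t f p] poisson_op_dif_off_C[OF U st f p]
    by (simp add: scl_simps add_ac)
qed

text \<open>Off \<open>C\<close> the coefficients of \<open>{g, s}\<close> are \<open>{g, f\<^sub>i}\<close>, so the identity is \<open>poisson_bracket_derivation\<close> for each
  coefficient.\<close>

lemma poisson_op_bracket:
  assumes U: "open U" and s: "s \<in> sections A V U" and f: "f \<in> holo A U" and g: "g \<in> holo A U" and p: "p \<in> U"
  shows "poisson_op s p (dif A (poisson_bracket A \<sigma> f g) p)
    = poisson_op (\<lambda>q. poisson_op s q (dif A g q)) p (dif A f p)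
    - poisson_op (\<lambda>q. poisson_op s q (dif A f q)) p (dif A g p)"
proof -
  let ?b = "poisson_bracket A \<sigma>"
  let ?X = "\<lambda>f s q. poisson_op s q (dif A f q)"
  have fg: "?b f g \<in> holo A U" by (rule holo_poisson_bracket[OF \<sigma>_section U f g])
  have sec: "?X h t \<in> sections A V U" if "h \<in> holo A U" "t \<in> sections A V U" for h t
    by (rule poisson_op_section[OF U that(2,1)])
  have "?X f (?X g s) p = ?X (?b f g) s p + ?X g (?X f s) p"
  proof (rule eq_if_eq_off_C[OF U _ _ _ p])
    show "?X f (?X g s) \<in> sections A V U" by (intro sec f g s)
    show "(\<lambda>p. ?X (?b f g) s p + ?X g (?X f s) p) \<in> sections A V U"
      by (intro V.sections_add[OF U] sec f g s fg)
    fix p assume p: "p \<in> U" "p \<notin> C"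
    let ?c1 = "\<lambda>q. coef1 q (s q)" and ?c2 = "\<lambda>q. coef2 q (s q)"
    let ?U = "U \<inter> - C"
    have U': "open ?U" "p \<in> ?U" using U p open_compl_C by auto
    have c: "?c1 \<in> holo A ?U" "?c2 \<in> holo A ?U"
      using cdiff_coef1[OF U s] cdiff_coef2[OF U s] by (auto simp: holo_iff)
    have fU: "f \<in> holo A ?U" "g \<in> holo A ?U" using f g by (auto simp: holo_iff)
    have twice: "?X k (?X h s) p = Scl V (?b k (?b h ?c1) p) (s1 p) + Scl V (?b k (?b h ?c2) p) (s2 p)"
      if h: "h \<in> holo A U" "h \<in> holo A ?U" and k: "k \<in> holo A U" for h k
    proof -
      have co: "coef1 q (?X h s q) = ?b h ?c1 q" "coef2 q (?X h s q) = ?b h ?c2 q" if "q \<in> ?U" for q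
        using that poisson_op_dif_off_C[OF U s h(1), of q] coef1_comb coef2_comb by auto
      have d: "cdiff (?b h ?c1) p" "cdiff (?b h ?c2) p"
        using holo_poisson_bracket[OF \<sigma>_section U'(1) h(2)] c U'(2) by (auto simp: holo_iff)
      have "dif A (\<lambda>q. coef1 q (?X h s q)) p = dif A (?b h ?c1) p"
        "dif A (\<lambda>q. coef2 q (?X h s q)) p = dif A (?b h ?c2) p"
        by (rule dif_cong[OF d(1) U' co(1)[symmetric]], assumption)
           (rule dif_cong[OF d(2) U' co(2)[symmetric]], assumption)
      then show ?thesis
        unfolding poisson_op_dif_off_C[OF U sec[OF h(1) s] k p] by (simp add: poisson_bracket_def[of A \<sigma> k])
    qed
    show "?X f (?X g s) p = ?X (?b f g) s p + ?X g (?X f s) p"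
      unfolding twice[OF g fU(2) f] twice[OF f fU(1) g] poisson_op_dif_off_C[OF U s fg p]
        poisson_bracket_derivation[OF \<sigma>_section U'(1) fU c(1) U'(2)]
        poisson_bracket_derivation[OF \<sigma>_section U'(1) fU c(2) U'(2)]
      by (simp add: scl_simps)
  qed
  then show ?thesis by simp
qed

text \<open>Every covector is a differential, which reduces identities of \<open>poisson_op\<close> to the preceding ones.\<close>

lemma poisson_op_covector:
  assumes "open U" "p \<in> U" "\<alpha> \<in> Fib (dual_bundle T) p"
  obtains U' f where "open U'" "p \<in> U'" "U' \<subseteq> U" "f \<in> holo A U'" "dif A f p = \<alpha>"
proof -
  obtain c where c: "c \<in> A" "p \<in> cdom c" by (rule chart_at)
  obtain f where f: "f \<in> holo A (cdom c)" "dif A f p = \<alpha>" by (rule dual_T_eq_dif[OF c assms(3)])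
  show thesis
    by (rule that[of "U \<inter> cdom c" f]) (use assms c f in \<open>auto simp: holo_iff\<close>)
qed

lemma poisson_op_outside: "\<alpha> \<notin> Fib (dual_bundle T) p \<Longrightarrow> poisson_op s p \<alpha> = 0"
  by (simp add: poisson_op_def)

lemma Scl_hom: "Scl (hom_bundle F V) a L = (\<lambda>x. Scl V a (L x))"
  by (simp add: hom_bundle_def)

lemma Scl_dual: "Scl (dual_bundle F) a L = (\<lambda>x. a * L x)"
  by (simp add: hom_bundle_def trivial_line_def)

lemma poisson_op_sheaf_map: "sheaf_map A UNIV V (hom_bundle (dual_bundle T) V) (\<lambda>U. poisson_op)"
  unfolding sheaf_map_def
proof (intro conjI allI impI ballI; elim conjE)
  fix U s assume U: "open U" and s: "s \<in> sections A V U"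
  show "poisson_op s \<in> sections A (hom_bundle (dual_bundle T) V) U"
  proof (rule V.hom_sectionsI)
    fix p assume p: "p \<in> U"
    show "poisson_op s p \<in> Fib (hom_bundle (dual_bundle T) V) p"
      unfolding hom_bundle_def[of "dual_bundle T" V] hbundle.simps mem_Collect_eq
    proof (intro conjI ballI allI impI)
      fix \<alpha> assume \<alpha>: "\<alpha> \<in> Fib (dual_bundle T) p"
      show "poisson_op s p \<alpha> \<in> Fib V p" by (rule poisson_op_in)
      show "poisson_op s p (\<alpha> + \<beta>) = poisson_op s p \<alpha> + poisson_op s p \<beta>"
        if "\<beta> \<in> Fib (dual_bundle T) p" for \<beta>
        by (rule poisson_op_linear(1)[OF \<alpha> U s p that])
      show "poisson_op s p (Scl (dual_bundle T) a \<alpha>) = Scl V a (poisson_op s p \<alpha>)" for a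
        unfolding Scl_dual by (rule poisson_op_linear(2)[OF \<alpha> U s p])
    qed (rule poisson_op_outside)
  next
    fix W \<Phi> and k :: "1 \<times> 2" assume "(W, \<Phi>) \<in> Triv (dual_bundle T)"
    then obtain c where c: "c \<in> A" "W = cdom c"
      and fr: "\<And>p k. p \<in> cdom c \<Longrightarrow> frame (dual_bundle T) \<Phi> k p = dcoord c (snd k) p"
      using Triv_dual_T by blast
    let ?z = "\<lambda>q. coord c q $ snd k"
    have op: "open (U \<inter> cdom c)" using U c by auto
    have s': "s \<in> sections A V (U \<inter> cdom c)" using s V.sections_subset by blast
    have z: "?z \<in> holo A (U \<inter> cdom c)" using c by (simp add: holo_iff cdiff_coord)
    show "(\<lambda>q. poisson_op s q (frame (dual_bundle T) \<Phi> k q)) \<in> sections A V (U \<inter> W)"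
      unfolding c(2)
      by (rule V.sections_cong[OF op poisson_op_section[OF op s' z]]) (simp add: dif_coord[OF c(1)] fr)
  qed
next
  fix U U' s s' p
  assume a: "open U" "open U'" "U' \<subseteq> U" "s \<in> sections A V U" "s' \<in> sections A V U'"
    "\<forall>p\<in>U'. s' p = s p" "p \<in> U'"
  have "s \<in> sections A V U'" using a V.sections_subset by blast
  then show "poisson_op s' p = poisson_op s p"
    using poisson_op_cong[of U' s s' p] a by (simp add: fun_eq_iff)
next
  fix U s t p assume a: "open U" "s \<in> sections A V U" "t \<in> sections A V U" "p \<in> U"
  have "poisson_op (\<lambda>q. s q + t q) p \<alpha> = poisson_op s p \<alpha> + poisson_op t p \<alpha>" for \<alpha>
  proof (cases "\<alpha> \<in> Fib (dual_bundle T) p")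
    case True
    obtain U' f where U': "open U'" "p \<in> U'" "U' \<subseteq> U" "f \<in> holo A U'" "dif A f p = \<alpha>"
      by (rule poisson_op_covector[OF a(1,4) True])
    show ?thesis
      using poisson_op_add[OF U'(1) V.sections_subset[OF a(2) U'(3)] V.sections_subset[OF a(3) U'(3)] U'(4,2)]
      by (simp add: U'(5))
  qed (simp add: poisson_op_outside)
  then show "poisson_op (\<lambda>q. s q + t q) p = poisson_op s p + poisson_op t p" by (simp add: fun_eq_iff)
next
  fix U s a p assume U: "open U" and s: "s \<in> sections A V U" and p: "p \<in> U"
  have "poisson_op (\<lambda>q. Scl V a (s q)) p \<alpha> = Scl V a (poisson_op s p \<alpha>)" for \<alpha>
  proof (cases "\<alpha> \<in> Fib (dual_bundle T) p")
    case True
    obtain U' f where U': "open U'" "p \<in> U'" "U' \<subseteq> U" "f \<in> holo A U'" "dif A f p = \<alpha>"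
      by (rule poisson_op_covector[OF U p True])
    show ?thesis
      using poisson_op_scale[OF U'(1) V.sections_subset[OF s U'(3)] U'(4,2)] by (simp add: U'(5))
  qed (simp add: poisson_op_outside scl_simps)
  then show "poisson_op (\<lambda>q. Scl V a (s q)) p = Scl (hom_bundle (dual_bundle T) V) a (poisson_op s p)"
    by (simp add: fun_eq_iff Scl_hom)
qed

text \<open>By the Leibniz rule the commutator with \<open>g\<close> is the multiplication by \<open>{f, g}\<close>, which commutes with \<open>h\<close>.\<close>

lemma poisson_op_first_order: "first_order_op A V (hom_bundle (dual_bundle T) V) (\<lambda>U. poisson_op)"
  unfolding first_order_op_def
proof (intro conjI allI impI ballI poisson_op_sheaf_map; elim conjE)
  fix U g h s p
  assume U: "open U" and g: "g \<in> holo A U" and h: "h \<in> holo A U" and s: "s \<in> sections A V U" and p: "p \<in> U"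
  have "poisson_op (\<lambda>q. Scl V (g q * h q) (s q)) p \<alpha> - Scl V (g p) (poisson_op (\<lambda>q. Scl V (h q) (s q)) p \<alpha>)
      - Scl V (h p) (poisson_op (\<lambda>q. Scl V (g q) (s q)) p \<alpha>) + Scl V (g p * h p) (poisson_op s p \<alpha>) = 0" for \<alpha>
  proof (cases "\<alpha> \<in> Fib (dual_bundle T) p")
    case True
    obtain U' f where U': "open U'" "p \<in> U'" "U' \<subseteq> U" "f \<in> holo A U'" "dif A f p = \<alpha>"
      by (rule poisson_op_covector[OF U p True])
    have g': "g \<in> holo A U'" and h': "h \<in> holo A U'" using g h U'(3) by (auto simp: holo_iff)
    have gh: "(\<lambda>q. g q * h q) \<in> holo A U'" using g' h' by (auto simp: holo_iff)
    have d: "cdiff f p" "cdiff g p" "cdiff h p" using U' g' h' by (auto simp: holo_iff)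
    note L = poisson_op_leibniz[OF U'(1) V.sections_subset[OF s U'(3)] U'(4) _ U'(2), unfolded U'(5)]
    show ?thesis
      unfolding L[OF g'] L[OF h'] L[OF gh] poisson_bracket_mult[OF \<sigma>_section d]
      by (simp add: scl_simps mult.commute)
  qed (simp add: poisson_op_outside scl_simps)
  then show "poisson_op (\<lambda>q. Scl V (g q * h q) (s q)) p
      - Scl (hom_bundle (dual_bundle T) V) (g p) (poisson_op (\<lambda>q. Scl V (h q) (s q)) p)
      - Scl (hom_bundle (dual_bundle T) V) (h p) (poisson_op (\<lambda>q. Scl V (g q) (s q)) p)
      + Scl (hom_bundle (dual_bundle T) V) (g p * h p) (poisson_op s p) = 0"
    by (simp add: fun_eq_iff Scl_hom)
qed

lemma poisson_module: "poisson_module A \<sigma> V (\<lambda>U f s p. poisson_op s p (dif A f p))"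
  unfolding poisson_module_def
proof (intro conjI)
  show "poisson_structure A \<sigma>" by (rule poisson_structure[OF \<sigma>_section])
  show "holo_bundle A V" by (rule V)
  show "\<forall>U f. open U \<and> f \<in> holo A U \<longrightarrow> sheaf_map A U V V (\<lambda>U' s p. poisson_op s p (dif A f p))"
  proof (intro allI impI; elim conjE)
    fix U f assume U: "open U" and f: "f \<in> holo A U"
    have f': "f \<in> holo A U'" if "U' \<subseteq> U" for U' using f that by (auto simp: holo_iff)
    show "sheaf_map A U V V (\<lambda>U' s p. poisson_op s p (dif A f p))"
      unfolding sheaf_map_def
    proof (intro conjI allI impI ballI; elim conjE)
      fix U0 s assume "open U0" "U0 \<subseteq> U" "s \<in> sections A V U0"
      then show "(\<lambda>p. poisson_op s p (dif A f p)) \<in> sections A V U0" by (intro poisson_op_section f')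
    next
      fix U0 U' s s' p
      assume a: "open U0" "open U'" "U' \<subseteq> U0" "s \<in> sections A V U0" "s' \<in> sections A V U'"
        "\<forall>p\<in>U'. s' p = s p" "p \<in> U'"
      have "s \<in> sections A V U'" using a V.sections_subset by blast
      then show "poisson_op s' p (dif A f p) = poisson_op s p (dif A f p)"
        using poisson_op_cong[of U' s s' p] a by simp
    next
      fix U0 s t p assume "open U0" "U0 \<subseteq> U" "s \<in> sections A V U0" "t \<in> sections A V U0" "p \<in> U0"
      then show "poisson_op (\<lambda>q. s q + t q) p (dif A f p) = poisson_op s p (dif A f p) + poisson_op t p (dif A f p)"
        by (intro poisson_op_add f')
    next
      fix U0 s a p assume "open U0" "U0 \<subseteq> U" "s \<in> sections A V U0" "p \<in> U0"
      then show "poisson_op (\<lambda>q. Scl V a (s q)) p (dif A f p) = Scl V a (poisson_op s p (dif A f p))"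
        by (intro poisson_op_scale f')
    qed
  qed
  show "\<exists>D. first_order_op A V (hom_bundle (dual_bundle T) V) D \<and>
        (\<forall>U f s. open U \<and> f \<in> holo A U \<and> s \<in> sections A V U \<longrightarrow>
           (\<forall>p\<in>U. poisson_op s p (dif A f p) = D U s p (dif A f p)))"
    by (intro exI[of _ "\<lambda>U. poisson_op"] conjI poisson_op_first_order) simp
qed (intro allI impI ballI; elim conjE; rule poisson_op_leibniz poisson_op_bracket; assumption)+

lemma poisson_op_hamiltonian:
  assumes U: "open U" "U \<subseteq> - C" and f: "f \<in> holo A U" and s: "s \<in> sections A V U" and p: "p \<in> U"
  shows "poisson_op s p (dif A f p) = flat_nabla U s p (hamiltonian A \<sigma> f p)"
proof -
  have pC: "p \<notin> C" using U p by blast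
  have "cdiff f p" using f p by (simp add: holo_iff)
  note H = hamiltonian_props[OF \<sigma>_section this]
  show ?thesis
    unfolding poisson_op_dif_off_C[OF U(1) s f p pC] flat_nabla_def
    by (simp add: H cdiff_coef1[OF U(1) s p pC] cdiff_coef2[OF U(1) s p pC])
qed

end

theorem proposition1:
  fixes A :: "('m::{t2_space,second_countable_topology}, 2) chart set"
    and V :: "('m, 'v::ab_group_add, 2) hbundle"
    and \<theta> :: "'m \<Rightarrow> (('v \<Rightarrow> complex) \<Rightarrow> ('v \<Rightarrow> complex) \<Rightarrow> complex) \<Rightarrow> 'm bivector"
    and s1 s2 :: "'m \<Rightarrow> 'v"
    and \<sigma> :: "'m \<Rightarrow> 'm bivector"
    and C :: "'m set"
  assumes "complex_manifold A"
    and "holo_bundle A V"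
    and "bundle_iso A (ext2 V) (ext2 (tangent_bundle A)) \<theta>"
    and "s1 \<in> sections A V UNIV"
    and "s2 \<in> sections A V UNIV"
    and "closure {p. lin_indep2 V (s1 p) (s2 p)} = UNIV"
    and "\<sigma> = (\<lambda>p. \<theta> p (wedge V p (s1 p) (s2 p)))"
    and "C = {p. \<sigma> p = 0}"
  shows "(\<exists>nab. flat_connection A (- C) V nab \<and>
              (\<forall>p\<in>- C. nab (- C) s1 p = 0 \<and> nab (- C) s2 p = 0)) \<and>
         (\<forall>nab. flat_connection A (- C) V nab \<and>
              (\<forall>p\<in>- C. nab (- C) s1 p = 0 \<and> nab (- C) s2 p = 0) \<longrightarrow>
              (\<exists>br. poisson_module A \<sigma> V br \<and>
                 (\<forall>U f s. open U \<and> U \<subseteq> - C \<and> f \<in> holo A U \<and> s \<in> sections A V U \<longrightarrow>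
                    (\<forall>p\<in>U. br U f s p = nab U s p (hamiltonian A \<sigma> f p)))))"
proof -
  interpret wedge_poisson A V \<theta> s1 s2 \<sigma> C
    by unfold_locales fact+
  show ?thesis
  proof (intro conjI allI impI)
    show "\<exists>nab. flat_connection A (- C) V nab \<and> (\<forall>p\<in>- C. nab (- C) s1 p = 0 \<and> nab (- C) s2 p = 0)"
      using flat_connection_flat_nabla flat_nabla_s1_s2 by blast
    fix nab
    assume nab: "flat_connection A (- C) V nab \<and> (\<forall>p\<in>- C. nab (- C) s1 p = 0 \<and> nab (- C) s2 p = 0)"
    show "\<exists>br. poisson_module A \<sigma> V br \<and>
       (\<forall>U f s. open U \<and> U \<subseteq> - C \<and> f \<in> holo A U \<and> s \<in> sections A V U \<longrightarrow>
          (\<forall>p\<in>U. br U f s p = nab U s p (hamiltonian A \<sigma> f p)))"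
    proof (intro exI[of _ "\<lambda>U f s p. poisson_op s p (dif A f p)"] conjI poisson_module allI impI ballI; elim conjE)
      fix U f s p assume a: "open U" "U \<subseteq> - C" "f \<in> holo A U" "s \<in> sections A V U" "p \<in> U"
      have "cdiff f p" using a by (simp add: holo_iff)
      then have "hamiltonian A \<sigma> f p \<in> Fib T p" by (rule hamiltonian_props(1)[OF \<sigma>_section])
      with nab a show "poisson_op s p (dif A f p) = nab U s p (hamiltonian A \<sigma> f p)"
        using flat_connection_unique[of nab U s p] poisson_op_hamiltonian[of U f s p] by simp
    qed
  qed
qed

end
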